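(* Let $G=\mathrm{SO}(N)$, $\mathrm{SU}(N)$ or $\mathrm{Sp}(N/2)$ ($N$ even in the last case), with Lie algebra $\mathfrak g$, and let $W$ be the standard Brownian motion on $\mathfrak g$ at time $1$. Let $n\ge1$, let $K^{(1)},\dots,K^{(n)}\ge0$ be integers with $\sum_iK^{(i)}=2K$, and let $\pi$ be a pairing (fixed-point-free involution) of $[2K]$. Consider the $2^{K}$ ways to construct a collection of closed surfaces from the polygons $H^{(1)},\dots,H^{(n)}$ by applying to each of the $K$ pairs of edges matched by $\pi$ one of two operations: for $\mathrm{SO}(N)$ and $\mathrm{Sp}(N/2)$, glue the two edges with the same orientation or with the opposite orientation; for $\mathrm{SU}(N)$, contract both edges or glue them with the opposite orientation. Then the sum of $$\big\langle W_{a^{(1)}_1a^{(1)}_2},\dots,W_{a^{(1)}_{K^{(1)}}a^{(1)}_{K^{(1)}+1}},\;\dots,\;W_{a^{(n)}_1a^{(n)}_2},\dots,W_{a^{(n)}_{K^{(n)}}a^{(n)}_{K^{(n)}+1}}\big\rangle_{\pi}$$ over all $a^{(i)}_1,\dots,a^{(i)}_{K^{(i)}+1}\in[N]$ with $a^{(i)}_{K^{(i)}+1}=a^{(i)}_1$ ($1\le i\le n$) is equal to the sum, over these $2^K$ collections of surfaces, of $$\begin{cases}(-1)^{\alpha}N^{-n+\chi}&\text{if }G=\mathrm{SO}(N),\\(-1)^{\alpha}N^{-n-\gamma+\chi}&\text{if }G=\mathrm{SU}(N),\\(-1)^{\alpha+\mu}N^{-n+\chi}&\text{if }G=\mathrm{Sp}(N/2),\end{cases}$$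 where $\chi$ is the sum of the Euler characteristics of the surfaces, $\alpha$ is the number of pairs of edges glued with the opposite orientation, $\gamma$ is the number of contracted edges (two for each contracted pair), and $\mu$ is the sum of the non-orientable genera of the surfaces.
   Context: $[N]=\{1,\dots,N\}$. $\mathrm{Sp}(N/2)=\{S\in \mathrm U(N):S^tJS=J\}$ with $J=\begin{pmatrix}0&I_{N/2}\\-I_{N/2}&0\end{pmatrix}$. The inner product on $\mathfrak g$ is $\langle X,Y\rangle=N\operatorname{Tr}(X^*Y)$ for $\mathrm{SU}(N)$ and $\frac N2\operatorname{Tr}(X^*Y)$ for $\mathrm{SO}(N)$ and $\mathrm{Sp}(N/2)$. $W=\sum_jB^{(j)}X_j$ with $(X_j)$ an orthonormal basis of $\mathfrak g$ and $B^{(j)}$ independent standard real Gaussians; $W_{ab}$ are its matrix entries. For centered jointly Gaussian (complex) variables, $\langle Z_1,\dots,Z_{2K}\rangle_\pi:=\prod_{i<j,\ \pi(i)=j}\mathbb E[Z_iZ_j]$ (equal to $1$ if $K=0$). $H^{(i)}$ is a disk whose boundary is a directed cycle graph with $K^{(i)}$ edges, or a sphere if $K^{(i)}=0$. The $2K$ edges are numbered $1,\dots,2K$, in order from $i=1$ to $n$ and in cyclic order (following the direction) around each boundary; edge $p$ corresponds to the $p$-th variable in the list above, and $\pi$ matches edge $p$ with edge $\pi(p)$. Gluing with the opposite orientation identifies the initial vertex of each edge with the terminal vertex of the other; with the same orientation, initial with initial and terminal with terminal. Contracting collapses each of the two edges to a point. The non-orientable genus of a connected closed surface is $0$ if it is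 orientable and $2-\chi$ otherwise. *)

theory Defs
  imports "HOL-Probability.Probability" "Jordan_Normal_Form.Schur_Decomposition"
begin

section \<open>The groups, their Lie algebras and the Gaussian matrix\<close>

datatype lie_type = SO | SU | Sp

text \<open>
  All three groups are sets of complex \<open>N \<times> N\<close> matrices with rows and columns indexed by
  \<open>0, \<dots>, N - 1\<close>; \<open>lie_group Sp N\<close> is the group usually written \<open>Sp(N/2)\<close>, for even \<open>N\<close>.
\<close>

definition symp_J :: "nat \<Rightarrow> complex mat" where
  "symp_J N = (let h = N div 2 in four_block_mat (0\<^sub>m h h) (1\<^sub>m h) (- 1\<^sub>m h) (0\<^sub>m h h))"

definition unitary_mats :: "nat \<Rightarrow> complex mat set" where
  "unitary_mats N = {S \<in> carrier_mat N N. mat_adjoint S * S = 1\<^sub>m N}"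

fun lie_group :: "lie_type \<Rightarrow> nat \<Rightarrow> complex mat set" where
  "lie_group SO N = {S \<in> carrier_mat N N. (\<forall>a<N. \<forall>b<N. S $$ (a, b) \<in> \<real>) \<and>
                       transpose_mat S * S = 1\<^sub>m N \<and> Determinant.det S = 1}"
| "lie_group SU N = {S \<in> unitary_mats N. Determinant.det S = 1}"
| "lie_group Sp N = {S \<in> unitary_mats N. transpose_mat S * symp_J N * S = symp_J N}"

text \<open>
  The Lie algebra is the tangent space of the group at the identity: the velocities at time 0 of
  the curves in the group that pass through the identity at time 0 and are differentiable there.
\<close>

definition lie_algebra :: "lie_type \<Rightarrow> nat \<Rightarrow> complex mat set" where
  "lie_algebra G N = {X \<in> carrier_mat N N. \<exists>\<gamma> :: real \<Rightarrow> complex mat.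
     (\<forall>t. \<gamma> t \<in> lie_group G N) \<and> \<gamma> 0 = 1\<^sub>m N \<and>
     (\<forall>a<N. \<forall>b<N. ((\<lambda>t. \<gamma> t $$ (a, b)) has_vector_derivative X $$ (a, b)) (at 0))}"

definition mat_tr :: "complex mat \<Rightarrow> complex" where
  "mat_tr A = (\<Sum>a<dim_row A. A $$ (a, a))"

fun inner_scale :: "lie_type \<Rightarrow> nat \<Rightarrow> real" where
  "inner_scale SU N = real N"
| "inner_scale SO N = real N / 2"
| "inner_scale Sp N = real N / 2"

text \<open>The value is complex-valued only as a matter of typing: it is real on the Lie algebra.\<close>

definition lie_inner :: "lie_type \<Rightarrow> nat \<Rightarrow> complex mat \<Rightarrow> complex mat \<Rightarrow> complex" where
  "lie_inner G N X Y = of_real (inner_scale G N) * mat_tr (mat_adjoint X * Y)"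

definition real_lincomb :: "nat \<Rightarrow> nat \<Rightarrow> (nat \<Rightarrow> real) \<Rightarrow> (nat \<Rightarrow> complex mat) \<Rightarrow> complex mat" where
  "real_lincomb N d c X = mat N N (\<lambda>(a, b). \<Sum>j<d. of_real (c j) * X j $$ (a, b))"

definition lie_orthonormal_basis ::
    "lie_type \<Rightarrow> nat \<Rightarrow> nat \<Rightarrow> (nat \<Rightarrow> complex mat) \<Rightarrow> bool" where
  "lie_orthonormal_basis G N d X \<longleftrightarrow>
     (\<forall>j<d. X j \<in> lie_algebra G N) \<and>
     (\<forall>j<d. \<forall>l<d. lie_inner G N (X j) (X l) = (if j = l then 1 else 0)) \<and>
     (\<forall>Y\<in>lie_algebra G N. \<exists>c. Y = real_lincomb N d c X)"

definition std_gaussian_family :: "'w measure \<Rightarrow> nat \<Rightarrow> (nat \<Rightarrow> 'w \<Rightarrow> real) \<Rightarrow> bool" where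
  "std_gaussian_family M d B \<longleftrightarrow>
     prob_space.indep_vars M (\<lambda>_. borel) B {..<d} \<and>
     (\<forall>j<d. distributed M lborel (B j) std_normal_density)"


section \<open>Pairings\<close>

text \<open>The elements of \<open>[m]\<close> are numbered \<open>0, \<dots>, m - 1\<close>.\<close>

definition is_pairing :: "nat \<Rightarrow> (nat \<Rightarrow> nat) \<Rightarrow> bool" where
  "is_pairing m \<pi> \<longleftrightarrow> (\<forall>p<m. \<pi> p < m \<and> \<pi> p \<noteq> p \<and> \<pi> (\<pi> p) = p)"

definition matched_pairs :: "nat \<Rightarrow> (nat \<Rightarrow> nat) \<Rightarrow> (nat \<times> nat) set" where
  "matched_pairs m \<pi> = {(p, q). p < q \<and> q < m \<and> \<pi> p = q}"

definition pairing_bracket ::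
    "'w measure \<Rightarrow> (nat \<Rightarrow> nat) \<Rightarrow> ('w \<Rightarrow> complex) list \<Rightarrow> complex" where
  "pairing_bracket M \<pi> Zs =
     (\<Prod>(p, q)\<in>matched_pairs (length Zs) \<pi>. integral\<^sup>L M (\<lambda>\<omega>. (Zs ! p) \<omega> * (Zs ! q) \<omega>))"


section \<open>Polygons\<close>

text \<open>
  The polygons are given by the list \<open>ks\<close> of their numbers of edges. Side \<open>j < ks ! i\<close> of polygon
  \<open>i\<close> is the pair \<open>(i, j)\<close>; it leads from the corner \<open>(i, j)\<close> to the next corner in cyclic order.
  Side number \<open>p\<close> of the whole collection is \<open>sides ks ! p\<close>.

  A sphere (\<open>ks ! i = 0\<close>) is the cell complex with one face, no edge and one vertex \<open>(i, 0)\<close>.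
\<close>

definition sides :: "nat list \<Rightarrow> (nat \<times> nat) list" where
  "sides ks = [(i, j). i \<leftarrow> [0..<length ks], j \<leftarrow> [0..<ks ! i]]"

definition corners :: "nat list \<Rightarrow> (nat \<times> nat) set" where
  "corners ks = (SIGMA i:{..<length ks}. {..<max 1 (ks ! i)})"

definition polygon :: "nat list \<Rightarrow> nat \<Rightarrow> nat" where
  "polygon ks p = fst (sides ks ! p)"

definition initial_corner :: "nat list \<Rightarrow> nat \<Rightarrow> nat \<times> nat" where
  "initial_corner ks p = sides ks ! p"

definition terminal_corner :: "nat list \<Rightarrow> nat \<Rightarrow> nat \<times> nat" where
  "terminal_corner ks p = (case sides ks ! p of (i, j) \<Rightarrow> (i, Suc j mod (ks ! i)))"

text \<open>
  The families \<open>a(i, j)\<close>, \<open>0 \<le> j \<le> ks ! i\<close>, of matrix indices whose last member agrees with the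
  first one for each \<open>i\<close>. For \<open>ks ! i = 0\<close> this leaves one free index \<open>a(i, 0)\<close>.
\<close>

definition cyclic_indices :: "nat \<Rightarrow> nat list \<Rightarrow> (nat \<times> nat \<Rightarrow> nat) set" where
  "cyclic_indices N ks =
     {a \<in> (SIGMA i:{..<length ks}. {..ks ! i}) \<rightarrow>\<^sub>E {..<N}. \<forall>i<length ks. a (i, ks ! i) = a (i, 0)}"

definition entry_list ::
    "('w \<Rightarrow> complex mat) \<Rightarrow> nat list \<Rightarrow> (nat \<times> nat \<Rightarrow> nat) \<Rightarrow> ('w \<Rightarrow> complex) list" where
  "entry_list W ks a = map (\<lambda>(i, j) \<omega>. W \<omega> $$ (a (i, j), a (i, Suc j))) (sides ks)"


section \<open>Surfaces glued from polygons\<close>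

datatype side_op = Glue_Same | Glue_Opposite | Contract

fun allowed_ops :: "lie_type \<Rightarrow> side_op set" where
  "allowed_ops SO = {Glue_Same, Glue_Opposite}"
| "allowed_ops Sp = {Glue_Same, Glue_Opposite}"
| "allowed_ops SU = {Contract, Glue_Opposite}"

text \<open>
  A way to construct surfaces is a choice \<open>s\<close> of an operation for each matched pair of sides. The
  result is a closed surface with a cell structure: its faces are the polygons, its edges
  the glued pairs of sides (a contracted side disappears), and its vertices the classes of corners
  under the identifications that the operations generate.
\<close>

definition constructions ::
    "lie_type \<Rightarrow> nat list \<Rightarrow> (nat \<Rightarrow> nat) \<Rightarrow> (nat \<times> nat \<Rightarrow> side_op) set" where
  "constructions G ks \<pi> = matched_pairs (sum_list ks) \<pi> \<rightarrow>\<^sub>E allowed_ops G"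

definition glued_pairs ::
    "nat list \<Rightarrow> (nat \<Rightarrow> nat) \<Rightarrow> (nat \<times> nat \<Rightarrow> side_op) \<Rightarrow> (nat \<times> nat) set" where
  "glued_pairs ks \<pi> s = {x \<in> matched_pairs (sum_list ks) \<pi>. s x \<noteq> Contract}"

definition corner_identifications :: "nat list \<Rightarrow> side_op \<Rightarrow> nat \<times> nat \<Rightarrow> (nat \<times> nat) rel" where
  "corner_identifications ks w = (\<lambda>(p, q). case w of
     Glue_Same \<Rightarrow> {(initial_corner ks p, initial_corner ks q),
                   (terminal_corner ks p, terminal_corner ks q)}
   | Glue_Opposite \<Rightarrow> {(initial_corner ks p, terminal_corner ks q),
                       (terminal_corner ks p, initial_corner ks q)}
   | Contract \<Rightarrow> {(initial_corner ks p, terminal_corner ks p),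
                  (initial_corner ks q, terminal_corner ks q)})"

definition generated_equiv :: "'a rel \<Rightarrow> 'a rel" where
  "generated_equiv r = (r \<union> r\<inverse>)\<^sup>*"

definition corner_equiv ::
    "nat list \<Rightarrow> (nat \<Rightarrow> nat) \<Rightarrow> (nat \<times> nat \<Rightarrow> side_op) \<Rightarrow> (nat \<times> nat) rel" where
  "corner_equiv ks \<pi> s =
     generated_equiv (\<Union>x\<in>matched_pairs (sum_list ks) \<pi>. corner_identifications ks (s x) x)"

definition polygon_equiv ::
    "nat list \<Rightarrow> (nat \<Rightarrow> nat) \<Rightarrow> (nat \<times> nat \<Rightarrow> side_op) \<Rightarrow> nat rel" where
  "polygon_equiv ks \<pi> s =
     generated_equiv ((\<lambda>(p, q). (polygon ks p, polygon ks q)) ` glued_pairs ks \<pi> s)"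

text \<open>A connected surface is represented by the set of polygons it is glued from.\<close>

definition surfaces ::
    "nat list \<Rightarrow> (nat \<Rightarrow> nat) \<Rightarrow> (nat \<times> nat \<Rightarrow> side_op) \<Rightarrow> nat set set" where
  "surfaces ks \<pi> s = {..<length ks} // polygon_equiv ks \<pi> s"

definition surface_vertices ::
    "nat list \<Rightarrow> (nat \<Rightarrow> nat) \<Rightarrow> (nat \<times> nat \<Rightarrow> side_op) \<Rightarrow> nat set \<Rightarrow> (nat \<times> nat) set set" where
  "surface_vertices ks \<pi> s C = {v \<in> corners ks. fst v \<in> C} // corner_equiv ks \<pi> s"

definition surface_edges ::
    "nat list \<Rightarrow> (nat \<Rightarrow> nat) \<Rightarrow> (nat \<times> nat \<Rightarrow> side_op) \<Rightarrow> nat set \<Rightarrow> (nat \<times> nat) set" where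
  "surface_edges ks \<pi> s C = {(p, q) \<in> glued_pairs ks \<pi> s. polygon ks p \<in> C \<and> polygon ks q \<in> C}"

definition euler_char ::
    "nat list \<Rightarrow> (nat \<Rightarrow> nat) \<Rightarrow> (nat \<times> nat \<Rightarrow> side_op) \<Rightarrow> nat set \<Rightarrow> int" where
  "euler_char ks \<pi> s C =
     int (card (surface_vertices ks \<pi> s C)) - int (card (surface_edges ks \<pi> s C)) + int (card C)"

text \<open>
  A surface is orientable if its faces can be oriented coherently, that is, so that along each edge
  the two adjacent sides induce opposite directions. The choice \<open>\<epsilon> i\<close> says whether face \<open>i\<close> has
  the orientation given by the direction of its boundary cycle or the reverse one.
\<close>

definition orientable ::
    "nat list \<Rightarrow> (nat \<Rightarrow> nat) \<Rightarrow> (nat \<times> nat \<Rightarrow> side_op) \<Rightarrow> nat set \<Rightarrow> bool" where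
  "orientable ks \<pi> s C \<longleftrightarrow> (\<exists>\<epsilon> :: nat \<Rightarrow> bool. \<forall>(p, q)\<in>surface_edges ks \<pi> s C.
     (s (p, q) = Glue_Opposite \<longrightarrow> \<epsilon> (polygon ks p) = \<epsilon> (polygon ks q)) \<and>
     (s (p, q) = Glue_Same \<longrightarrow> \<epsilon> (polygon ks p) \<noteq> \<epsilon> (polygon ks q)))"

definition nonorientable_genus ::
    "nat list \<Rightarrow> (nat \<Rightarrow> nat) \<Rightarrow> (nat \<times> nat \<Rightarrow> side_op) \<Rightarrow> nat set \<Rightarrow> int" where
  "nonorientable_genus ks \<pi> s C = (if orientable ks \<pi> s C then 0 else 2 - euler_char ks \<pi> s C)"

definition total_euler ::
    "nat list \<Rightarrow> (nat \<Rightarrow> nat) \<Rightarrow> (nat \<times> nat \<Rightarrow> side_op) \<Rightarrow> int" where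
  "total_euler ks \<pi> s = (\<Sum>C\<in>surfaces ks \<pi> s. euler_char ks \<pi> s C)"

definition total_genus ::
    "nat list \<Rightarrow> (nat \<Rightarrow> nat) \<Rightarrow> (nat \<times> nat \<Rightarrow> side_op) \<Rightarrow> int" where
  "total_genus ks \<pi> s = (\<Sum>C\<in>surfaces ks \<pi> s. nonorientable_genus ks \<pi> s C)"

definition num_opposite ::
    "nat list \<Rightarrow> (nat \<Rightarrow> nat) \<Rightarrow> (nat \<times> nat \<Rightarrow> side_op) \<Rightarrow> int" where
  "num_opposite ks \<pi> s = int (card {x \<in> matched_pairs (sum_list ks) \<pi>. s x = Glue_Opposite})"

definition num_contracted_sides ::
    "nat list \<Rightarrow> (nat \<Rightarrow> nat) \<Rightarrow> (nat \<times> nat \<Rightarrow> side_op) \<Rightarrow> int" where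
  "num_contracted_sides ks \<pi> s =
     2 * int (card {x \<in> matched_pairs (sum_list ks) \<pi>. s x = Contract})"

fun surface_weight ::
    "lie_type \<Rightarrow> nat \<Rightarrow> nat list \<Rightarrow> (nat \<Rightarrow> nat) \<Rightarrow> (nat \<times> nat \<Rightarrow> side_op) \<Rightarrow> real" where
  "surface_weight SO N ks \<pi> s =
     (- 1) powi num_opposite ks \<pi> s * real N powi (- int (length ks) + total_euler ks \<pi> s)"
| "surface_weight SU N ks \<pi> s =
     (- 1) powi num_opposite ks \<pi> s *
     real N powi (- int (length ks) - num_contracted_sides ks \<pi> s + total_euler ks \<pi> s)"
| "surface_weight Sp N ks \<pi> s =
     (- 1) powi (num_opposite ks \<pi> s + total_genus ks \<pi> s) *
     real N powi (- int (length ks) + total_euler ks \<pi> s)"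

end

theory Submission
  imports Defs
begin

text \<open>
  The tangent space is given by explicit linear equations (differentiate the group equations;
  conversely use Cayley transforms), so the covariance \<open>\<Sum>j. X j \<otimes> X j\<close> of the entries of \<open>W\<close> is the
  orthogonal projection of the matrix units. It is a sum of two terms, one for each operation on the
  two sides. Expanding the product over the pairs, every choice of operations contributes the number
  of labels of corners that are constant on vertices, \<open>N\<close> to the number of vertices, up to a scalar.

  For \<open>Sp\<close>, labels are instead flipped by \<open>J\<close> across an edge glued with the same orientation, and
  each label contributes a sign. Faces, edges and vertices are the cycles of three permutations of the
  corners; comparing their signs, for a suitable permutation walking around the vertices, shows that
  this sign is \<open>-1\<close> to the total Euler characteristic. The same comparison with a coherent orientation
  in place of the signs shows that an orientable surface has even Euler characteristic. Hence the
  sign is \<open>-1\<close> to the total non-orientable genus.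
\<close>

section \<open>The Lie algebras\<close>

text \<open>Vertices are the delicate cells. Faces and edges are the cycles of the boundary rotation
  and of the pairing, but composing these two permutations winds around the vertices only if every
  gluing is opposite: a same-orientation gluing reverses the sense of rotation. What saves the count
  is local. The corners at a vertex are cyclically arranged even on a non-orientable surface, so a
  sense of rotation can be chosen vertex by vertex, though in general not polygon by polygon. Such a
  choice is a Boolean function on corners that changes across same-orientation gluings and is kept
  by opposite ones. It occurs in three guises: as an auxiliary choice that turns flipped labels into
  constant ones, as a coherent orientation of the faces, and as the half of the index range in which
  a symplectic label lies. In the last guise the sign of a label is the parity of the number of
  same-orientation edges along which the function changes, which is why all admissible labels have
  the same sign. For non-orientable surfaces the step to the genus is immediate, since 2 - \<chi>
  and \<chi> have the same parity.\<close>

lemma mat_mult_entry: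
  "A \<in> carrier_mat n m \<Longrightarrow> B \<in> carrier_mat m k \<Longrightarrow> i < n \<Longrightarrow> j < k \<Longrightarrow>
     (A * B) $$ (i, j) = (\<Sum>l<m. A $$ (i, l) * B $$ (l, j))"
  by (auto simp: scalar_prod_def atLeast0LessThan intro!: sum.cong)

lemma dim_mat_adjoint [simp]:
  "dim_row (mat_adjoint A) = dim_col A" "dim_col (mat_adjoint A) = dim_row A"
  by (simp_all only: mat_adjoint_def mat_of_rows_carrier length_map cols_length)

lemma mat_adjoint_carrier [intro]: "A \<in> carrier_mat n m \<Longrightarrow> mat_adjoint A \<in> carrier_mat m n"
  by (rule carrier_matI) auto

lemma mat_adjoint_entry:
  fixes A :: "complex mat"
  shows "A \<in> carrier_mat n m \<Longrightarrow> i < m \<Longrightarrow> j < n \<Longrightarrow> mat_adjoint A $$ (i, j) = cnj (A $$ (j, i))"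
  by (simp add: mat_adjoint_def mat_of_rows_def conjugate_complex_def)

lemma mat_adjoint_mult:
  fixes A B :: "complex mat"
  assumes "A \<in> carrier_mat n m" and "B \<in> carrier_mat m k"
  shows "mat_adjoint (A * B) = mat_adjoint B * mat_adjoint A"
proof (rule eq_matI)
  have AB: "A * B \<in> carrier_mat n k" using assms by auto
  have c: "mat_adjoint A \<in> carrier_mat m n" "mat_adjoint B \<in> carrier_mat k m"
    "mat_adjoint (A * B) \<in> carrier_mat k n" using assms AB by auto
  show d: "dim_row (mat_adjoint (A * B)) = dim_row (mat_adjoint B * mat_adjoint A)"
    "dim_col (mat_adjoint (A * B)) = dim_col (mat_adjoint B * mat_adjoint A)" by auto
  fix i j assume "i < dim_row (mat_adjoint B * mat_adjoint A)" "j < dim_col (mat_adjoint B * mat_adjoint A)"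
  then have ij: "i < k" "j < n" using c by auto
  show "mat_adjoint (A * B) $$ (i, j) = (mat_adjoint B * mat_adjoint A) $$ (i, j)"
    using ij assms c AB
    by (simp add: mat_adjoint_entry[OF AB] mat_mult_entry[of _ n m _ k] mat_mult_entry[of _ k m _ n]
          mat_adjoint_entry[OF assms(1)] mat_adjoint_entry[OF assms(2)] mult.commute del: index_mult_mat)
qed

lemma mat_adjoint_one_plus:
  fixes A :: "complex mat"
  assumes "A \<in> carrier_mat n n"
  shows "mat_adjoint (1\<^sub>m n + A) = 1\<^sub>m n + mat_adjoint A" and "mat_adjoint (1\<^sub>m n - A) = 1\<^sub>m n - mat_adjoint A"
proof -
  have c: "mat_adjoint A \<in> carrier_mat n n" "1\<^sub>m n + A \<in> carrier_mat n n" "1\<^sub>m n - A \<in> carrier_mat n n"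
    using assms by auto
  show "mat_adjoint (1\<^sub>m n + A) = 1\<^sub>m n + mat_adjoint A" "mat_adjoint (1\<^sub>m n - A) = 1\<^sub>m n - mat_adjoint A"
    by (rule eq_matI; use assms in \<open>auto simp: mat_adjoint_entry[OF c(2)] mat_adjoint_entry[OF c(3)] mat_adjoint_entry[OF assms]\<close>)+
qed

lemma mat_adjoint_one [simp]: "mat_adjoint (1\<^sub>m n :: complex mat) = 1\<^sub>m n"
by (rule eq_matI) (auto simp: mat_adjoint_entry[of _ n n])

section \<open>The symplectic form as a signed permutation of the indices\<close>

lemma symp_J_carrier: "even N \<Longrightarrow> symp_J N \<in> carrier_mat N N"
  by (rule carrier_matI) (simp_all add: symp_J_def Let_def flip: mult_2)

definition symp_flip :: "nat \<Rightarrow> nat \<Rightarrow> nat" where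
  "symp_flip N a = (if a < N div 2 then a + N div 2 else a - N div 2)"

definition symp_sign :: "nat \<Rightarrow> nat \<Rightarrow> complex" where
  "symp_sign N a = (if a < N div 2 then 1 else - 1)"

lemma symp_J_entry:
  assumes "even N" "a < N" "b < N"
  shows "symp_J N $$ (a, b) = (if b = symp_flip N a then symp_sign N a else 0)"
proof -
  obtain h where "N = 2 * h" using assms(1) by (rule evenE)
  then show ?thesis using assms(2,3) by (auto simp: symp_J_def Let_def symp_flip_def symp_sign_def)
qed

lemma symp_flip:
  assumes "even N" "a < N"
  shows "symp_flip N a < N" and "symp_flip N (symp_flip N a) = a" and "symp_flip N a \<noteq> a"
    and "symp_sign N (symp_flip N a) = - symp_sign N a"
proof -
  obtain h where "N = 2 * h" using assms(1) by (rule evenE)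
  then show "symp_flip N a < N" "symp_flip N (symp_flip N a) = a" "symp_flip N a \<noteq> a"
    "symp_sign N (symp_flip N a) = - symp_sign N a"
    using assms(2) by (auto simp: symp_flip_def symp_sign_def)
qed

section \<open>Linear equations for the tangent spaces\<close>

fun infinitesimal :: "lie_type \<Rightarrow> nat \<Rightarrow> complex mat \<Rightarrow> bool" where
  "infinitesimal SO N X \<longleftrightarrow> (\<forall>a<N. \<forall>b<N. X $$ (a, b) \<in> \<real>)"
| "infinitesimal SU N X \<longleftrightarrow> (\<Sum>a<N. X $$ (a, a)) = 0"
| "infinitesimal Sp N X \<longleftrightarrow> (\<forall>a<N. \<forall>b<N.
     (\<Sum>c<N. X $$ (c, a) * symp_J N $$ (c, b)) + (\<Sum>c<N. symp_J N $$ (a, c) * X $$ (c, b)) = 0)"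

text \<open>All three groups consist of unitary matrices, hence the common antihermitian condition;
  \<open>infinitesimal\<close> carries what each group adds. For SO the addition is reality, which
  makes \<open>X\<close> real and skew-symmetric.\<close>

definition lie_equations :: "lie_type \<Rightarrow> nat \<Rightarrow> complex mat set" where
  "lie_equations G N = {X \<in> carrier_mat N N.
     (\<forall>a<N. \<forall>b<N. cnj (X $$ (b, a)) = - X $$ (a, b)) \<and> infinitesimal G N X}"

lemma lie_group_unitary:
  assumes "S \<in> lie_group G N"
  shows "S \<in> unitary_mats N"
proof (cases G)
  case SO
  then have S: "S \<in> carrier_mat N N" "transpose_mat S * S = 1\<^sub>m N" "\<And>a b. a < N \<Longrightarrow> b < N \<Longrightarrow> S $$ (a, b) \<in> \<real>"
    using assms by auto
  have "mat_adjoint S = transpose_mat S"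
    using S(1) S(3)
    by (intro eq_matI) (auto simp: mat_adjoint_entry[OF S(1)] Reals_cnj_iff)
  then show ?thesis using S by (simp add: unitary_mats_def)
qed (use assms in auto)

text \<open>In the Leibniz expansion a permutation other than the identity moves at least two
  indices. Differentiating one factor leaves another off-diagonal entry of the identity matrix, so
  only the diagonal product contributes, and it gives the trace.\<close>

lemma det_has_vector_derivative_at_one:
  fixes \<gamma> :: "real \<Rightarrow> complex mat"
  assumes car: "\<And>t. \<gamma> t \<in> carrier_mat N N" and one: "\<gamma> 0 = 1\<^sub>m N"
    and der: "\<And>a b. a < N \<Longrightarrow> b < N \<Longrightarrow> ((\<lambda>t. \<gamma> t $$ (a, b)) has_vector_derivative X a b) (at 0)"
  shows "((\<lambda>t. Determinant.det (\<gamma> t)) has_vector_derivative (\<Sum>a<N. X a a)) (at 0)"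
proof -
  let ?P = "{p. p permutes {0..<N}}"
  let ?D = "\<lambda>p. \<Sum>i\<in>{0..<N}. X i (p i) * (\<Prod>j\<in>{0..<N} - {i}. \<gamma> 0 $$ (j, p j))"
  have prod: "((\<lambda>t. \<Prod>i\<in>{0..<N}. \<gamma> t $$ (i, p i)) has_vector_derivative ?D p) (at 0)" if p: "p \<in> ?P" for p
  proof -
    have "((\<lambda>t. \<Prod>i\<in>{0..<N}. \<gamma> t $$ (i, p i)) has_derivative
        (\<lambda>y. \<Sum>i\<in>{0..<N}. (y *\<^sub>R X i (p i)) * (\<Prod>j\<in>{0..<N} - {i}. \<gamma> 0 $$ (j, p j)))) (at 0)"
    proof (rule has_derivative_prod)
      fix i assume "i \<in> {0..<N}"
      then show "((\<lambda>t. \<gamma> t $$ (i, p i)) has_derivative (\<lambda>y. y *\<^sub>R X i (p i))) (at 0)"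
        using der[of i "p i"] p permutes_in_image[of p "{0..<N}" i] by (simp add: has_vector_derivative_def)
    qed
    then show ?thesis by (simp add: has_vector_derivative_def scaleR_sum_right)
  qed
  have D: "?D p = (if p = id then \<Sum>a<N. X a a else 0)" if p: "p \<in> ?P" for p
  proof (cases "p = id")
    case True
    have "(\<Prod>j\<in>{0..<N} - {i}. \<gamma> 0 $$ (j, p j)) = 1" for i
      by (rule prod.neutral) (auto simp: one True)
    then show ?thesis using True by (simp add: atLeast0LessThan)
  next
    case False
    have "(\<Prod>j\<in>{0..<N} - {i}. \<gamma> 0 $$ (j, p j)) = 0" if i: "i \<in> {0..<N}" for i
    proof -
      obtain k where k: "p k \<noteq> k" using False by (auto simp: fun_eq_iff)
      have inj: "p (p k) \<noteq> p k" using k p by (auto dest: permutes_inj injD)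
      have kN: "k \<in> {0..<N}" "p k \<in> {0..<N}" using k p permutes_not_in permutes_in_image by fastforce+
      \<comment> \<open>Of the two moved points \<open>k\<close> and \<open>p k\<close>, at least
        one differs from \<open>i\<close>; its factor vanishes.\<close>
      obtain j where "j \<in> {0..<N} - {i}" "p j \<noteq> j" using k inj kN by (cases "k = i") auto
      then show ?thesis using p permutes_in_image[of p "{0..<N}" j]
        by (intro prod_zero) (auto simp: one intro!: bexI[of _ j])
    qed
    then have "?D p = 0" by (intro sum.neutral) (simp del: prod_zero_iff)
    then show ?thesis using False by simp
  qed
  have "((\<lambda>t. \<Sum>p\<in>?P. signof p * (\<Prod>i\<in>{0..<N}. \<gamma> t $$ (i, p i))) has_vector_derivative
      (\<Sum>p\<in>?P. signof p * ?D p)) (at 0)"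
    by (intro has_vector_derivative_sum has_vector_derivative_mult_right prod)
  moreover have "(\<Sum>p\<in>?P. signof p * ?D p) = (\<Sum>p\<in>?P. if p = id then \<Sum>a<N. X a a else 0)"
    by (intro sum.cong refl) (simp add: D)
  moreover have "\<dots> = (\<Sum>a<N. X a a)"
    by (simp add: finite_permutations permutes_id)
  ultimately show ?thesis by (simp add: det_def'[OF car])
qed

lemma lie_algebra_subset_equations:
  assumes "G = Sp \<Longrightarrow> even N"
  shows "lie_algebra G N \<subseteq> lie_equations G N"
proof
  fix X assume "X \<in> lie_algebra G N"
  then obtain \<gamma> where X: "X \<in> carrier_mat N N" and grp: "\<And>t. \<gamma> t \<in> lie_group G N" and one: "\<gamma> 0 = 1\<^sub>m N"
    and der: "\<And>a b. a < N \<Longrightarrow> b < N \<Longrightarrow> ((\<lambda>t. \<gamma> t $$ (a, b)) has_vector_derivative X $$ (a, b)) (at 0)"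
    by (auto simp: lie_algebra_def)
  have U: "\<gamma> t \<in> carrier_mat N N" "mat_adjoint (\<gamma> t) * \<gamma> t = 1\<^sub>m N" for t
    using lie_group_unitary[OF grp[of t]] by (auto simp: unitary_mats_def)
  \<comment> \<open>Every group equation says that some function of \<open>\<gamma> t\<close> is
    constant. Its velocity at 0 must vanish, and evaluating that velocity gives a linear equation
    for \<open>X\<close>.\<close>
  have zero: "D = 0" if "(f has_vector_derivative D) (at (0::real))" "\<And>t. f t = k" for f D and k :: "'a :: real_normed_vector"
    using vector_derivative_unique_at[OF that(1), of 0] that(2) has_vector_derivative_const[of k]
    by (metis (no_types) ext)
  have anti: "cnj (X $$ (b, a)) = - X $$ (a, b)" if ab: "a < N" "b < N" for a b
  proof -
    have "((\<lambda>t. \<Sum>c<N. cnj (\<gamma> t $$ (c, a)) * \<gamma> t $$ (c, b)) has_vector_derivative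
       (\<Sum>c<N. cnj (\<gamma> 0 $$ (c, a)) * X $$ (c, b) + cnj (X $$ (c, a)) * \<gamma> 0 $$ (c, b))) (at 0)"
      by (intro has_vector_derivative_sum has_vector_derivative_mult has_vector_derivative_cnj der) (use ab in auto)
    moreover have "(\<Sum>c<N. cnj (\<gamma> t $$ (c, a)) * \<gamma> t $$ (c, b)) = (1\<^sub>m N :: complex mat) $$ (a, b)" for t
      using ab U[of t] mat_mult_entry[OF mat_adjoint_carrier[OF U(1)] U(1), of a b t t]
      by (simp add: mat_adjoint_entry[OF U(1)] del: index_one_mat)
    ultimately have "(\<Sum>c<N. cnj (\<gamma> 0 $$ (c, a)) * X $$ (c, b) + cnj (X $$ (c, a)) * \<gamma> 0 $$ (c, b)) = 0"
      by (rule zero)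
    moreover have "(\<Sum>c<N. cnj (\<gamma> 0 $$ (c, a)) * X $$ (c, b) + cnj (X $$ (c, a)) * \<gamma> 0 $$ (c, b)) =
        (\<Sum>c<N. (if c = a then X $$ (c, b) else 0) + (if c = b then cnj (X $$ (c, a)) else 0))"
      by (intro sum.cong) (use ab in \<open>auto simp: one\<close>)
    ultimately have "X $$ (a, b) + cnj (X $$ (b, a)) = 0" using ab by (simp add: sum.distrib)
    then show ?thesis by (simp add: add_eq_0_iff)
  qed
  have "infinitesimal G N X"
  proof (cases G)
    case SO
    have "X $$ (a, b) \<in> \<real>" if ab: "a < N" "b < N" for a b
    proof -
      have "((\<lambda>t. Im (\<gamma> t $$ (a, b))) has_vector_derivative Im (X $$ (a, b))) (at 0)"
        by (rule bounded_linear.has_vector_derivative[OF bounded_linear_Im der[OF ab]])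
      moreover have "Im (\<gamma> t $$ (a, b)) = 0" for t using grp[of t] ab SO by (auto simp: complex_is_Real_iff)
      ultimately show ?thesis unfolding complex_is_Real_iff by (rule zero)
    qed
    then show ?thesis by (simp add: SO)
  next
    case SU
    have "((\<lambda>t. Determinant.det (\<gamma> t)) has_vector_derivative (\<Sum>a<N. X $$ (a, a))) (at 0)"
      by (rule det_has_vector_derivative_at_one[OF U(1) one der])
    then have "(\<Sum>a<N. X $$ (a, a)) = 0" by (rule zero[of _ _ 1]) (use grp SU in auto)
    then show ?thesis by (simp add: SU)
  next
    case Sp
    note J = symp_J_carrier[OF assms[OF Sp]]
    show ?thesis unfolding Sp infinitesimal.simps
    proof (intro allI impI)
      fix a b assume ab: "a < N" "b < N"
      let ?J = "\<lambda>a b. symp_J N $$ (a, b)"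
      have "((\<lambda>t. \<Sum>d<N. (\<Sum>c<N. \<gamma> t $$ (c, a) * ?J c d) * \<gamma> t $$ (d, b)) has_vector_derivative
         (\<Sum>d<N. (\<Sum>c<N. \<gamma> 0 $$ (c, a) * ?J c d) * X $$ (d, b) + (\<Sum>c<N. X $$ (c, a) * ?J c d) * \<gamma> 0 $$ (d, b))) (at 0)"
        by (intro has_vector_derivative_sum has_vector_derivative_mult has_vector_derivative_mult_left der) (use ab in auto)
      moreover have "(\<Sum>d<N. (\<Sum>c<N. \<gamma> t $$ (c, a) * ?J c d) * \<gamma> t $$ (d, b)) = ?J a b" for t
      proof -
        have T: "transpose_mat (\<gamma> t) \<in> carrier_mat N N" using U(1) by simp
        have TJ: "transpose_mat (\<gamma> t) * symp_J N \<in> carrier_mat N N" using T J by (rule mult_carrier_mat)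
        have "?J a b = (transpose_mat (\<gamma> t) * symp_J N * \<gamma> t) $$ (a, b)" using grp[of t] Sp by simp
        also have "\<dots> = (\<Sum>d<N. (\<Sum>c<N. \<gamma> t $$ (c, a) * ?J c d) * \<gamma> t $$ (d, b))"
          unfolding mat_mult_entry[OF TJ U(1) ab]
          by (intro sum.cong refl arg_cong2[of _ _ _ _ "(*)"], subst mat_mult_entry[OF T J])
            (use ab U(1)[of t] in auto)
        finally show ?thesis by simp
      qed
      ultimately have "(\<Sum>d<N. (\<Sum>c<N. \<gamma> 0 $$ (c, a) * ?J c d) * X $$ (d, b) + (\<Sum>c<N. X $$ (c, a) * ?J c d) * \<gamma> 0 $$ (d, b)) = 0"
        by (rule zero)
      moreover have "(\<Sum>c<N. \<gamma> 0 $$ (c, a) * ?J c d) = ?J a d" for d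
      proof -
        have "(\<Sum>c<N. \<gamma> 0 $$ (c, a) * ?J c d) = (\<Sum>c<N. if c = a then ?J c d else 0)"
          by (intro sum.cong) (use ab in \<open>auto simp: one\<close>)
        then show ?thesis using ab by simp
      qed
      moreover have "(\<Sum>d<N. (\<Sum>c<N. X $$ (c, a) * ?J c d) * \<gamma> 0 $$ (d, b)) = (\<Sum>c<N. X $$ (c, a) * ?J c b)"
      proof -
        have "(\<Sum>d<N. (\<Sum>c<N. X $$ (c, a) * ?J c d) * \<gamma> 0 $$ (d, b)) =
            (\<Sum>d<N. if d = b then (\<Sum>c<N. X $$ (c, a) * ?J c d) else 0)"
          by (intro sum.cong) (use ab in \<open>auto simp: one\<close>)
        then show ?thesis using ab by simp
      qed
      ultimately show "(\<Sum>c<N. X $$ (c, a) * ?J c b) + (\<Sum>c<N. ?J a c * X $$ (c, b)) = 0"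
        by (simp add: sum.distrib add.commute)
    qed
  qed
  then show "X \<in> lie_equations G N" using X anti by (simp add: lie_equations_def)
qed

section \<open>Curves of prescribed velocity through Cayley transforms\<close>

lemma cayley_preserves_form:
  fixes A B R R' J :: "complex mat"
  assumes A: "A \<in> carrier_mat n n" and B: "B \<in> carrier_mat n n" and J: "J \<in> carrier_mat n n"
    and R: "R \<in> carrier_mat n n" and R': "R' \<in> carrier_mat n n"
    and BJ: "B * J = - (J * A)"
    and inv: "(1\<^sub>m n - A) * R = 1\<^sub>m n" and inv': "R' * (1\<^sub>m n - B) = 1\<^sub>m n"
  shows "R' * (1\<^sub>m n + B) * J * ((1\<^sub>m n + A) * R) = J"
proof -
  let ?I = "1\<^sub>m n :: complex mat"
  have car: "?I \<in> carrier_mat n n" "?I + A \<in> carrier_mat n n" "?I - A \<in> carrier_mat n n"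
    "?I + B \<in> carrier_mat n n" "?I - B \<in> carrier_mat n n" using A B by auto
  have JA: "J * A \<in> carrier_mat n n" "B * (J * A) \<in> carrier_mat n n" using A B J by auto
  have "(?I + B) * (J * (?I + A)) = (?I + B) * (J + J * A)"
    using J A by (simp add: mult_add_distrib_mat[OF J car(1) A])
  also have "\<dots> = (J + J * A) + B * (J + J * A)"
    using J A B JA by (subst add_mult_distrib_mat[OF car(1) B]) auto
  also have "\<dots> = (J + J * A) + (- (J * A) + B * (J * A))"
    using mult_add_distrib_mat[OF B J JA(1)] BJ by simp
  finally have plus: "(?I + B) * (J * (?I + A)) = (J + J * A) + (- (J * A) + B * (J * A))" .
  have "(?I - B) * (J * (?I - A)) = (?I - B) * (J - J * A)"
    using J A by (simp add: mult_minus_distrib_mat[OF J car(1) A])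
  also have "\<dots> = (J - J * A) - B * (J - J * A)"
    using J A B JA by (subst minus_mult_distrib_mat[OF car(1) B]) auto
  also have "\<dots> = (J - J * A) - (- (J * A) - B * (J * A))"
    using mult_minus_distrib_mat[OF B J JA(1)] BJ by simp
  finally have minus: "(?I - B) * (J * (?I - A)) = (J - J * A) - (- (J * A) - B * (J * A))" .
  \<comment> \<open>The two products differ by twice \<open>B * J + J * A\<close>, which is zero by
    hypothesis. This equality lets both inverse factors cancel.\<close>
  have eq: "(?I + B) * (J * (?I + A)) = (?I - B) * (J * (?I - A))"
  proof -
    have "(J + U) + (- U + V) = (J - U) - (- U - V)" if "U \<in> carrier_mat n n" "V \<in> carrier_mat n n" for U V
      by (rule eq_matI) (use J that in auto)
    from this[OF JA] show ?thesis unfolding plus minus .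
  qed
  have m: "P * Q \<in> carrier_mat n n" if "P \<in> carrier_mat n n" "Q \<in> carrier_mat n n" for P Q :: "complex mat"
    using that by auto
  have as: "P * Q * T = P * (Q * T)" if "P \<in> carrier_mat n n" "Q \<in> carrier_mat n n" "T \<in> carrier_mat n n"
    for P Q T :: "complex mat"
    using that by (rule assoc_mult_mat)
  have "R' * (?I + B) * J * ((?I + A) * R) = R' * ((?I + B) * (J * (?I + A)) * R)"
    by (simp add: as m car J R R' A B)
  also have "\<dots> = (R' * (?I - B)) * (J * ((?I - A) * R))"
    unfolding eq by (simp add: as m car J R R' A B)
  also have "\<dots> = J" using J by (simp add: inv inv')
  finally show ?thesis .
qed

text \<open>The columns of a unitary matrix are unit vectors. The bound controls the remainder of a
  Cayley curve without any estimate of an inverse matrix.\<close>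

lemma unitary_entry_le_1:
  assumes "S \<in> unitary_mats N" "a < N" "b < N"
  shows "cmod (S $$ (a, b)) \<le> 1"
proof -
  have S: "S \<in> carrier_mat N N" "mat_adjoint S * S = 1\<^sub>m N" using assms by (auto simp: unitary_mats_def)
  have "(\<Sum>c<N. cnj (S $$ (c, b)) * S $$ (c, b)) = 1"
    using mat_mult_entry[OF mat_adjoint_carrier[OF S(1)] S(1), of b b] assms S
    by (simp add: mat_adjoint_entry[OF S(1)])
  then have "complex_of_real (\<Sum>c<N. (cmod (S $$ (c, b)))\<^sup>2) = 1"
    by (simp add: complex_norm_square[symmetric] mult.commute)
  then have "(\<Sum>c<N. (cmod (S $$ (c, b)))\<^sup>2) = 1" by (simp only: of_real_eq_1_iff)
  moreover have "(cmod (S $$ (a, b)))\<^sup>2 \<le> (\<Sum>c<N. (cmod (S $$ (c, b)))\<^sup>2)"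
    using assms by (intro member_le_sum) auto
  ultimately show ?thesis by (simp add: power2_le_imp_le)
qed

text \<open>The Cayley transform of a traceless antihermitian matrix is unitary but in general not
  of determinant 1, so for SU the determinant condition is dropped here and restored later. For SO
  the transform already has determinant 1.\<close>

fun lie_group_any_det :: "lie_type \<Rightarrow> nat \<Rightarrow> complex mat set" where
  "lie_group_any_det SU N = unitary_mats N"
| "lie_group_any_det G N = lie_group G N"

lemma one_in_lie_group: "G \<noteq> Sp \<or> even N \<Longrightarrow> 1\<^sub>m N \<in> lie_group G N"
  using symp_J_carrier[of N] by (cases G) (auto simp: unitary_mats_def)

text \<open>Three forms are preserved by the same computation: the identity with the adjoint for
  unitarity, the identity with the transpose for orthogonality, and \<open>symp_J N\<close> with the
  transpose for Sp. The conclusion is multiplied by the denominator, so that it is an equation for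
  the entries of \<open>C\<close> free of inverses.\<close>

lemma cayley_transform:
  assumes even: "G = Sp \<Longrightarrow> even N" and X: "X \<in> lie_equations G N" and
    det: "Determinant.det (1\<^sub>m N - complex_of_real t \<cdot>\<^sub>m X) \<noteq> 0"
  shows "\<exists>C \<in> lie_group_any_det G N. C * (1\<^sub>m N - complex_of_real t \<cdot>\<^sub>m X) = 1\<^sub>m N + complex_of_real t \<cdot>\<^sub>m X"
proof -
  define A where "A = complex_of_real t \<cdot>\<^sub>m X"
  have XC: "X \<in> carrier_mat N N" and anti: "\<And>a b. a < N \<Longrightarrow> b < N \<Longrightarrow> cnj (X $$ (b, a)) = - X $$ (a, b)"
    and inft: "infinitesimal G N X"
    using X by (auto simp: lie_equations_def)
  have A: "A \<in> carrier_mat N N" using XC by (simp add: A_def)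
  let ?I = "1\<^sub>m N :: complex mat"
  have P: "?I - A \<in> carrier_mat N N" "?I + A \<in> carrier_mat N N" using A by auto
  define R where "R = inverse (Determinant.det (?I - A)) \<cdot>\<^sub>m adj_mat (?I - A)"
  have d: "Determinant.det (?I - A) \<noteq> 0" using det by (simp add: A_def)
  have R: "R \<in> carrier_mat N N" using adj_mat(1)[OF P(1)] by (simp add: R_def)
  have "inverse (Determinant.det (?I - A)) \<cdot>\<^sub>m (Determinant.det (?I - A) \<cdot>\<^sub>m ?I) = ?I"
    by (rule eq_matI) (use d in auto)
  then have PR: "(?I - A) * R = ?I" and RP: "R * (?I - A) = ?I"
    unfolding R_def mult_smult_distrib[OF P(1) adj_mat(1)[OF P(1)]]
      mult_smult_assoc_mat[OF adj_mat(1)[OF P(1)] P(1)] adj_mat(2,3)[OF P(1)] by simp_all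
  define C where "C = (?I + A) * R"
  have C: "C \<in> carrier_mat N N" using P R by (simp add: C_def)
  have CP: "C * (?I - A) = ?I + A"
    unfolding C_def using assoc_mult_mat[OF P(2) R P(1)] RP right_mult_one_mat[OF P(2)] by simp
  have adjA: "mat_adjoint A = - A"
    using XC anti by (intro eq_matI) (auto simp: A_def mat_adjoint_entry[of _ N N])
  have aR: "mat_adjoint R * (?I - mat_adjoint A) = ?I"
    using arg_cong[OF PR, of mat_adjoint] by (simp add: mat_adjoint_mult[OF P(1) R] mat_adjoint_one_plus[OF A])
  have aC: "mat_adjoint C = mat_adjoint R * (?I + mat_adjoint A)"
    by (simp add: C_def mat_adjoint_mult[OF P(2) R] mat_adjoint_one_plus[OF A])
  have unit: "mat_adjoint C * C = ?I"
  proof -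
    have "mat_adjoint R * (?I + mat_adjoint A) * ?I * ((?I + A) * R) = ?I"
      by (rule cayley_preserves_form[OF A _ _ R _ _ PR aR]) (use A R in \<open>auto simp: adjA\<close>)
    moreover have "mat_adjoint R * (?I + mat_adjoint A) \<in> carrier_mat N N" using A R by auto
    ultimately show ?thesis unfolding aC unfolding C_def by (simp only: right_mult_one_mat)
  qed
  then have U: "C \<in> unitary_mats N" using C by (simp add: unitary_mats_def)
  have tR: "transpose_mat R * (?I - transpose_mat A) = ?I"
    using arg_cong[OF PR, of transpose_mat] by (simp add: transpose_mult[OF P(1) R] transpose_minus[OF one_carrier_mat A])
  have tC: "transpose_mat C = transpose_mat R * (?I + transpose_mat A)"
    by (simp add: C_def transpose_mult[OF P(2) R] transpose_add[OF one_carrier_mat A])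
  have "C \<in> lie_group_any_det G N"
  proof (cases G)
    case SO
    have tA: "transpose_mat A = - A"
    proof (rule eq_matI)
      fix a b assume "a < dim_row (- A)" "b < dim_col (- A)"
      then have ab: "a < N" "b < N" using A by auto
      then have "cnj (X $$ (b, a)) = X $$ (b, a)" using inft SO by (simp add: Reals_cnj_iff)
      then have "X $$ (b, a) = - X $$ (a, b)" using anti[OF ab] by simp
      then show "transpose_mat A $$ (a, b) = (- A) $$ (a, b)" using ab XC by (simp add: A_def)
    qed (use A in auto)
    have "transpose_mat R * (?I + transpose_mat A) * ?I * ((?I + A) * R) = ?I"
      by (rule cayley_preserves_form[OF A _ _ R _ _ PR tR]) (use A R in \<open>auto simp: tA\<close>)
    moreover have "transpose_mat R * (?I + transpose_mat A) \<in> carrier_mat N N" using A R by auto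
    ultimately have orth: "transpose_mat C * C = ?I"
      unfolding tC unfolding C_def by (simp only: right_mult_one_mat)
    have CT: "transpose_mat C \<in> carrier_mat N N" and CA: "mat_adjoint C \<in> carrier_mat N N" using C by auto
    \<comment> \<open>Both the adjoint and the transpose are inverses of \<open>C\<close>, so they
      coincide, and this says that the entries of \<open>C\<close> are real.\<close>
    have "C * transpose_mat C = ?I" using mat_mult_left_right_inverse[OF CT C orth] .
    then have "mat_adjoint C = mat_adjoint C * (C * transpose_mat C)" by (simp add: right_mult_one_mat[OF CA])
    also have "\<dots> = transpose_mat C" using assoc_mult_mat[OF CA C CT] unit left_mult_one_mat[OF CT] by simp
    finally have real: "mat_adjoint C = transpose_mat C" .
    have "C $$ (a, b) \<in> \<real>" if "a < N" "b < N" for a b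
      using arg_cong[OF real, of "\<lambda>M. M $$ (b, a)"] that C by (simp add: mat_adjoint_entry[OF C] Reals_cnj_iff)
    moreover have "Determinant.det C = 1"
    proof -
      \<comment> \<open>As \<open>A\<close> is skew-symmetric, numerator and denominator of the
        transform have the same determinant.\<close>
      have "?I + A = transpose_mat (?I - A)"
        using A tA by (intro eq_matI) (auto simp: transpose_minus[OF one_carrier_mat A])
      then have "Determinant.det C = Determinant.det (?I - A) * Determinant.det R"
        unfolding C_def det_mult[OF P(2) R] using det_transpose[OF P(1)] by simp
      also have "\<dots> = 1" using det_mult[OF P(1) R] PR by simp
      finally show ?thesis .
    qed
    ultimately show ?thesis using SO C orth by simp
  next
    case SU
    then show ?thesis using U by simp
  next
    case Sp
    have J: "symp_J N \<in> carrier_mat N N" using symp_J_carrier even Sp by blast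
    have AT: "transpose_mat A \<in> carrier_mat N N" using A by simp
    have "transpose_mat A * symp_J N = - (symp_J N * A)"
    proof (rule eq_matI)
      fix a b assume "a < dim_row (- (symp_J N * A))" "b < dim_col (- (symp_J N * A))"
      then have ab: "a < N" "b < N" using A J by auto
      have "(\<Sum>c<N. X $$ (c, a) * symp_J N $$ (c, b)) = - (\<Sum>c<N. symp_J N $$ (a, c) * X $$ (c, b))"
        using inft Sp ab by (simp add: eq_neg_iff_add_eq_0)
      then have "t * (\<Sum>c<N. X $$ (c, a) * symp_J N $$ (c, b)) = - (t * (\<Sum>c<N. symp_J N $$ (a, c) * X $$ (c, b)))"
        by simp
      moreover have "(- (symp_J N * A)) $$ (a, b) = - (symp_J N * A) $$ (a, b)" using ab J A by simp
      ultimately show "(transpose_mat A * symp_J N) $$ (a, b) = (- (symp_J N * A)) $$ (a, b)"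
        unfolding mat_mult_entry[OF AT J ab] using mat_mult_entry[OF J A ab] ab XC
        by (simp add: A_def sum_distrib_left mult_ac del: index_mult_mat)
    qed (use A J in auto)
    then have "transpose_mat C * symp_J N * C = symp_J N"
      unfolding tC unfolding C_def using cayley_preserves_form[OF A AT J R _ _ PR tR] R by simp
    then show ?thesis using U Sp by simp
  qed
  then show ?thesis using CP by (auto simp: A_def)
qed

text \<open>
  The Cayley curve \<open>\<gamma> t\<close> with \<open>\<gamma> t * (1 - (t/2) X) = 1 + (t/2) X\<close> satisfies
  \<open>\<gamma> t = 1 + (t/2) (\<gamma> t + 1) X\<close>, and the entries of \<open>\<gamma> t\<close> are bounded because it is unitary; so its
  velocity is found without differentiating the inverse. Away from \<open>0\<close>, where the inverse may not
  exist, \<open>\<gamma> t = 1\<close>.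
\<close>

lemma lie_equations_velocity:
  assumes even: "G = Sp \<Longrightarrow> even N" and X: "X \<in> lie_equations G N"
  obtains \<gamma> :: "real \<Rightarrow> complex mat" where "\<And>t. \<gamma> t \<in> lie_group_any_det G N" and "\<gamma> 0 = 1\<^sub>m N"
    and "\<And>a b. a < N \<Longrightarrow> b < N \<Longrightarrow> ((\<lambda>t. \<gamma> t $$ (a, b)) has_vector_derivative X $$ (a, b)) (at 0)"
proof -
  have XC: "X \<in> carrier_mat N N" using X by (auto simp: lie_equations_def)
  let ?A = "\<lambda>t. complex_of_real (t / 2) \<cdot>\<^sub>m X"
  let ?P = "\<lambda>t. 1\<^sub>m N - ?A t"
  define \<gamma> where "\<gamma> t = (if t \<noteq> 0 \<and> Determinant.det (?P t) \<noteq> 0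
    then SOME C. C \<in> lie_group_any_det G N \<and> C * ?P t = 1\<^sub>m N + ?A t else 1\<^sub>m N)" for t
  have g: "\<gamma> t \<in> lie_group_any_det G N \<and> \<gamma> t * ?P t = 1\<^sub>m N + ?A t" if "t \<noteq> 0" "Determinant.det (?P t) \<noteq> 0" for t
  proof -
    have "\<exists>C. C \<in> lie_group_any_det G N \<and> C * ?P t = 1\<^sub>m N + ?A t"
      using cayley_transform[OF even X, of "t / 2"] that by blast
    from someI_ex[OF this] show ?thesis using that unfolding \<gamma>_def by presburger
  qed
  have "1\<^sub>m N \<in> lie_group_any_det G N" using even one_in_lie_group[of G N] by (cases G) (auto simp: unitary_mats_def)
  then have grp: "\<gamma> t \<in> lie_group_any_det G N" for t using g[of t] by (auto simp: \<gamma>_def)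
  have U: "\<gamma> t \<in> unitary_mats N" for t using grp[of t] lie_group_unitary[of "\<gamma> t" G] by (cases G) auto
  then have gC: "\<gamma> t \<in> carrier_mat N N" for t by (auto simp: unitary_mats_def)
  have g0: "\<gamma> 0 = 1\<^sub>m N" by (simp add: \<gamma>_def)
  have P: "?P t \<in> carrier_mat N N" for t using XC by auto
  have "((\<lambda>t. Determinant.det (?P t)) has_vector_derivative (\<Sum>a<N. - (X $$ (a, a) / 2))) (at 0)"
  proof (rule det_has_vector_derivative_at_one[where X = "\<lambda>a b. - (X $$ (a, b) / 2)"])
    show "?P 0 = 1\<^sub>m N" using XC by (intro eq_matI) auto
    fix a b assume ab: "a < N" "b < N"
    have "((\<lambda>t. (1\<^sub>m N :: complex mat) $$ (a, b) - t *\<^sub>R (X $$ (a, b) / 2)) has_vector_derivative - (X $$ (a, b) / 2)) (at 0)"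
      by (auto intro!: derivative_eq_intros)
    moreover have "?P t $$ (a, b) = (1\<^sub>m N :: complex mat) $$ (a, b) - t *\<^sub>R (X $$ (a, b) / 2)" for t
      using ab XC by (simp add: scaleR_conv_of_real)
    ultimately show "((\<lambda>t. ?P t $$ (a, b)) has_vector_derivative - (X $$ (a, b) / 2)) (at 0)" by simp
  qed (use P in simp)
  then have "isCont (\<lambda>t. Determinant.det (?P t)) 0" by (rule has_vector_derivative_continuous)
  moreover have "Determinant.det (?P 0) \<noteq> 0"
  proof -
    have "?P 0 = 1\<^sub>m N" using XC by (intro eq_matI) auto
    then show ?thesis by simp
  qed
  ultimately have ev: "\<forall>\<^sub>F t in at 0. Determinant.det (?P t) \<noteq> 0"
    unfolding isCont_def by (rule tendsto_imp_eventually_ne)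
  \<comment> \<open>The difference quotient of \<open>\<gamma>\<close> at 0 for all small nonzero
    \<open>t\<close>, read off from the defining equation; it still contains
    \<open>\<gamma> t\<close>.\<close>
  define h where "h a b t = ((\<Sum>c<N. \<gamma> t $$ (a, c) * X $$ (c, b)) + X $$ (a, b)) / 2" for a b t
  have quot: "\<forall>\<^sub>F t in at 0. \<gamma> t $$ (a, b) = (1\<^sub>m N :: complex mat) $$ (a, b) + t *\<^sub>R h a b t" if ab: "a < N" "b < N" for a b
    using ev eventually_neq_at_within[of 0]
  proof eventually_elim
    case (elim t)
    have "(\<gamma> t * ?P t) $$ (a, b) = (1\<^sub>m N + ?A t) $$ (a, b)" using g elim by simp
    then have "(\<Sum>c<N. \<gamma> t $$ (a, c) * ?P t $$ (c, b)) = (1\<^sub>m N + ?A t) $$ (a, b)"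
      using mat_mult_entry[OF gC P ab, of t] by simp
    moreover have "(\<Sum>c<N. \<gamma> t $$ (a, c) * ?P t $$ (c, b)) =
        (\<Sum>c<N. (if c = b then \<gamma> t $$ (a, c) else 0) - (t / 2) * (\<gamma> t $$ (a, c) * X $$ (c, b)))"
      by (intro sum.cong) (use XC ab in \<open>auto simp: algebra_simps\<close>)
    moreover have "\<dots> = \<gamma> t $$ (a, b) - (t / 2) * (\<Sum>c<N. \<gamma> t $$ (a, c) * X $$ (c, b))"
      using ab by (simp add: sum_subtractf sum_distrib_left)
    ultimately have "(1\<^sub>m N + ?A t) $$ (a, b) = \<gamma> t $$ (a, b) - (t / 2) * (\<Sum>c<N. \<gamma> t $$ (a, c) * X $$ (c, b))"
      by simp
    moreover have "(1\<^sub>m N + ?A t) $$ (a, b) = (1\<^sub>m N :: complex mat) $$ (a, b) + (t / 2) * X $$ (a, b)"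
      using XC ab by simp
    ultimately show ?case
      by (simp add: h_def scaleR_conv_of_real algebra_simps add_divide_distrib del: index_one_mat)
  qed
  define K where "K a b = ((\<Sum>c<N. cmod (X $$ (c, b))) + cmod (X $$ (a, b))) / 2" for a b
  have hK: "cmod (h a b t) \<le> K a b" if ab: "a < N" "b < N" for a b t
  proof -
    have "cmod (h a b t) \<le> (cmod (\<Sum>c<N. \<gamma> t $$ (a, c) * X $$ (c, b)) + cmod (X $$ (a, b))) / 2"
      by (simp add: h_def norm_divide norm_triangle_ineq divide_right_mono)
    moreover have "cmod (\<Sum>c<N. \<gamma> t $$ (a, c) * X $$ (c, b)) \<le> (\<Sum>c<N. cmod (X $$ (c, b)))"
      by (rule sum_norm_le) (use unitary_entry_le_1[OF U ab(1)] in \<open>auto simp: norm_mult intro: mult_left_le_one_le\<close>)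
    ultimately show ?thesis by (simp add: K_def)
  qed
  have lim: "((\<lambda>t. \<gamma> t $$ (a, b)) \<longlongrightarrow> (1\<^sub>m N :: complex mat) $$ (a, b)) (at 0)" if ab: "a < N" "b < N" for a b
  proof -
    have "((\<lambda>t. t *\<^sub>R h a b t) \<longlongrightarrow> 0) (at 0)"
    proof (rule Lim_null_comparison)
      show "\<forall>\<^sub>F t in at 0. cmod (t *\<^sub>R h a b t) \<le> \<bar>t\<bar> * K a b"
        using hK[OF ab] by (intro always_eventually allI) (simp add: mult_left_mono)
      show "((\<lambda>t. \<bar>t\<bar> * K a b) \<longlongrightarrow> 0) (at 0)" by (auto intro!: tendsto_eq_intros)
    qed
    then have "((\<lambda>t. (1\<^sub>m N :: complex mat) $$ (a, b) + t *\<^sub>R h a b t) \<longlongrightarrow> (1\<^sub>m N :: complex mat) $$ (a, b)) (at 0)"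
      using tendsto_add[OF tendsto_const] by fastforce
    then show ?thesis by (rule Lim_transform_eventually) (use quot[OF ab] in \<open>simp add: eq_commute\<close>)
  qed
  \<comment> \<open>The continuity just derived from the bound is fed back into \<open>h\<close>:
    when \<open>\<gamma>\<close> tends to the identity, \<open>h\<close> tends to half of
    \<open>X\<close> plus half of \<open>X\<close>.\<close>
  have limh: "(h a b \<longlongrightarrow> X $$ (a, b)) (at 0)" if ab: "a < N" "b < N" for a b
  proof -
    have "(h a b \<longlongrightarrow> ((\<Sum>c<N. (1\<^sub>m N :: complex mat) $$ (a, c) * X $$ (c, b)) + X $$ (a, b)) / 2) (at 0)"
      unfolding h_def by (intro tendsto_intros lim) (use ab in auto)
    moreover have "(\<Sum>c<N. (1\<^sub>m N :: complex mat) $$ (a, c) * X $$ (c, b)) = (\<Sum>c<N. if c = a then X $$ (c, b) else 0)"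
      by (intro sum.cong) (use ab in auto)
    ultimately show ?thesis using ab by simp
  qed
  show thesis
  proof (rule that[of \<gamma>, OF grp g0])
    fix a b assume ab: "a < N" "b < N"
    show "((\<lambda>t. \<gamma> t $$ (a, b)) has_vector_derivative X $$ (a, b)) (at 0)"
      unfolding has_vector_derivative_def has_derivative_at
    proof
      have "((\<lambda>t. norm (h a b t - X $$ (a, b))) \<longlongrightarrow> 0) (at 0)"
        using limh[OF ab] by (simp add: LIM_zero tendsto_norm_zero)
      then show "((\<lambda>t. norm (\<gamma> (0 + t) $$ (a, b) - \<gamma> 0 $$ (a, b) - t *\<^sub>R X $$ (a, b)) / norm t) \<longlongrightarrow> 0) (at 0)"
      proof (rule Lim_transform_eventually)
        show "\<forall>\<^sub>F t in at 0. norm (h a b t - X $$ (a, b)) =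
            norm (\<gamma> (0 + t) $$ (a, b) - \<gamma> 0 $$ (a, b) - t *\<^sub>R X $$ (a, b)) / norm t"
          using quot[OF ab] eventually_neq_at_within[of 0]
        proof eventually_elim
          case (elim t)
          have "\<gamma> (0 + t) $$ (a, b) - \<gamma> 0 $$ (a, b) - t *\<^sub>R X $$ (a, b) = t *\<^sub>R (h a b t - X $$ (a, b))"
            using elim by (simp add: g0 scaleR_diff_right del: index_one_mat)
          then show ?case using elim by simp
        qed
      qed
    qed (rule bounded_linear_scaleR_left)
  qed
qed

text \<open>Conjugation is a ring homomorphism and so commutes with the determinant. The conjugate
  determinant is therefore the factor that normalises a unitary matrix to determinant 1.\<close>

lemma unitary_det_norm:
  assumes "S \<in> unitary_mats N"
  shows "cnj (Determinant.det S) * Determinant.det S = 1"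
proof -
  have S: "S \<in> carrier_mat N N" "mat_adjoint S * S = 1\<^sub>m N" using assms by (auto simp: unitary_mats_def)
  have "mat_adjoint S = transpose_mat (map_mat cnj S)"
    using S by (intro eq_matI) (auto simp: mat_adjoint_entry[OF S(1)])
  then have "Determinant.det (mat_adjoint S) = Determinant.det (map_mat cnj S)"
    using det_transpose[of "map_mat cnj S" N] S by simp
  also have "\<dots> = cnj (Determinant.det S)"
  proof -
    interpret comm_ring_hom cnj by unfold_locales auto
    show ?thesis by (rule hom_det)
  qed
  finally show ?thesis
    using det_mult[OF mat_adjoint_carrier[OF S(1)] S(1)] S(2) by simp
qed

text \<open>For \<open>SU\<close>, the determinant of a unitary curve is divided out of its first column.\<close>

lemma lie_algebra_eq_equations:
  assumes even: "G = Sp \<Longrightarrow> even N"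
  shows "lie_algebra G N = lie_equations G N"
proof
  show "lie_algebra G N \<subseteq> lie_equations G N" using lie_algebra_subset_equations[OF even] .
  show "lie_equations G N \<subseteq> lie_algebra G N"
  proof
    fix X assume X: "X \<in> lie_equations G N"
    then have XC: "X \<in> carrier_mat N N" by (auto simp: lie_equations_def)
    obtain \<gamma> where g: "\<And>t. \<gamma> t \<in> lie_group_any_det G N" "\<gamma> 0 = 1\<^sub>m N"
      and der: "\<And>a b. a < N \<Longrightarrow> b < N \<Longrightarrow> ((\<lambda>t. \<gamma> t $$ (a, b)) has_vector_derivative X $$ (a, b)) (at 0)"
      using lie_equations_velocity[OF even X] by blast
    show "X \<in> lie_algebra G N"
    proof (cases "G = SU")
      case False
      then have "lie_group_any_det G N = lie_group G N" by (cases G) auto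
      then show ?thesis using g der XC unfolding lie_algebra_def by blast
    next
      case True
      define D where "D t = mat N N (\<lambda>(a, b). if a = b then if b = 0 then cnj (Determinant.det (\<gamma> t)) else 1 else 0)" for t
      have U: "\<gamma> t \<in> unitary_mats N" for t using g True by simp
      then have gC: "\<gamma> t \<in> carrier_mat N N" "mat_adjoint (\<gamma> t) * \<gamma> t = 1\<^sub>m N" for t by (auto simp: unitary_mats_def)
      have DC: "D t \<in> carrier_mat N N" for t by (simp add: D_def)
      have De: "D t $$ (a, b) = (if a = b then if b = 0 then cnj (Determinant.det (\<gamma> t)) else 1 else 0)"
        if "a < N" "b < N" for a b t
        using that by (simp add: D_def)
      have dt: "cnj (Determinant.det (\<gamma> t)) * Determinant.det (\<gamma> t) = 1" for t by (rule unitary_det_norm[OF U])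
      have entry: "(\<gamma> t * D t) $$ (a, b) = \<gamma> t $$ (a, b) * (if b = 0 then cnj (Determinant.det (\<gamma> t)) else 1)"
        if "a < N" "b < N" for a b t
      proof -
        have "(\<gamma> t * D t) $$ (a, b) = (\<Sum>c<N. if c = b then \<gamma> t $$ (a, c) * (if b = 0 then cnj (Determinant.det (\<gamma> t)) else 1) else 0)"
          unfolding mat_mult_entry[OF gC(1) DC that] by (intro sum.cong) (use that in \<open>auto simp: D_def\<close>)
        then show ?thesis using that by simp
      qed
      have "\<gamma> t * D t \<in> lie_group G N" for t
      proof -
        have aD: "mat_adjoint (D t) \<in> carrier_mat N N" "mat_adjoint (\<gamma> t) \<in> carrier_mat N N" using DC gC by auto
        have "mat_adjoint (D t) * D t = 1\<^sub>m N"
        proof (rule eq_matI)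
          fix a b assume "a < dim_row (1\<^sub>m N :: complex mat)" "b < dim_col (1\<^sub>m N :: complex mat)"
          then have ab: "a < N" "b < N" by auto
          have "(mat_adjoint (D t) * D t) $$ (a, b) = (\<Sum>c<N. if c = b then (if a = b then 1 else 0) else 0)"
            unfolding mat_mult_entry[OF aD(1) DC ab]
            by (intro sum.cong) (use ab dt[of t] in \<open>auto simp: mat_adjoint_entry[OF DC] De mult.commute\<close>)
          then show "(mat_adjoint (D t) * D t) $$ (a, b) = (1\<^sub>m N :: complex mat) $$ (a, b)" using ab by simp
        qed (use DC[of t] in auto)
        moreover have "mat_adjoint (\<gamma> t * D t) * (\<gamma> t * D t) = mat_adjoint (D t) * ((mat_adjoint (\<gamma> t) * \<gamma> t) * D t)"
        proof -
          have gD: "\<gamma> t * D t \<in> carrier_mat N N" by (rule mult_carrier_mat[OF gC(1) DC])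
          have "mat_adjoint (\<gamma> t * D t) * (\<gamma> t * D t) = mat_adjoint (D t) * (mat_adjoint (\<gamma> t) * (\<gamma> t * D t))"
            unfolding mat_adjoint_mult[OF gC(1) DC] by (rule assoc_mult_mat[OF aD gD])
          then show ?thesis by (simp add: assoc_mult_mat[OF aD(2) gC(1) DC])
        qed
        ultimately have "mat_adjoint (\<gamma> t * D t) * (\<gamma> t * D t) = 1\<^sub>m N"
          using gC(2) left_mult_one_mat[OF DC, of t] by simp
        \<comment> \<open>For \<open>N = 0\<close> there is no first column to rescale, and every
          determinant is already 1.\<close>
        moreover have "Determinant.det (D t) = (if N = 0 then 1 else cnj (Determinant.det (\<gamma> t)))"
        proof -
          have "upper_triangular (D t)" by (auto simp: D_def upper_triangular_def)
          from det_upper_triangular[OF this DC]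
          have "Determinant.det (D t) = (\<Prod>i = 0..<N. D t $$ (i, i))" by (simp add: D_def prod_list_diag_prod)
          also have "\<dots> = (\<Prod>i = 0..<N. if i = 0 then cnj (Determinant.det (\<gamma> t)) else 1)"
            by (intro prod.cong) (auto simp: D_def)
          finally show ?thesis by simp
        qed
        then have "Determinant.det (\<gamma> t * D t) = 1"
          unfolding det_mult[OF gC(1) DC] using dt[of t] gC[of t] by (auto simp: mult.commute)
        ultimately show ?thesis using True mult_carrier_mat[OF gC(1) DC, of t t] by (simp add: unitary_mats_def)
      qed
      moreover have "\<gamma> 0 * D 0 = 1\<^sub>m N"
      proof -
        have "D 0 = 1\<^sub>m N" by (rule eq_matI) (auto simp: D_def g(2))
        then show ?thesis by (simp add: g(2))
      qed
      moreover have "((\<lambda>t. (\<gamma> t * D t) $$ (a, b)) has_vector_derivative X $$ (a, b)) (at 0)" if ab: "a < N" "b < N" for a b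
      proof (cases "b = 0")
        case False
        then show ?thesis using entry[OF ab] der[OF ab] by simp
      next
        case b: True
        \<comment> \<open>The trace is the velocity of the determinant. As it vanishes, the
          correction factor has velocity 0 and leaves the velocity of the first column
          unchanged.\<close>
        have "(\<Sum>a<N. X $$ (a, a)) = 0" using X True by (simp add: lie_equations_def)
        then have "((\<lambda>t. Determinant.det (\<gamma> t)) has_vector_derivative 0) (at 0)"
          using det_has_vector_derivative_at_one[OF gC(1) g(2) der] by simp
        from has_vector_derivative_mult[OF der[OF ab] has_vector_derivative_cnj[OF this]]
        show ?thesis using entry[OF ab] b by (simp add: g(2))
      qed
      ultimately show ?thesis using XC unfolding lie_algebra_def
        by (intro CollectI conjI exI[of _ "\<lambda>t. \<gamma> t * D t"] allI impI)
    qed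
  qed
qed

section \<open>The covariance of the entries\<close>

text \<open>An antihermitian \<open>A\<close> has adjoint \<open>- A\<close>. This replaces the
  sesquilinear product by a bilinear trace form, in which identities extend to complex
  combinations.\<close>

lemma lie_inner_eq_bilinear:
  assumes "A \<in> lie_equations G N" and "B \<in> carrier_mat N N"
  shows "lie_inner G N A B = - of_real (inner_scale G N) * (\<Sum>x<N. \<Sum>y<N. A $$ (x, y) * B $$ (y, x))"
proof -
  have A: "A \<in> carrier_mat N N" "\<And>a b. a < N \<Longrightarrow> b < N \<Longrightarrow> cnj (A $$ (b, a)) = - A $$ (a, b)"
    using assms(1) by (auto simp: lie_equations_def)
  have "mat_tr (mat_adjoint A * B) = (\<Sum>x<N. \<Sum>y<N. cnj (A $$ (y, x)) * B $$ (y, x))"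
    unfolding mat_tr_def using A(1) assms(2)
    by (simp add: mat_mult_entry[OF mat_adjoint_carrier[OF A(1)] assms(2)] mat_adjoint_entry[OF A(1)] del: index_mult_mat(1))
  also have "\<dots> = - (\<Sum>x<N. \<Sum>y<N. A $$ (x, y) * B $$ (y, x))"
    by (simp add: A(2) sum_negf)
  finally show ?thesis by (simp add: lie_inner_def)
qed

text \<open>Expand \<open>Y\<close> in the basis; orthonormality collapses the double sum. The
  tensor \<open>\<Sum>j. X j \<otimes> X j\<close> is thus a reproducing kernel whatever the basis
  is, and its entries can be found by testing against suitable \<open>Y\<close>.\<close>

lemma lie_basis_reproduces:
  assumes even: "G = Sp \<Longrightarrow> even N" and basis: "lie_orthonormal_basis G N d X"
    and Y: "Y \<in> lie_equations G N" and uv: "u < N" "v < N"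
  shows "Y $$ (u, v) = - of_real (inner_scale G N) *
           (\<Sum>x<N. \<Sum>y<N. Y $$ (y, x) * (\<Sum>j<d. X j $$ (x, y) * X j $$ (u, v)))"
proof -
  have XE: "X j \<in> lie_equations G N" if "j < d" for j
    using basis that lie_algebra_eq_equations[OF even] by (auto simp: lie_orthonormal_basis_def)
  then have XC: "X j \<in> carrier_mat N N" if "j < d" for j using that by (auto simp: lie_equations_def)
  obtain c where c: "Y = real_lincomb N d c X"
    using basis Y lie_algebra_eq_equations[OF even] by (auto simp: lie_orthonormal_basis_def)
  have Ye: "Y $$ (a, b) = (\<Sum>l<d. of_real (c l) * X l $$ (a, b))" if "a < N" "b < N" for a b
    using that by (simp add: c real_lincomb_def)
  let ?\<kappa> = "complex_of_real (inner_scale G N)"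
  let ?T = "\<lambda>j l. \<Sum>x<N. \<Sum>y<N. X j $$ (x, y) * X l $$ (y, x)"
  have orth: "- ?\<kappa> * ?T j l = (if j = l then 1 else 0)" if "j < d" "l < d" for j l
    using basis that lie_inner_eq_bilinear[OF XE XC, of j l] by (simp add: lie_orthonormal_basis_def)
  have "(\<Sum>x<N. \<Sum>y<N. Y $$ (y, x) * (\<Sum>j<d. X j $$ (x, y) * X j $$ (u, v))) =
      (\<Sum>x<N. \<Sum>y<N. \<Sum>j<d. \<Sum>l<d. of_real (c l) * X j $$ (u, v) * (X j $$ (x, y) * X l $$ (y, x)))"
  proof (intro sum.cong refl)
    fix x y assume "x \<in> {..<N}" "y \<in> {..<N}"
    then show "Y $$ (y, x) * (\<Sum>j<d. X j $$ (x, y) * X j $$ (u, v)) =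
        (\<Sum>j<d. \<Sum>l<d. of_real (c l) * X j $$ (u, v) * (X j $$ (x, y) * X l $$ (y, x)))"
      by (simp add: Ye sum_product) (subst sum.swap, simp add: mult_ac)
  qed
  also have "\<dots> = (\<Sum>j<d. \<Sum>x<N. \<Sum>y<N. \<Sum>l<d. of_real (c l) * X j $$ (u, v) * (X j $$ (x, y) * X l $$ (y, x)))"
    by (simp only: sum.swap[of _ "{..<d}" "{..<N}"])
  also have "\<dots> = (\<Sum>j<d. \<Sum>l<d. \<Sum>x<N. \<Sum>y<N. of_real (c l) * X j $$ (u, v) * (X j $$ (x, y) * X l $$ (y, x)))"
    by (simp only: sum.swap[of _ "{..<d}" "{..<N}"])
  also have "\<dots> = (\<Sum>j<d. \<Sum>l<d. of_real (c l) * X j $$ (u, v) * ?T j l)"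
    by (simp add: sum_distrib_left)
  finally have "- ?\<kappa> * (\<Sum>x<N. \<Sum>y<N. Y $$ (y, x) * (\<Sum>j<d. X j $$ (x, y) * X j $$ (u, v))) =
      (\<Sum>j<d. \<Sum>l<d. of_real (c l) * X j $$ (u, v) * (- ?\<kappa> * ?T j l))"
    by (simp add: sum_distrib_left mult_ac)
  also have "\<dots> = (\<Sum>j<d. \<Sum>l<d. if j = l then of_real (c l) * X j $$ (u, v) else 0)"
    by (intro sum.cong refl) (subst orth, auto)
  also have "\<dots> = Y $$ (u, v)" using uv by (simp add: Ye)
  finally show ?thesis by simp
qed

text \<open>
  The reproducing identity is complex linear, so it extends from the Lie algebra to its
  complexification, which contains the projections of the matrix units.
\<close>

lemma lie_basis_reproduces_complexified:
  assumes even: "G = Sp \<Longrightarrow> even N" and basis: "lie_orthonormal_basis G N d X"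
    and Y1: "Matrix.mat N N (\<lambda>(a, b). Z a b - cnj (Z b a)) \<in> lie_equations G N"
    and Y2: "Matrix.mat N N (\<lambda>(a, b). \<i> * (Z a b + cnj (Z b a))) \<in> lie_equations G N"
    and uv: "u < N" "v < N"
  shows "Z u v = - of_real (inner_scale G N) *
           (\<Sum>x<N. \<Sum>y<N. Z y x * (\<Sum>j<d. X j $$ (x, y) * X j $$ (u, v)))"
proof -
  let ?S = "\<lambda>Y. \<Sum>x<N. \<Sum>y<N. Y y x * (\<Sum>j<d. X j $$ (x, y) * X j $$ (u, v))"
  let ?Y1 = "\<lambda>a b. Z a b - cnj (Z b a)" and ?Y2 = "\<lambda>a b. \<i> * (Z a b + cnj (Z b a))"
  let ?\<kappa> = "complex_of_real (inner_scale G N)"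
  have 1: "?Y1 u v = - ?\<kappa> * ?S ?Y1"
    using lie_basis_reproduces[OF even basis Y1 uv] uv by simp
  have 2: "?Y2 u v = - ?\<kappa> * ?S ?Y2"
    using lie_basis_reproduces[OF even basis Y2 uv] uv by simp
  \<comment> \<open>Twice the antihermitian and hermitian parts of \<open>Z\<close>, the latter made
    antihermitian by the factor \<open>\<i>\<close>.\<close>
  have Z: "Z a b = (1/2) * ?Y1 a b - (\<i>/2) * ?Y2 a b" for a b by (simp add: field_simps)
  have ZC: "Z a b * C = (1/2) * (?Y1 a b * C) - (\<i>/2) * (?Y2 a b * C)" for a b C
    by (subst Z) (simp only: left_diff_distrib mult.assoc)
  have "?S Z = (\<Sum>x<N. \<Sum>y<N. (1/2) * (?Y1 y x * (\<Sum>j<d. X j $$ (x, y) * X j $$ (u, v))) -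
      (\<i>/2) * (?Y2 y x * (\<Sum>j<d. X j $$ (x, y) * X j $$ (u, v))))"
    by (intro sum.cong refl) (rule ZC)
  also have "\<dots> = (1/2) * ?S ?Y1 - (\<i>/2) * ?S ?Y2"
    by (simp only: sum_subtractf sum_distrib_left)
  finally have "- ?\<kappa> * ?S Z = - ?\<kappa> * ((1/2) * ?S ?Y1 - (\<i>/2) * ?S ?Y2)"
    by (rule arg_cong)
  also have "\<dots> = (1/2) * (- ?\<kappa> * ?S ?Y1) - (\<i>/2) * (- ?\<kappa> * ?S ?Y2)"
    by (simp only: right_diff_distrib mult.left_commute)
  also have "\<dots> = Z u v" unfolding 1[symmetric] 2[symmetric] by (rule Z[symmetric])
  finally show ?thesis by (rule sym)
qed

text \<open>\<open>symp_J N\<close> is a signed permutation matrix, so either sum has a single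
  nonzero term. In the first sum the sign is \<open>- symp_sign N b\<close>, because it belongs to
  the row \<open>symp_flip N b\<close>.\<close>

lemma infinitesimal_Sp_iff:
  assumes "even N"
  shows "infinitesimal Sp N X \<longleftrightarrow> (\<forall>a<N. \<forall>b<N.
    symp_sign N a * X $$ (symp_flip N a, b) = symp_sign N b * X $$ (symp_flip N b, a))"
proof -
  have "(\<Sum>c<N. X $$ (c, a) * symp_J N $$ (c, b)) + (\<Sum>c<N. symp_J N $$ (a, c) * X $$ (c, b)) =
      symp_sign N a * X $$ (symp_flip N a, b) - symp_sign N b * X $$ (symp_flip N b, a)"
    if ab: "a < N" "b < N" for a b
  proof -
    note f = symp_flip[OF assms]
    have "(\<Sum>c<N. X $$ (c, a) * symp_J N $$ (c, b)) = (\<Sum>c<N. if c = symp_flip N b then X $$ (c, a) * - symp_sign N b else 0)"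
      by (intro sum.cong refl) (use ab f symp_J_entry[OF assms] in auto)
    moreover have "(\<Sum>c<N. symp_J N $$ (a, c) * X $$ (c, b)) = (\<Sum>c<N. if c = symp_flip N a then symp_sign N a * X $$ (c, b) else 0)"
      by (intro sum.cong refl) (use ab f symp_J_entry[OF assms] in auto)
    ultimately show ?thesis using f(1) ab by simp
  qed
  then show ?thesis by simp
qed

text \<open>The part of the covariance of the entries at \<open>(a, b)\<close> and
  \<open>(c, d)\<close> that belongs to one operation. For SU the \<open>Contract\<close> term
  corrects for the trace direction, which the Lie algebra omits; for Sp the entries of
  \<open>symp_J N\<close> replace the equality of indices across a same-orientation gluing.\<close>

fun pair_weight :: "lie_type \<Rightarrow> nat \<Rightarrow> side_op \<Rightarrow> nat \<Rightarrow> nat \<Rightarrow> nat \<Rightarrow> nat \<Rightarrow> complex" where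
  "pair_weight G N Glue_Opposite a b c d = - (of_bool (a = d \<and> b = c) / of_nat N)"
| "pair_weight G N Contract a b c d = of_bool (a = b \<and> c = d) / (of_nat N)\<^sup>2"
| "pair_weight Sp N Glue_Same a b c d = symp_J N $$ (a, c) * symp_J N $$ (b, d) / of_nat N"
| "pair_weight G N Glue_Same a b c d = of_bool (a = c \<and> b = d) / of_nat N"

lemma sum_matrix_unit:
  fixes f :: "nat \<Rightarrow> nat \<Rightarrow> complex"
  assumes "a < N" "b < N"
  shows "(\<Sum>x<N. \<Sum>y<N. of_bool (y = b \<and> x = a) * f x y) = f a b"
proof -
  have "(\<Sum>x<N. \<Sum>y<N. of_bool (y = b \<and> x = a) * f x y) = (\<Sum>x<N. \<Sum>y<N. if y = b then if x = a then f x y else 0 else 0)"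
    by (intro sum.cong) auto
  then show ?thesis using assms by simp
qed

text \<open>Test the reproducing property against \<open>Z\<close>, a multiple of the projection of
  the matrix unit at \<open>(b, a)\<close> to the complexified Lie algebra. The contraction with
  \<open>Z\<close> returns the wanted entry: once for SU, and twice for SO and Sp, where the
  symmetry of the \<open>X j\<close> makes both terms of \<open>Z\<close> count equally. The halved
  inner product compensates this factor 2, so that all three cases end with
  \<open>- Z u v / N\<close>.\<close>

lemma lie_basis_casimir:
  assumes N: "N \<ge> 1" and even: "G = Sp \<Longrightarrow> even N" and basis: "lie_orthonormal_basis G N d X"
    and ab: "a < N" "b < N" and uv: "u < N" "v < N"
  shows "(\<Sum>j<d. X j $$ (a, b) * X j $$ (u, v)) = (\<Sum>w\<in>allowed_ops G. pair_weight G N w a b u v)"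
proof -
  let ?C = "\<lambda>x y. \<Sum>j<d. X j $$ (x, y) * X j $$ (u, v)"
  have XE: "X j \<in> lie_equations G N" if "j < d" for j
    using basis that lie_algebra_eq_equations[OF even] by (auto simp: lie_orthonormal_basis_def)
  have N0: "of_nat N \<noteq> (0 :: complex)" using N by simp
  show ?thesis
  proof (cases G)
    case SO
    define Z :: "nat \<Rightarrow> nat \<Rightarrow> complex" where "Z u v = of_bool (u = b \<and> v = a) - of_bool (u = a \<and> v = b)" for u v
    have real: "Z x y \<in> \<real>" for x y by (simp add: Z_def)
    have cnjZ: "cnj (Z x y) = - Z y x" for x y
      unfolding Reals_cnj_iff[THEN iffD1, OF real] by (simp add: Z_def conj_commute)
    have "Matrix.mat N N (\<lambda>(a, b). Z a b - cnj (Z b a)) \<in> lie_equations G N"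
      by (auto simp: lie_equations_def SO cnjZ intro: real Reals_mult)
    moreover have "Matrix.mat N N (\<lambda>(a, b). \<i> * (Z a b + cnj (Z b a))) \<in> lie_equations G N"
      by (auto simp: lie_equations_def SO cnjZ)
    ultimately have "Z u v = - of_real (inner_scale G N) * (\<Sum>x<N. \<Sum>y<N. Z y x * ?C x y)"
      using lie_basis_reproduces_complexified[of G N d X Z, OF even basis _ _ uv] by blast
    also have "(\<Sum>x<N. \<Sum>y<N. Z y x * ?C x y) = ?C a b - ?C b a"
      by (simp only: Z_def left_diff_distrib sum_subtractf sum_matrix_unit[OF ab] sum_matrix_unit[OF ab(2,1)])
    also have "?C b a = - ?C a b"
    proof -
      have "X j $$ (b, a) = - X j $$ (a, b)" if "j < d" for j
      proof -
        have "cnj (X j $$ (b, a)) = - X j $$ (a, b)" and "X j $$ (b, a) \<in> \<real>"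
          using XE[OF that] ab unfolding lie_equations_def SO by simp_all
        then show ?thesis unfolding Reals_cnj_iff by metis
      qed
      then show ?thesis by (simp add: sum_negf)
    qed
    finally have "?C a b = - Z u v / of_nat N" using N0 by (simp add: SO field_simps)
    moreover have "(\<Sum>w\<in>allowed_ops G. pair_weight G N w a b u v) = - Z u v / of_nat N"
    proof -
      have "(u = b \<and> v = a) = (a = v \<and> b = u)" "(u = a \<and> v = b) = (a = u \<and> b = v)" by blast+
      then show ?thesis by (simp add: SO Z_def diff_divide_distrib)
    qed
    ultimately show ?thesis by simp
  next
    case SU
    define Z :: "nat \<Rightarrow> nat \<Rightarrow> complex" where "Z u v = of_bool (u = b \<and> v = a) - of_bool (a = b \<and> u = v) / of_nat N" for u v
    have tr: "(\<Sum>x<N. Z x x) = 0"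
    proof -
      have "(\<Sum>x<N. Z x x) = (\<Sum>x<N. (if x = b then of_bool (b = a) else 0) - of_bool (a = b) / of_nat N)"
        by (intro sum.cong) (auto simp: Z_def)
      then show ?thesis using ab N0 by (auto simp: sum_subtractf)
    qed
    have trc: "(\<Sum>x<N. cnj (Z x x)) = 0" using arg_cong[OF tr, of cnj] by simp
    have "Matrix.mat N N (\<lambda>(a, b). Z a b - cnj (Z b a)) \<in> lie_equations G N"
      using tr trc by (auto simp: lie_equations_def SU sum_subtractf)
    moreover have "Matrix.mat N N (\<lambda>(a, b). \<i> * (Z a b + cnj (Z b a))) \<in> lie_equations G N"
      using tr trc by (auto simp: lie_equations_def SU sum.distrib algebra_simps simp flip: sum_distrib_left)
    ultimately have "Z u v = - of_real (inner_scale G N) * (\<Sum>x<N. \<Sum>y<N. Z y x * ?C x y)"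
      using lie_basis_reproduces_complexified[of G N d X Z, OF even basis _ _ uv] by blast
    also have "(\<Sum>x<N. \<Sum>y<N. Z y x * ?C x y) = ?C a b - (\<Sum>x<N. \<Sum>y<N. of_bool (a = b \<and> y = x) / of_nat N * ?C x y)"
      by (simp only: Z_def left_diff_distrib sum_subtractf sum_matrix_unit[OF ab])
    \<comment> \<open>The identity component of \<open>Z\<close> is paired with the traces of the
      \<open>X j\<close>, which vanish.\<close>
    also have "(\<Sum>x<N. \<Sum>y<N. of_bool (a = b \<and> y = x) / of_nat N * ?C x y) = 0"
    proof -
      have "(\<Sum>x<N. \<Sum>y<N. of_bool (a = b \<and> y = x) / of_nat N * ?C x y) =
          (\<Sum>x<N. \<Sum>y<N. if y = x then of_bool (a = b) / of_nat N * ?C x x else 0)"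
        by (intro sum.cong) auto
      also have "\<dots> = of_bool (a = b) / of_nat N * (\<Sum>x<N. ?C x x)"
        by (simp add: sum_distrib_left)
      also have "(\<Sum>x<N. ?C x x) = (\<Sum>j<d. (\<Sum>x<N. X j $$ (x, x)) * X j $$ (u, v))"
        by (subst sum.swap) (simp add: sum_distrib_right)
      also have "\<dots> = 0" using XE by (intro sum.neutral) (auto simp: lie_equations_def SU)
      finally show ?thesis by simp
    qed
    finally have "?C a b = - Z u v / of_nat N" using N0 by (simp add: SU field_simps)
    moreover have "(\<Sum>w\<in>allowed_ops G. pair_weight G N w a b u v) = - Z u v / of_nat N"
    proof -
      have "(u = b \<and> v = a) = (a = v \<and> b = u)" by blast
      then show ?thesis by (simp add: SU Z_def power2_eq_square diff_divide_distrib)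
    qed
    ultimately show ?thesis by simp
  next
    case Sp
    note ev = even[OF Sp]
    note f = symp_flip[OF ev]
    let ?s = "symp_sign N" and ?f = "symp_flip N"
    have s: "?s x * ?s x = 1" "cnj (?s x) = ?s x" for x by (auto simp: symp_sign_def)
    have inj: "?f x = y \<longleftrightarrow> x = ?f y" if "x < N" "y < N" for x y using f(2) that by metis
    \<comment> \<open>\<open>Z a b\<close> is the matrix unit at \<open>(b, a)\<close> symmetrised
      under the involution that sends a matrix to \<open>J\<close> times its transpose times
      \<open>J\<close>; the fixed points of this involution form the complexified Lie algebra. The
      parameters stay explicit because the adjoint of \<open>Z a b\<close> is
      \<open>Z b a\<close>.\<close>
    define Z :: "nat \<Rightarrow> nat \<Rightarrow> nat \<Rightarrow> nat \<Rightarrow> complex" where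
      "Z a b u v = of_bool (u = b \<and> v = a) - ?s a * ?s b * of_bool (u = ?f a \<and> v = ?f b)" for a b u v
    have cnjZ: "cnj (Z a b x y) = Z b a y x" for a b x y
    proof -
      have "(x = b \<and> y = a) = (y = a \<and> x = b)" "(x = ?f a \<and> y = ?f b) = (y = ?f b \<and> x = ?f a)" by blast+
      moreover have "cnj (of_bool P) = of_bool P" for P by (cases P) auto
      ultimately show ?thesis
        unfolding Z_def complex_cnj_diff complex_cnj_mult s mult.commute[of "?s a" "?s b"] by (simp only:)
    qed
    have Zsp: "?s p * Z a b (?f p) q = ?s q * Z a b (?f q) p" if "a < N" "b < N" "p < N" "q < N" for a b p q
    proof -
      have 1: "(?f p = b \<and> q = a) = (p = ?f b \<and> q = a)" "(?f q = b \<and> p = a) = (q = ?f b \<and> p = a)"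
        "(?f p = ?f a \<and> q = ?f b) = (q = ?f b \<and> p = a)" "(?f q = ?f a \<and> p = ?f b) = (p = ?f b \<and> q = a)"
        using that f by (metis (no_types))+
      have 2: "?s p * of_bool (p = ?f b \<and> q = a) = - ?s b * of_bool (p = ?f b \<and> q = a)"
        "?s q * of_bool (q = ?f b \<and> p = a) = - ?s b * of_bool (q = ?f b \<and> p = a)"
        "?s p * (?s a * ?s b * of_bool (q = ?f b \<and> p = a)) = ?s b * of_bool (q = ?f b \<and> p = a)"
        "?s q * (?s a * ?s b * of_bool (p = ?f b \<and> q = a)) = ?s b * of_bool (p = ?f b \<and> q = a)"
        using that f(4) s(1)[of a] by (simp_all add: of_bool_def mult.assoc[symmetric])
      show ?thesis unfolding Z_def right_diff_distrib 1 2 by simp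
    qed
    have "Matrix.mat N N (\<lambda>(x, y). Z a b x y - cnj (Z a b y x)) \<in> lie_equations G N"
      using Zsp[OF ab] Zsp[OF ab(2,1)] f(1)
      by (simp add: lie_equations_def Sp infinitesimal_Sp_iff[OF ev] cnjZ right_diff_distrib del: infinitesimal.simps)
    moreover have "Matrix.mat N N (\<lambda>(x, y). \<i> * (Z a b x y + cnj (Z a b y x))) \<in> lie_equations G N"
      using Zsp[OF ab] Zsp[OF ab(2,1)] f(1)
      by (simp add: lie_equations_def Sp infinitesimal_Sp_iff[OF ev] cnjZ distrib_left add.commute mult.left_commute[of _ \<i>] del: infinitesimal.simps)
    ultimately have "Z a b u v = - of_real (inner_scale G N) * (\<Sum>x<N. \<Sum>y<N. Z a b y x * ?C x y)"
      using lie_basis_reproduces_complexified[of G N d X "Z a b", OF even basis _ _ uv] by blast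
    also have "(\<Sum>x<N. \<Sum>y<N. Z a b y x * ?C x y) = ?C a b - ?s a * ?s b * ?C (?f b) (?f a)"
      by (simp only: Z_def left_diff_distrib sum_subtractf mult.assoc sum_matrix_unit[OF ab]
            sum_matrix_unit[OF f(1)[OF ab(2)] f(1)[OF ab(1)]] flip: sum_distrib_left)
    also have "?s a * ?s b * ?C (?f b) (?f a) = - ?C a b"
    proof -
      have "?s a * ?s b * X j $$ (?f b, ?f a) = - X j $$ (a, b)" if "j < d" for j
      proof -
        have "?s (?f a) * X j $$ (?f (?f a), b) = ?s b * X j $$ (?f b, ?f a)"
          using XE[OF that] infinitesimal_Sp_iff[OF ev, of "X j"] f(1) ab by (auto simp: lie_equations_def Sp)
        then have "?s b * X j $$ (?f b, ?f a) = - (?s a * X j $$ (a, b))" using f ab by simp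
        then have "?s a * (?s b * X j $$ (?f b, ?f a)) = - (?s a * ?s a * X j $$ (a, b))" by simp
        then show ?thesis by (simp add: s mult.assoc)
      qed
      then have "(\<Sum>j<d. ?s a * ?s b * X j $$ (?f b, ?f a) * X j $$ (u, v)) = (\<Sum>j<d. - X j $$ (a, b) * X j $$ (u, v))"
        by (intro sum.cong) auto
      then show ?thesis by (simp add: sum_distrib_left sum_negf mult.assoc)
    qed
    finally have "?C a b = - Z a b u v / of_nat N" using N0 by (simp add: Sp field_simps)
    moreover have "(\<Sum>w\<in>allowed_ops G. pair_weight G N w a b u v) = - Z a b u v / of_nat N"
    proof -
      have "(u = b \<and> v = a) = (a = v \<and> b = u)" by blast
      then show ?thesis using ab uv by (simp add: Sp Z_def symp_J_entry[OF ev] diff_divide_distrib)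
    qed
    ultimately show ?thesis by simp
  qed
qed

section \<open>Second moments of the Gaussian matrix\<close>

lemma std_gaussian_family_covariance:
  assumes "prob_space M" and B: "std_gaussian_family M d B" and jl: "j < d" "l < d"
  shows "integrable M (\<lambda>\<omega>. B j \<omega> * B l \<omega>)" and "(\<integral>\<omega>. B j \<omega> * B l \<omega> \<partial>M) = (if j = l then 1 else 0)"
proof -
  interpret prob_space M by fact
  have D: "distributed M lborel (B i) std_normal_density" if "i < d" for i
    using B that by (simp add: std_gaussian_family_def)
  have int1: "integrable M (B i)" if "i < d" for i
    using distributed_integrable[OF D[OF that], of "\<lambda>x. x"] integrable_std_normal_moment[of 1] by simp
  have "integrable M (\<lambda>\<omega>. B j \<omega> * B l \<omega>) \<and> (\<integral>\<omega>. B j \<omega> * B l \<omega> \<partial>M) = (if j = l then 1 else 0)"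
  proof (cases "j = l")
    case True
    have "integrable M (\<lambda>\<omega>. (B j \<omega>)\<^sup>2)"
      using distributed_integrable[OF D[OF jl(1)], of "\<lambda>x. x\<^sup>2"] integrable_std_normal_moment[of 2] by simp
    moreover have "(\<integral>\<omega>. (B j \<omega>)\<^sup>2 \<partial>M) = 1"
      using distributed_integral[OF D[OF jl(1)], of "\<lambda>x. x\<^sup>2"] integral_std_normal_moment_even[of 1] by simp
    ultimately show ?thesis using True by (simp add: power2_eq_square)
  next
    case False
    have ind: "indep_vars (\<lambda>_. borel) B {j, l}"
    proof (rule indep_vars_subset)
      show "indep_vars (\<lambda>_. borel) B {..<d}" using B unfolding std_gaussian_family_def by blast
      show "{j, l} \<subseteq> {..<d}" using jl by simp
    qed
    have int: "integrable M (B i)" if "i \<in> {j, l}" for i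
      using that int1[OF jl(1)] int1[OF jl(2)] by blast
    have fin: "finite {j, l}" by simp
    note indep_vars_lebesgue_integral[OF fin ind int] indep_vars_integrable[OF fin ind int]
    then show ?thesis using False standard_normal_distributed_expectation[OF D[OF jl(1)]] by simp
  qed
  then show "integrable M (\<lambda>\<omega>. B j \<omega> * B l \<omega>)" "(\<integral>\<omega>. B j \<omega> * B l \<omega> \<partial>M) = (if j = l then 1 else 0)"
    by auto
qed

lemma gaussian_matrix_covariance:
  assumes N: "N \<ge> 1" and even: "G = Sp \<Longrightarrow> even N" and M: "prob_space M"
    and basis: "lie_orthonormal_basis G N d X" and B: "std_gaussian_family M d B"
    and ab: "a < N" "b < N" and uv: "u < N" "v < N"
  shows "(\<integral>\<omega>. real_lincomb N d (\<lambda>j. B j \<omega>) X $$ (a, b) * real_lincomb N d (\<lambda>j. B j \<omega>) X $$ (u, v) \<partial>M) =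
    (\<Sum>w\<in>allowed_ops G. pair_weight G N w a b u v)"
proof -
  note cov = std_gaussian_family_covariance[OF M B]
  have int: "integrable M (\<lambda>\<omega>. of_real (B j \<omega> * B l \<omega>) * z)" if "j < d" "l < d" for j l and z :: complex
    using cov(1)[OF that] by (intro integrable_mult_left integrable_of_real)
  have "(\<integral>\<omega>. real_lincomb N d (\<lambda>j. B j \<omega>) X $$ (a, b) * real_lincomb N d (\<lambda>j. B j \<omega>) X $$ (u, v) \<partial>M) =
     (\<integral>\<omega>. (\<Sum>j<d. \<Sum>l<d. of_real (B j \<omega> * B l \<omega>) * (X j $$ (a, b) * X l $$ (u, v))) \<partial>M)"
    using ab uv by (simp add: real_lincomb_def sum_product mult_ac)
  also have "\<dots> = (\<Sum>j<d. \<Sum>l<d. of_real (\<integral>\<omega>. B j \<omega> * B l \<omega> \<partial>M) * (X j $$ (a, b) * X l $$ (u, v)))"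
  proof -
    have "(\<integral>\<omega>. (\<Sum>j<d. \<Sum>l<d. of_real (B j \<omega> * B l \<omega>) * (X j $$ (a, b) * X l $$ (u, v))) \<partial>M) =
        (\<Sum>j<d. \<integral>\<omega>. (\<Sum>l<d. of_real (B j \<omega> * B l \<omega>) * (X j $$ (a, b) * X l $$ (u, v))) \<partial>M)"
      by (intro Bochner_Integration.integral_sum Bochner_Integration.integrable_sum int) auto
    also have "\<dots> = (\<Sum>j<d. \<Sum>l<d. \<integral>\<omega>. of_real (B j \<omega> * B l \<omega>) * (X j $$ (a, b) * X l $$ (u, v)) \<partial>M)"
      by (intro sum.cong refl Bochner_Integration.integral_sum int) auto
    also have "\<dots> = (\<Sum>j<d. \<Sum>l<d. of_real (\<integral>\<omega>. B j \<omega> * B l \<omega> \<partial>M) * (X j $$ (a, b) * X l $$ (u, v)))"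
      by (simp only: Bochner_Integration.integral_mult_left_zero integral_complex_of_real)
    finally show ?thesis .
  qed
  also have "\<dots> = (\<Sum>j<d. \<Sum>l<d. if j = l then X j $$ (a, b) * X l $$ (u, v) else 0)"
    by (intro sum.cong refl) (simp add: cov(2))
  also have "\<dots> = (\<Sum>j<d. X j $$ (a, b) * X j $$ (u, v))" by simp
  also have "\<dots> = (\<Sum>w\<in>allowed_ops G. pair_weight G N w a b u v)"
    by (rule lie_basis_casimir[OF N _ basis ab uv]) (rule even)
  finally show ?thesis .
qed

section \<open>Signs and cycles\<close>

lemma refl_generated_equiv [simp]: "(x, x) \<in> generated_equiv r"
  by (simp add: generated_equiv_def)

lemma generated_equivI: "(x, y) \<in> r \<Longrightarrow> (x, y) \<in> generated_equiv r"
  by (auto simp: generated_equiv_def)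

lemma sym_generated_equiv: "sym (generated_equiv r)"
  unfolding generated_equiv_def by (rule sym_rtrancl) (auto simp: sym_def)

lemma trans_generated_equiv: "trans (generated_equiv r)"
  by (simp add: generated_equiv_def trans_rtrancl)

lemma equiv_generated_equiv: "equiv UNIV (generated_equiv r)"
  by (rule equivI) (simp_all add: sym_generated_equiv trans_generated_equiv refl_on_def)

lemma generated_equiv_respects:
  assumes "(x, y) \<in> generated_equiv r" and "\<And>u v. (u, v) \<in> r \<Longrightarrow> f u = f v"
  shows "f x = f y"
  using assms(1) unfolding generated_equiv_def
  by (induction rule: rtrancl_induct) (use assms(2) in \<open>auto dest: sym\<close>)

lemma generated_equiv_Image_eq:
  assumes "(x, y) \<in> generated_equiv r"
  shows "generated_equiv r `` {x} = generated_equiv r `` {y}"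
  using assms equiv_generated_equiv by (metis equiv_class_eq_iff)

text \<open>Compatible labels are the pullbacks of arbitrary labels of the classes. The equivalence
  lives on the whole type; since no generator joins \<open>S\<close> to its complement, the classes
  that meet \<open>S\<close> lie inside it.\<close>

lemma card_labels_respecting:
  fixes S :: "'a set" and r :: "'a rel"
  assumes S: "finite S" and r: "\<And>x y. (x, y) \<in> r \<Longrightarrow> x \<in> S \<longleftrightarrow> y \<in> S"
  shows "card {c \<in> S \<rightarrow>\<^sub>E {..<N::nat}. \<forall>(x, y)\<in>r. x \<in> S \<longrightarrow> c x = c y} = N ^ card (S // generated_equiv r)"
proof -
  let ?E = "generated_equiv r"
  let ?F = "{c \<in> S \<rightarrow>\<^sub>E {..<N}. \<forall>(x, y)\<in>r. x \<in> S \<longrightarrow> c x = c y}"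
  let ?h = "\<lambda>f. \<lambda>x\<in>S. f (?E `` {x})"
  have finQ: "finite (S // ?E)" using S by (auto simp: quotient_def)
  have img: "?h ` (S // ?E \<rightarrow>\<^sub>E {..<N}) = ?F"
  proof (intro equalityI subsetI)
    fix c assume "c \<in> ?h ` (S // ?E \<rightarrow>\<^sub>E {..<N})"
    then obtain f where f: "f \<in> S // ?E \<rightarrow>\<^sub>E {..<N}" and c: "c = ?h f" by auto
    have "?E `` {x} = ?E `` {y}" if "(x, y) \<in> r" for x y
      by (rule generated_equiv_Image_eq, rule generated_equivI, rule that)
    then show "c \<in> ?F" using f r unfolding c by (auto simp: quotientI PiE_iff)
  next
    fix c assume c: "c \<in> ?F"
    have resp: "y \<in> S \<and> c x = c y" if "(x, y) \<in> ?E" "x \<in> S" for x y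
    proof -
      \<comment> \<open>The extra value \<open>None\<close> outside \<open>S\<close> lets a single
        invariance argument give both membership in \<open>S\<close> and equality of labels.\<close>
      have "(if x \<in> S then Some (c x) else None) = (if y \<in> S then Some (c y) else None)"
        by (rule generated_equiv_respects[OF that(1)]) (use c r in auto)
      then show ?thesis using that(2) by (auto split: if_splits)
    qed
    define f where "f = (\<lambda>Q\<in>S // ?E. c (SOME x. x \<in> Q))"
    have some: "(SOME z. z \<in> ?E `` {x}) \<in> ?E `` {x}" for x
      by (rule someI[of _ x]) auto
    have fv: "f (?E `` {x}) = c x" if "x \<in> S" for x
      using some[of x] resp[of x] that by (auto simp: f_def quotientI)
    have "f \<in> S // ?E \<rightarrow>\<^sub>E {..<N}"
    proof
      fix Q assume "Q \<in> S // ?E"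
      then obtain x where "x \<in> S" "Q = ?E `` {x}" by (auto elim: quotientE)
      then show "f Q \<in> {..<N}" using fv c by auto
    qed (auto simp: f_def)
    moreover have "c = ?h f"
      using c fv by (auto simp: fun_eq_iff restrict_def PiE_iff extensional_def)
    ultimately show "c \<in> ?h ` (S // ?E \<rightarrow>\<^sub>E {..<N})" by blast
  qed
  have inj: "inj_on ?h (S // ?E \<rightarrow>\<^sub>E {..<N})"
  proof (rule inj_onI)
    fix f g assume f: "f \<in> S // ?E \<rightarrow>\<^sub>E {..<N}" and g: "g \<in> S // ?E \<rightarrow>\<^sub>E {..<N}" and eq: "?h f = ?h g"
    show "f = g"
    proof (rule PiE_ext[OF f g])
      fix Q assume "Q \<in> S // ?E"
      then obtain x where x: "x \<in> S" "Q = ?E `` {x}" by (auto elim: quotientE)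
      then show "f Q = g Q" using fun_cong[OF eq, of x] by simp
    qed
  qed
  have "card ?F = card (S // ?E \<rightarrow>\<^sub>E {..<N})"
    using card_image[OF inj] img by simp
  also have "\<dots> = N ^ card (S // ?E)" using finQ by (simp add: card_PiE)
  finally show ?thesis .
qed

text \<open>
  Counting the invariant labels with two values counts the cycles of a permutation, including its
  fixed points.
\<close>

lemma sign_eq_card_invariant_labels:
  assumes "finite S" and "p permutes S"
  shows "\<exists>k. card {c \<in> S \<rightarrow>\<^sub>E {..<2::nat}. \<forall>y\<in>S. c (p y) = c y} = 2 ^ k \<and>
             sign p = (- 1) ^ (card S + k)"
  using assms
proof (induction S arbitrary: p rule: finite_induct)
  case empty
  then show ?case by (intro exI[of _ 0]) (auto simp: permutes_empty)
next
  case (insert x S)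
  let ?F = "\<lambda>S p. {c \<in> S \<rightarrow>\<^sub>E {..<2::nat}. \<forall>y\<in>S. c (p y) = c y}"
  \<comment> \<open>\<open>q\<close> is \<open>p\<close> with \<open>x\<close> cut out of its cycle.
    If \<open>x\<close> was fixed, its label is free and the count doubles; otherwise its label is
    forced to be that of \<open>p x\<close>, so the count stays and the sign changes.\<close>
  define q where "q = Transposition.transpose x (p x) \<circ> p"
  have q: "q permutes S" using permutes_insert_lemma[OF insert.prems] by (simp add: q_def)
  obtain k where k: "card (?F S q) = 2 ^ k" "sign q = (- 1) ^ (card S + k)"
    using insert.IH[OF q] by blast
  have qS: "q y \<in> S \<longleftrightarrow> y \<in> S" for y using q by (rule permutes_in_image)
  have p_eq: "p = Transposition.transpose x (p x) \<circ> q" by (simp add: q_def o_assoc[symmetric] flip: comp_assoc)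
  have sgn: "sign p = (if p x = x then 1 else - 1) * sign q"
    by (subst p_eq, subst sign_compose)
      (use permutation_swap_id permutation_permutes[of q] q insert.hyps(1) in \<open>auto simp: sign_swap_id\<close>)
  show ?case
  proof (cases "p x = x")
    case True
    then have [simp]: "q = p" by (simp add: q_def)
    have img: "?F (insert x S) p = (\<lambda>(y, g). g(x := y)) ` ({..<2} \<times> ?F S p)"
    proof (intro equalityI subsetI)
      fix c assume c: "c \<in> ?F (insert x S) p"
      have "c = (\<lambda>(y, g). g(x := y)) (c x, c(x := undefined))" by simp
      moreover have "(c x, c(x := undefined)) \<in> {..<2} \<times> ?F S p"
        using c insert.hyps(2) qS by (auto simp: PiE_iff extensional_def)
      ultimately show "c \<in> (\<lambda>(y, g). g(x := y)) ` ({..<2} \<times> ?F S p)" by (rule image_eqI)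
    next
      fix c assume "c \<in> (\<lambda>(y, g). g(x := y)) ` ({..<2} \<times> ?F S p)"
      then obtain v g where "c = g(x := v)" "v < 2" "g \<in> ?F S p" by auto
      then show "c \<in> ?F (insert x S) p"
        using True insert.hyps(2) qS by (auto simp: PiE_iff extensional_def)
    qed
    have inj: "inj_on (\<lambda>(y, g). g(x := y)) ({..<2::nat} \<times> ?F S p)"
    proof (rule inj_onI, clarify)
      fix u u' :: nat and g g' 
      assume g: "g \<in> S \<rightarrow>\<^sub>E {..<2}" "g' \<in> S \<rightarrow>\<^sub>E {..<2}" and eq: "g(x := u) = g'(x := u')"
      have "g z = g' z" for z
        using fun_cong[OF eq, of z] PiE_arb[OF g(1), of x] PiE_arb[OF g(2), of x] insert.hyps
        by (cases "z = x") auto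
      then show "u = u' \<and> g = g'" using fun_cong[OF eq, of x] by auto
    qed
    have "card (?F (insert x S) p) = 2 ^ Suc k"
      unfolding img card_image[OF inj] using k by (simp add: card_cartesian_product)
    then show ?thesis using True sgn k insert.hyps by (intro exI[of _ "Suc k"]) auto
  next
    case False
    have px: "p x \<in> S" using False permutes_in_image[OF insert.prems, of x] by auto
    have qv: "q y = (if p y = x then p x else p y)" if "y \<in> S" for y
    proof -
      have "p y \<noteq> p x" using that insert.hyps permutes_inj[OF insert.prems] by (auto dest: injD)
      then show ?thesis by (auto simp: q_def Transposition.transpose_def)
    qed
    let ?h = "\<lambda>c :: 'a \<Rightarrow> nat. c(x := c (p x))"
    have pS: "p y \<in> S" if "y \<in> S" "p y \<noteq> x" for y
      using that permutes_in_image[OF insert.prems, of y] by auto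
    have img: "?F (insert x S) p = ?h ` ?F S q"
    proof (intro equalityI subsetI)
      fix c assume c: "c \<in> ?F (insert x S) p"
      let ?g = "c(x := undefined)"
      have "?g \<in> ?F S q" using c px qv insert.hyps pS by (auto simp: PiE_iff extensional_def)
      moreover have "c = ?h ?g" using c False by (auto simp: fun_eq_iff)
      ultimately show "c \<in> ?h ` ?F S q" by blast
    next
      fix c assume "c \<in> ?h ` ?F S q"
      then obtain g where g: "g \<in> ?F S q" "c = ?h g" by auto
      have "g (p y) = g y" if "y \<in> S" "p y \<noteq> x" for y using g that qv[OF that(1)] by auto
      moreover have "g (p x) = g y" if "y \<in> S" "p y = x" for y using g that qv[OF that(1)] by auto
      ultimately show "c \<in> ?F (insert x S) p"
        using g px insert.hyps by (auto simp: PiE_iff extensional_def)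
    qed
    have inj: "inj_on ?h (?F S q)"
    proof (rule inj_onI)
      fix g g' assume g: "g \<in> ?F S q" "g' \<in> ?F S q" and eq: "?h g = ?h g'"
      have "g z = g' z" for z
        using fun_cong[OF eq, of z] g insert.hyps by (cases "z = x") (auto simp: PiE_iff extensional_def)
      then show "g = g'" by auto
    qed
    have "card (?F (insert x S) p) = 2 ^ k" unfolding img card_image[OF inj] using k by simp
    then show ?thesis using False sgn k insert.hyps by (intro exI[of _ k]) auto
  qed
qed

text \<open>The moved points fall into two-cycles; the induction peels off one transposition at a
  time.\<close>

lemma sign_involution:
  assumes "finite S" and "f permutes S" and "\<And>x. f (f x) = x"
  shows "sign f = (- 1) ^ (card {x \<in> S. f x \<noteq> x} div 2)"
  using assms(2,3)
proof (induction "card {x \<in> S. f x \<noteq> x}" arbitrary: f rule: less_induct)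
  case less
  show ?case
  proof (cases "{x \<in> S. f x \<noteq> x} = {}")
    case True
    then have "f = id" using less.prems(1) by (auto simp: fun_eq_iff permutes_def)
    then show ?thesis by simp
  next
    case False
    then obtain x where x: "x \<in> S" "f x \<noteq> x" by auto
    define g where "g = Transposition.transpose x (f x) \<circ> f"
    have fx: "f x \<in> S" using x less.prems(1) by (simp add: permutes_in_image)
    have g: "g permutes S" unfolding g_def
      by (rule permutes_compose[OF less.prems(1)], rule permutes_swap_id[OF x(1) fx])
    have gv: "g y = (if y = x \<or> y = f x then y else f y)" for y
    proof -
      have "f y = x \<longleftrightarrow> y = f x" "f y = f x \<longleftrightarrow> y = x" by (metis less.prems(2))+
      then show ?thesis unfolding g_def by (auto simp: Transposition.transpose_def)
    qed
    have gg: "g (g y) = y" for y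
    proof -
      have "f y = x \<longleftrightarrow> y = f x" "f y = f x \<longleftrightarrow> y = x" by (metis less.prems(2))+
      then show ?thesis using less.prems(2)[of y] unfolding gv by auto
    qed
    have mv: "{y \<in> S. f y \<noteq> y} = insert x (insert (f x) {y \<in> S. g y \<noteq> y})"
      using x fx less.prems(2) by (auto simp: gv)
    have card: "card {y \<in> S. f y \<noteq> y} = Suc (Suc (card {y \<in> S. g y \<noteq> y}))"
      unfolding mv using x assms(1) by (subst card_insert_disjoint; simp add: gv)+
    have f_eq: "f = Transposition.transpose x (f x) \<circ> g" by (simp add: g_def flip: comp_assoc)
    have "sign f = - sign g"
      by (subst f_eq, subst sign_compose)
        (use permutation_swap_id permutation_permutes[of g] g assms(1) x in \<open>auto simp: sign_swap_id\<close>)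
    then show ?thesis using less.hyps[OF _ g gg] card by simp
  qed
qed

section \<open>Permutations around the vertices\<close>

lemma permutes_finite_injI:
  assumes "finite S" and "inj f" and "\<And>x. x \<in> S \<Longrightarrow> f x \<in> S" and "\<And>x. x \<notin> S \<Longrightarrow> f x = x"
  shows "f permutes S"
proof (rule bij_imp_permutes)
  have "f ` S \<subseteq> S" and "inj_on f S" using assms(2,3) by (auto intro: inj_on_subset)
  then show "bij_betw f S S" using endo_inj_surj[OF assms(1)] by (simp add: bij_betw_def)
qed (use assms(4) in auto)

text \<open>
  \<open>\<tau>\<close> walks around the vertices, and \<open>s\<close> tells in which direction the walk passes a corner. Here
  \<open>\<phi>\<close> sends a corner to the next corner of its polygon, \<open>\<pi>\<close> matches the sides (named by their initial
  corners) and \<open>R\<close> marks the sides glued with the same orientation. Exchanging the two sides of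
  every pair along which \<open>s\<close> changes turns \<open>\<phi>\<close> into a permutation \<open>f\<close> with \<open>s\<close> constant on its cycles.
  Then \<open>f = u \<circ> v\<close>, where \<open>u\<close> and \<open>v\<close> move only the two values of \<open>s\<close>, and \<open>\<tau> = u \<circ> m \<circ> v\<inverse>\<close>, which
  gives its sign.
\<close>

lemma vertex_permutation:
  fixes S :: "'a set" and s R :: "'a \<Rightarrow> bool"
  assumes S: "finite S" and \<phi>: "\<phi> permutes S" and \<pi>: "\<pi> permutes S" and inv: "\<And>x. \<pi> (\<pi> x) = x"
    and R: "\<And>x. R (\<pi> x) = R x"
    and same: "\<And>x. R x \<Longrightarrow> s (\<pi> x) \<noteq> s x" "\<And>x. R x \<Longrightarrow> s (\<phi> (\<pi> x)) \<noteq> s (\<phi> x)"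
    and opp: "\<And>x. \<not> R x \<Longrightarrow> s (\<phi> (\<pi> x)) = s x"
  shows "\<exists>\<tau>. \<tau> permutes S \<and>
    sign \<tau> = sign \<phi> * sign \<pi> * (- 1) ^ (card {x \<in> S. R x \<and> s x \<noteq> s (\<phi> x)} div 2) \<and>
    (\<forall>c :: 'a \<Rightarrow> nat. (\<forall>x\<in>S. c (\<tau> x) = c x) \<longleftrightarrow>
       (\<forall>x\<in>S. if R x then c x = c (\<pi> x) \<and> c (\<phi> x) = c (\<phi> (\<pi> x)) else c x = c (\<phi> (\<pi> x)) \<and> c (\<phi> x) = c (\<pi> x)))"
proof -
  \<comment> \<open>The sides along which \<open>s\<close> changes. The gluing conditions make
    \<open>D\<close> common to both sides of a pair, so \<open>d\<close>, \<open>m\<close> and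
    \<open>\<rho>\<close> are involutions.\<close>
  define D where "D x \<longleftrightarrow> s x \<noteq> s (\<phi> x)" for x
  define d where "d x = (if D x then \<pi> x else x)" for x
  define m where "m x = (if D x \<and> \<not> R x then x else \<pi> x)" for x
  define \<rho> where "\<rho> x = (if D x \<and> R x then \<pi> x else x)" for x
  define f where "f x = \<phi> (d x)" for x
  define u where "u x = (if s x then f x else x)" for x
  define v where "v x = (if s x then x else f x)" for x
  have opp': "s (\<phi> x) = s (\<pi> x)" if "\<not> R x" for x using opp[of "\<pi> x"] that by (simp add: R inv)
  have D: "D (\<pi> x) = D x" for x using same[of x] opp[of x] opp'[of x] by (auto simp: D_def)
  have sf: "s (f x) = s x" for x
    using same[of x] opp[of x] by (auto simp: f_def d_def D_def)
  have out\<pi>: "\<pi> x = x" if "x \<notin> S" for x using that \<pi> by (simp add: permutes_not_in)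
  have in\<pi>: "\<pi> x \<in> S \<longleftrightarrow> x \<in> S" for x using \<pi> by (simp add: permutes_in_image)
  have invol: "g permutes S" if "\<And>x. g (g x) = x" "\<And>x. x \<in> S \<Longrightarrow> g x \<in> S" "\<And>x. x \<notin> S \<Longrightarrow> g x = x"
    for g using that S by (intro permutes_finite_injI) (auto intro: inj_on_inverseI)
  have dd: "d permutes S" by (rule invol) (auto simp: d_def D inv out\<pi> in\<pi>)
  have mm: "m permutes S" by (rule invol) (auto simp: m_def D R inv out\<pi> in\<pi>)
  have rr: "\<rho> permutes S" by (rule invol) (auto simp: \<rho>_def D R inv out\<pi> in\<pi>)
  have ff: "f permutes S" using permutes_compose[OF dd \<phi>] by (simp add: f_def[abs_def] o_def)
  have injf: "f x = f y \<longleftrightarrow> x = y" for x y using permutes_inj[OF ff] by (auto dest: injD)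
  have inf: "f x \<in> S \<longleftrightarrow> x \<in> S" for x using ff by (simp add: permutes_in_image)
  have outf: "f x = x" if "x \<notin> S" for x using that ff by (simp add: permutes_not_in)
  have uu: "u permutes S"
  proof (rule permutes_finite_injI[OF S])
    show "inj u" by (rule injI) (metis u_def sf injf)
  qed (auto simp: u_def inf outf)
  have vv: "v permutes S"
  proof (rule permutes_finite_injI[OF S])
    show "inj v" by (rule injI) (metis v_def sf injf)
  qed (auto simp: v_def inf outf)
  have perm: "permutation g" if "g permutes S" for g using that S by (auto simp: permutation_permutes)
  define \<tau> where "\<tau> = u \<circ> m \<circ> inv_into UNIV v"
  have tt: "\<tau> permutes S" unfolding \<tau>_def
    by (intro permutes_compose uu mm permutes_inv vv)
  have "f = u \<circ> v" by (auto simp: u_def v_def sf fun_eq_iff)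
  then have sfu: "sign f = sign u * sign v" using sign_compose[OF perm[OF uu] perm[OF vv]] by simp
  have "f = \<phi> \<circ> d" by (auto simp: f_def)
  then have sfd: "sign f = sign \<phi> * sign d" using sign_compose[OF perm[OF \<phi>] perm[OF dd]] by simp
  \<comment> \<open>Both compositions exchange the two sides of a pair, except that both fix them
    when \<open>D\<close> and \<open>R\<close> hold. This trades the signs of \<open>d\<close> and
    \<open>m\<close> for those of \<open>\<pi>\<close> and \<open>\<rho>\<close>.\<close>
  have "d \<circ> m = \<pi> \<circ> \<rho>" by (auto simp: d_def m_def \<rho>_def fun_eq_iff D R inv)
  then have sdm: "sign d * sign m = sign \<pi> * sign \<rho>"
    using sign_compose[OF perm[OF \<pi>] perm[OF rr]] sign_compose[OF perm[OF dd] perm[OF mm]] by simp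
  have "{x \<in> S. \<rho> x \<noteq> x} = {x \<in> S. R x \<and> s x \<noteq> s (\<phi> x)}"
    using same(1) by (auto simp: \<rho>_def D_def) metis+
  then have s\<rho>: "sign \<rho> = (- 1) ^ (card {x \<in> S. R x \<and> s x \<noteq> s (\<phi> x)} div 2)"
  proof -
    have "\<rho> (\<rho> x) = x" for x by (auto simp: \<rho>_def D R inv)
    from sign_involution[OF S rr this] show ?thesis
      using \<open>{x \<in> S. \<rho> x \<noteq> x} = _\<close> by simp
  qed
  have "sign \<tau> = sign u * sign m * sign v"
    unfolding \<tau>_def using perm[OF uu] perm[OF vv] perm[OF mm]
    by (simp add: sign_compose permutation_compose permutation_inverse sign_inverse)
  also have "\<dots> = sign \<phi> * (sign d * sign m)" using sfu sfd by (simp add: mult_ac)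
  finally have sgn: "sign \<tau> = sign \<phi> * sign \<pi> * (- 1) ^ (card {x \<in> S. R x \<and> s x \<noteq> s (\<phi> x)} div 2)"
    unfolding sdm s\<rho> by (simp add: mult_ac)
  \<comment> \<open>Substituting \<open>v y\<close> for \<open>x\<close> removes the inverse of
    \<open>v\<close> from the invariance condition.\<close>
  have inv\<tau>: "(\<forall>x\<in>S. c (\<tau> x) = c x) \<longleftrightarrow> (\<forall>y\<in>S. c (u (m y)) = c (v y))" for c :: "'a \<Rightarrow> nat"
  proof -
    have "(\<forall>x\<in>S. c (\<tau> x) = c x) \<longleftrightarrow> (\<forall>y\<in>S. c (\<tau> (v y)) = c (v y))"
      using permutes_image[OF vv] by (metis imageE imageI)
    then show ?thesis by (simp add: \<tau>_def inv_f_f[OF permutes_inj[OF vv]])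
  qed
  have pt: "(c (u (m y)) = c (v y)) \<longleftrightarrow>
      (if R y then (if s y then c (\<pi> y) = c y else c (\<phi> (\<pi> y)) = c (\<phi> y))
       else if s y then c (\<phi> (\<pi> y)) = c y else if D y then c y = c (\<phi> (\<pi> y)) else c (\<pi> y) = c (\<phi> y))"
    for c :: "'a \<Rightarrow> nat" and y
    using same[of y] opp[of y] opp'[of y] D[of y]
    by (auto simp: u_def v_def m_def f_def d_def D_def inv)
  \<comment> \<open>Each side yields one equation, and the two sides of a pair together yield both
    identifications: with same orientation because \<open>s\<close> differs on them, with opposite
    orientation because of the case split on \<open>D\<close>.\<close>
  have "(\<forall>y\<in>S. c (u (m y)) = c (v y)) \<longleftrightarrow>
      (\<forall>x\<in>S. if R x then c x = c (\<pi> x) \<and> c (\<phi> x) = c (\<phi> (\<pi> x)) else c x = c (\<phi> (\<pi> x)) \<and> c (\<phi> x) = c (\<pi> x))"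
    (is "?L \<longleftrightarrow> ?Q") for c :: "'a \<Rightarrow> nat"
  proof
    assume L: ?L
    show ?Q
    proof
      fix x assume x: "x \<in> S"
      have 1: "c (u (m x)) = c (v x)" "c (u (m (\<pi> x))) = c (v (\<pi> x))" using L x in\<pi> by auto
      show "if R x then c x = c (\<pi> x) \<and> c (\<phi> x) = c (\<phi> (\<pi> x)) else c x = c (\<phi> (\<pi> x)) \<and> c (\<phi> x) = c (\<pi> x)"
        using 1 same[of x] opp[of x] opp'[of x] unfolding pt
        by (auto simp: R inv D D_def split: if_splits)
    qed
  next
    assume ?Q
    then show ?L unfolding pt by (auto split: if_splits)
  qed
  then show ?thesis using tt sgn inv\<tau> by (intro exI[of _ \<tau>]) simp
qed

text \<open>The exponents \<open>V\<close> and \<open>n\<close> are the numbers of vertices and of faces.\<close>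

lemma vertex_face_parity:
  fixes S :: "'a set" and s R :: "'a \<Rightarrow> bool"
  assumes S: "finite S" and \<phi>: "\<phi> permutes S" and \<pi>: "\<pi> permutes S" and inv: "\<And>x. \<pi> (\<pi> x) = x"
    and R: "\<And>x. R (\<pi> x) = R x"
    and same: "\<And>x. R x \<Longrightarrow> s (\<pi> x) \<noteq> s x" "\<And>x. R x \<Longrightarrow> s (\<phi> (\<pi> x)) \<noteq> s (\<phi> x)"
    and opp: "\<And>x. \<not> R x \<Longrightarrow> s (\<phi> (\<pi> x)) = s x"
    and V: "card {c \<in> S \<rightarrow>\<^sub>E {..<2::nat}. \<forall>x\<in>S. if R x then c x = c (\<pi> x) \<and> c (\<phi> x) = c (\<phi> (\<pi> x))
              else c x = c (\<phi> (\<pi> x)) \<and> c (\<phi> x) = c (\<pi> x)} = 2 ^ V"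
    and n: "card {c \<in> S \<rightarrow>\<^sub>E {..<2::nat}. \<forall>x\<in>S. c (\<phi> x) = c x} = 2 ^ n"
  shows "(- 1) ^ (V + n) = sign \<pi> * (- 1) ^ (card {x \<in> S. R x \<and> s x \<noteq> s (\<phi> x)} div 2)"
proof -
  obtain \<tau> where \<tau>: "\<tau> permutes S"
      "sign \<tau> = sign \<phi> * sign \<pi> * (- 1) ^ (card {x \<in> S. R x \<and> s x \<noteq> s (\<phi> x)} div 2)"
      "card {c \<in> S \<rightarrow>\<^sub>E {..<2::nat}. \<forall>x\<in>S. c (\<tau> x) = c x} = 2 ^ V"
    using vertex_permutation[of S \<phi> \<pi> R s, OF S \<phi> \<pi> inv R same opp] V by auto
  have "sign \<tau> = (- 1) ^ (card S + V)"
    using sign_eq_card_invariant_labels[OF S \<tau>(1)] \<tau>(3) by auto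
  moreover have "sign \<phi> = (- 1) ^ (card S + n)"
    using sign_eq_card_invariant_labels[OF S \<phi>] n by auto
  ultimately have "(- 1) ^ (card S + V) = (- 1) ^ (card S + n) * (sign \<pi> * (- 1) ^ (card {x \<in> S. R x \<and> s x \<noteq> s (\<phi> x)} div 2))"
    using \<tau>(2) by (simp add: mult.assoc)
  then have "(- 1) ^ V = (- 1) ^ n * (sign \<pi> * (- 1) ^ (card {x \<in> S. R x \<and> s x \<noteq> s (\<phi> x)} div 2))"
    by (simp add: power_add mult.assoc)
  then show ?thesis by (simp add: power_add)
qed

text \<open>Joining \<open>e\<close> to \<open>\<kappa> e\<close> and to \<open>\<theta> e\<close>
  gives a graph whose components are paths or cycles alternating between two perfect matchings,
  hence bipartite. Each component consists of two orbits of
  \<open>\<kappa> \<circ> \<theta>\<close>, exchanged by both involutions; these orbits are the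
  colour classes.\<close>

lemma two_colouring_of_involutions:
  assumes k: "\<And>e. \<kappa> (\<kappa> e) = e" "\<And>e. \<kappa> e \<noteq> e" and t: "\<And>e. \<theta> (\<theta> e) = e" "\<And>e. \<theta> e \<noteq> e"
  obtains t :: "'e \<Rightarrow> bool" where "\<And>e. t (\<kappa> e) \<noteq> t e" and "\<And>e. t (\<theta> e) \<noteq> t e"
proof -
  define g where "g = \<kappa> \<circ> \<theta>"
  define E where "E = generated_equiv {(e, g e) | e. True}"
  have kg: "\<kappa> (g e) = \<theta> e" "g (\<theta> e) = \<kappa> e" "g (\<kappa> (g e)) = \<kappa> e" for e by (simp_all add: g_def k t)
  have injg: "g a = g b \<longleftrightarrow> a = b" for a b by (metis comp_apply g_def k(1) t(1))
  \<comment> \<open>otherwise a conjugate of \<open>\<kappa>\<close> or \<open>\<theta>\<close>, hence \<open>\<kappa>\<close> or \<open>\<theta>\<close>, would have a fixed point\<close>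
  have ne: "(g ^^ n) e \<noteq> \<kappa> e" for n e
  proof (induction n arbitrary: e rule: less_induct)
    case (less n)
    consider "n = 0" | "n = 1" | m where "n = Suc (Suc m)" by (cases n; cases "n - 1") auto
    then show ?case
    proof cases
      case 1 then show ?thesis using k(2)[of e] by simp
    next
      case 2 then show ?thesis using t(2)[of e] k(1) by (auto simp: g_def) metis
    next
      case 3
      have "(g ^^ m) (g e) \<noteq> \<theta> e" using less.IH[of m "g e"] 3 kg by simp
      then have "g ((g ^^ m) (g e)) \<noteq> \<kappa> e" using kg(2)[of e] injg by metis
      then show ?thesis using 3 by (simp add: funpow_swap1)
    qed
  qed
  \<comment> \<open>Injectivity of \<open>g\<close> collapses a zigzag of forward and backward steps
    to a power in one direction.\<close>
  have E_pow: "\<exists>n. y = (g ^^ n) x \<or> x = (g ^^ n) y" if "(x, y) \<in> E" for x y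
    using that unfolding E_def generated_equiv_def
  proof (induction rule: rtrancl_induct)
    case base show ?case by (rule exI[of _ 0]) simp
  next
    case (step y z)
    from step obtain n where "y = (g ^^ n) x \<or> x = (g ^^ n) y" by blast
    moreover have "z = g y \<or> y = g z" using step by auto
    ultimately consider "y = (g ^^ n) x" "z = g y" | "x = (g ^^ n) y" "y = g z"
      | "y = (g ^^ n) x" "y = g z" | "x = (g ^^ n) y" "z = g y" by blast
    then show ?case
    proof cases
      case 1 then show ?thesis by (intro exI[of _ "Suc n"]) simp
    next
      case 2 then show ?thesis by (intro exI[of _ "Suc n"]) (simp add: funpow_swap1)
    next
      case 3
      show ?thesis
      proof (cases n)
        case 0 then show ?thesis using 3 by (intro exI[of _ 1]) simp
      next
        case (Suc l) then show ?thesis using 3 by (intro exI[of _ l]) (simp add: injg)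
      qed
    next
      case 4
      show ?thesis
      proof (cases n)
        case 0 then show ?thesis using 4 by (intro exI[of _ 1]) simp
      next
        case (Suc l) then show ?thesis using 4 by (intro exI[of _ l]) (simp add: funpow_swap1)
      qed
    qed
  qed
  define O' where "O' e = E `` {e}" for e
  have O_g: "O' (g e) = O' e" for e
    unfolding O'_def E_def by (rule generated_equiv_Image_eq[symmetric], rule generated_equivI) blast
  have O_k: "O' (\<kappa> e) \<noteq> O' e" for e
  proof
    assume "O' (\<kappa> e) = O' e"
    moreover have "\<kappa> e \<in> O' (\<kappa> e)" by (simp add: O'_def E_def)
    ultimately have "(e, \<kappa> e) \<in> E" by (simp add: O'_def)
    then obtain n where "\<kappa> e = (g ^^ n) e \<or> e = (g ^^ n) (\<kappa> e)" using E_pow by blast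
    then show False using ne[of n e] ne[of n "\<kappa> e", unfolded k(1)] by metis
  qed
  have O_t: "O' (\<theta> e) = O' (\<kappa> e)" for e using O_g[of "\<theta> e"] kg by simp
  have O_kt: "O' (\<kappa> (\<theta> e)) = O' e" for e using O_g[of e] by (simp add: g_def)
  \<comment> \<open>One orbit of each exchanged pair is chosen. The choice is made from the
    unordered pair and is therefore the same for \<open>e\<close>, \<open>\<kappa> e\<close> and
    \<open>\<theta> e\<close>.\<close>
  define h where "h e = (SOME Q. Q \<in> {O' e, O' (\<kappa> e)})" for e
  define c where "c e \<longleftrightarrow> h e = O' e" for e
  have h: "h e = O' e \<or> h e = O' (\<kappa> e)" for e
    using someI[of "\<lambda>Q. Q \<in> {O' e, O' (\<kappa> e)}" "O' e"] by (auto simp: h_def)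
  have hk: "h (\<kappa> e) = h e" for e unfolding h_def by (simp add: k insert_commute)
  have ht: "h (\<theta> e) = h e" for e unfolding h_def by (simp add: O_t O_kt insert_commute)
  show thesis
  proof (rule that[of c])
    show "c (\<kappa> e) \<noteq> c e" for e using h[of e] O_k[of e] by (auto simp: c_def hk)
    show "c (\<theta> e) \<noteq> c e" for e using h[of e] O_k[of e] by (auto simp: c_def ht O_t)
  qed
qed

text \<open>
  The two ends of sides at a corner \<open>x\<close> are encoded as \<open>(x, True)\<close> for the outgoing and
  \<open>(x, False)\<close> for the incoming side; \<open>\<kappa>\<close> exchanges them and \<open>\<theta>\<close> is the gluing of ends.
\<close>

lemma corner_signs_exist:
  fixes R :: "'a \<Rightarrow> bool"
  assumes \<phi>: "\<phi> permutes S" and inv: "\<And>x. \<pi> (\<pi> x) = x"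
    and R: "\<And>x. R (\<pi> x) = R x" "\<And>x. R x \<Longrightarrow> \<pi> x \<noteq> x"
  obtains s :: "'a \<Rightarrow> bool" where "\<And>x. R x \<Longrightarrow> s (\<pi> x) \<noteq> s x" "\<And>x. R x \<Longrightarrow> s (\<phi> (\<pi> x)) \<noteq> s (\<phi> x)"
    "\<And>x. \<not> R x \<Longrightarrow> s (\<phi> (\<pi> x)) = s x"
proof -
  define \<kappa> :: "'a \<times> bool \<Rightarrow> 'a \<times> bool" where "\<kappa> = (\<lambda>(x, b). (x, \<not> b))"
  define \<psi> where "\<psi> = inv_into UNIV \<phi>"
  \<comment> \<open>The outgoing end at \<open>x\<close> belongs to side \<open>x\<close>, the
    incoming end to the side that ends there, \<open>\<psi> x\<close>. An opposite gluing matches an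
    outgoing with an incoming end, whence the change of the flag.\<close>
  define \<theta> :: "'a \<times> bool \<Rightarrow> 'a \<times> bool" where "\<theta> = (\<lambda>(x, b).
    if b then (if R x then (\<pi> x, b) else (\<phi> (\<pi> x), \<not> b))
    else (if R (\<psi> x) then (\<phi> (\<pi> (\<psi> x)), b) else (\<pi> (\<psi> x), \<not> b)))"
  have \<psi>: "\<psi> (\<phi> x) = x" "\<phi> (\<psi> x) = x" for x
    unfolding \<psi>_def using permutes_inverses[OF \<phi>] by auto
  have 1: "\<kappa> (\<kappa> e) = e" "\<kappa> e \<noteq> e" for e by (auto simp: \<kappa>_def split: prod.splits)
  have 2: "\<theta> (\<theta> e) = e" for e by (auto simp: \<theta>_def \<psi> inv R split: prod.splits)
  have 3: "\<theta> e \<noteq> e" for e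
    using R(2) \<psi> by (auto simp: \<theta>_def split: prod.splits if_splits) metis
  obtain t :: "'a \<times> bool \<Rightarrow> bool" where t: "\<And>e. t (\<kappa> e) \<noteq> t e" "\<And>e. t (\<theta> e) \<noteq> t e"
    by (rule two_colouring_of_involutions[OF 1 2 3]) blast
  have k: "t (x, False) = (\<not> t (x, True))" for x using t(1)[of "(x, True)"] by (auto simp: \<kappa>_def)
  show thesis
  proof (rule that[of "\<lambda>x. t (x, True)"])
    fix x
    show "t (\<pi> x, True) \<noteq> t (x, True)" if "R x" using t(2)[of "(x, True)"] that by (simp add: \<theta>_def)
    show "t (\<phi> (\<pi> x), True) \<noteq> t (\<phi> x, True)" if "R x"
      using t(2)[of "(\<phi> x, False)"] that by (simp add: \<theta>_def \<psi> k)
    show "t (\<phi> (\<pi> x), True) = t (x, True)" if "\<not> R x"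
      using t(2)[of "(x, True)"] that by (simp add: \<theta>_def k)
  qed
qed

section \<open>Cell structures of glued polygons\<close>

lemma set_sides: "set (sides ks) = (SIGMA i:{..<length ks}. {..<ks ! i})"
  by (auto simp: sides_def)

lemma length_sides: "length (sides ks) = sum_list ks"
proof -
  have "length (sides ks) = (\<Sum>i\<leftarrow>[0..<length ks]. ks ! i)"
    by (simp add: sides_def length_concat comp_def)
  then show ?thesis by (simp add: map_nth)
qed

lemma distinct_sides: "distinct (sides ks)"
proof -
  have "card (set (sides ks)) = (\<Sum>i<length ks. ks ! i)" by (simp add: set_sides)
  also have "\<dots> = length (sides ks)" by (simp add: length_sides sum_list_sum_nth atLeast0LessThan)
  finally show ?thesis by (rule card_distinct)
qed

lemma bij_betw_sides: "bij_betw ((!) (sides ks)) {..<sum_list ks} (set (sides ks))"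
  by (rule bij_betw_nth) (simp_all add: distinct_sides length_sides)

text \<open>
  The corners of polygon \<open>i\<close> form one cycle of \<open>next_corner ks\<close>; the single corner of a sphere is a
  fixed point.
\<close>

definition next_corner :: "nat list \<Rightarrow> nat \<times> nat \<Rightarrow> nat \<times> nat" where
  "next_corner ks x = (if x \<in> corners ks then (fst x, Suc (snd x) mod max 1 (ks ! fst x)) else x)"

text \<open>The pairing carried over from side numbers to initial corners. It is the identity off
  the sides, in particular at the corner of a sphere, so that it can serve as an involution of the
  whole type.\<close>

definition partner_corner :: "nat list \<Rightarrow> (nat \<Rightarrow> nat) \<Rightarrow> nat \<times> nat \<Rightarrow> nat \<times> nat" where
  "partner_corner ks \<pi> x = (if x \<in> set (sides ks)
     then sides ks ! \<pi> (inv_into {..<sum_list ks} ((!) (sides ks)) x) else x)"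

lemma finite_corners [simp]: "finite (corners ks)"
  by (simp add: corners_def)

lemma sides_subset_corners: "set (sides ks) \<subseteq> corners ks"
  by (auto simp: set_sides corners_def)

lemma fst_next_corner [simp]: "fst (next_corner ks x) = fst x"
  by (simp add: next_corner_def)

lemma next_corner_in_corners: "x \<in> corners ks \<Longrightarrow> next_corner ks x \<in> corners ks"
  by (auto simp: next_corner_def corners_def)

lemma Suc_mod_inj:
  assumes "i < k" "j < k" "Suc i mod k = Suc j mod k"
  shows "i = j"
proof -
  have "Suc n mod k = (if Suc n = k then 0 else Suc n)" if "n < k" for n using that by simp
  then show ?thesis using assms by (metis Zero_not_Suc old.nat.inject)
qed

lemma next_corner_permutes_restrict:
  "(\<lambda>x. if fst x \<in> C then next_corner ks x else x) permutes {x \<in> corners ks. fst x \<in> C}"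
proof (rule permutes_finite_injI)
  let ?f = "\<lambda>x. if fst x \<in> C then next_corner ks x else x"
  show "inj ?f"
  proof (rule injI)
    fix x y assume eq: "?f x = ?f y"
    have fst: "fst x = fst y" using arg_cong[OF eq, of fst] by (simp split: if_splits)
    have cor: "?f z \<in> corners ks \<longleftrightarrow> z \<in> corners ks" for z
      using next_corner_in_corners[of z ks] by (auto simp: next_corner_def)
    show "x = y"
    proof (cases "x \<in> corners ks \<and> fst x \<in> C")
      case True
      then have y: "y \<in> corners ks" using eq cor by metis
      have "snd x = snd y"
        by (rule Suc_mod_inj[of _ "max 1 (ks ! fst x)"])
          (use True y eq fst in \<open>auto simp: next_corner_def corners_def\<close>)
      then show ?thesis using fst by (simp add: prod_eq_iff)
    next
      case False
      then have "\<not> (y \<in> corners ks \<and> fst y \<in> C)" using eq cor fst by metis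
      then show ?thesis using eq False by (auto simp: next_corner_def split: if_splits)
    qed
  qed
next
  fix x assume "x \<notin> {x \<in> corners ks. fst x \<in> C}"
  then show "(if fst x \<in> C then next_corner ks x else x) = x" by (simp add: next_corner_def)
qed (simp_all add: next_corner_in_corners)

text \<open>An invariant label is constant along each boundary cycle and hence is a label of the
  faces; a sphere contributes its single corner. For \<open>N = 2\<close> this identifies the cycles
  of \<open>next_corner ks\<close> over \<open>C\<close> with the faces in \<open>C\<close>.\<close>

lemma card_next_corner_invariant:
  assumes C: "C \<subseteq> {..<length ks}"
  shows "card {c \<in> {x \<in> corners ks. fst x \<in> C} \<rightarrow>\<^sub>E {..<N::nat}.
      \<forall>x\<in>{x \<in> corners ks. fst x \<in> C}. c (next_corner ks x) = c x} = N ^ card C"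
proof -
  let ?S = "{x \<in> corners ks. fst x \<in> C}"
  let ?F = "{c \<in> ?S \<rightarrow>\<^sub>E {..<N}. \<forall>x\<in>?S. c (next_corner ks x) = c x}"
  let ?h = "\<lambda>g. \<lambda>x\<in>?S. g (fst x)"
  have fin: "finite C" using C finite_subset by blast
  have zero: "(i, 0) \<in> ?S" if "i \<in> C" for i using that C by (auto simp: corners_def)
  have img: "?h ` (C \<rightarrow>\<^sub>E {..<N}) = ?F"
  proof (intro equalityI subsetI)
    fix c assume "c \<in> ?h ` (C \<rightarrow>\<^sub>E {..<N})"
    then obtain g where "g \<in> C \<rightarrow>\<^sub>E {..<N}" "c = ?h g" by blast
    then show "c \<in> ?F" using next_corner_in_corners[of _ ks] by (simp add: PiE_iff extensional_def)
  next
    fix c assume c: "c \<in> ?F"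
    have const: "c (i, j) = c (i, 0)" if "(i, j) \<in> ?S" for i j
      using that
    proof (induction j)
      case (Suc j)
      then have "(i, j) \<in> ?S" "next_corner ks (i, j) = (i, Suc j)"
        by (auto simp: corners_def next_corner_def)
      then show ?case using Suc.IH c by force
    qed simp
    have "c = ?h (\<lambda>i\<in>C. c (i, 0))"
    proof
      fix x :: "nat \<times> nat"
      obtain i j where "x = (i, j)" by fastforce
      then show "c x = ?h (\<lambda>i\<in>C. c (i, 0)) x"
        using c const[of i j] by (auto simp: PiE_iff extensional_def)
    qed
    moreover have "(\<lambda>i\<in>C. c (i, 0)) \<in> C \<rightarrow>\<^sub>E {..<N}" using c zero by auto
    ultimately show "c \<in> ?h ` (C \<rightarrow>\<^sub>E {..<N})" by blast
  qed
  have inj: "inj_on ?h (C \<rightarrow>\<^sub>E {..<N})"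
  proof (rule inj_onI)
    fix f g assume f: "f \<in> C \<rightarrow>\<^sub>E {..<N}" and g: "g \<in> C \<rightarrow>\<^sub>E {..<N}" and eq: "?h f = ?h g"
    show "f = g"
    proof (rule PiE_ext[OF f g])
      fix i assume "i \<in> C"
      then show "f i = g i" using fun_cong[OF eq, of "(i, 0)"] zero[of i] by simp
    qed
  qed
  have "card ?F = card (C \<rightarrow>\<^sub>E {..<N})" using card_image[OF inj] unfolding img .
  then show ?thesis using fin by (simp add: card_PiE)
qed

section \<open>Sides and corners of polygons with a fixed pairing\<close>

locale paired_polygons =
  fixes ks :: "nat list" and \<pi> :: "nat \<Rightarrow> nat"
  assumes pairing: "is_pairing (sum_list ks) \<pi>"
begin

abbreviation "m \<equiv> sum_list ks"
abbreviation "pairs \<equiv> matched_pairs m \<pi>"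
abbreviation "side \<equiv> initial_corner ks"
abbreviation "partner \<equiv> partner_corner ks \<pi>"
abbreviation "succ_corner \<equiv> next_corner ks"

lemma pi: "p < m \<Longrightarrow> \<pi> p < m" "p < m \<Longrightarrow> \<pi> p \<noteq> p" "p < m \<Longrightarrow> \<pi> (\<pi> p) = p"
  using pairing by (auto simp: is_pairing_def)

lemma pairsD:
  assumes "(p, q) \<in> pairs"
  shows "p < m" "q < m" "p < q" "\<pi> p = q" "\<pi> q = p"
  using assms pi[of p] by (auto simp: matched_pairs_def)

lemma pairs_cases:
  assumes "p < m"
  obtains "(p, \<pi> p) \<in> pairs" | "(\<pi> p, p) \<in> pairs"
  using assms pi[of p] by (cases p "\<pi> p" rule: linorder_cases) (auto simp: matched_pairs_def)

lemma finite_pairs [simp]: "finite pairs"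
  by (rule finite_subset[of _ "{..<m} \<times> {..<m}"]) (auto simp: matched_pairs_def)

text \<open>A pair is listed once, smaller side first, so it accounts for exactly two sides.\<close>

lemma card_sides_of_pairs:
  assumes "\<And>p. p < m \<Longrightarrow> P (\<pi> p) \<longleftrightarrow> P p"
  shows "card {p. p < m \<and> P p} = 2 * card {(p, q) \<in> pairs. P p}"
proof -
  let ?A = "{(p, q) \<in> pairs. P p}"
  have "{p. p < m \<and> P p} = fst ` ?A \<union> snd ` ?A"
  proof (intro equalityI subsetI)
    fix p assume p: "p \<in> {p. p < m \<and> P p}"
    then have "p < m" by simp
    then show "p \<in> fst ` ?A \<union> snd ` ?A"
    proof (cases rule: pairs_cases)
      case 1
      then show ?thesis using p by force
    next
      case 2
      then have "(\<pi> p, p) \<in> ?A" using p assms by auto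
      then show ?thesis by force
    qed
  next
    fix p assume "p \<in> fst ` ?A \<union> snd ` ?A"
    then obtain a b where "(a, b) \<in> pairs" "P a" "p = a \<or> p = b" by auto
    then show "p \<in> {p. p < m \<and> P p}" using pairsD[of a b] assms[of a] by auto
  qed
  moreover have "fst ` ?A \<inter> snd ` ?A = {}"
  proof -
    have False if "(a, b) \<in> pairs" "(c, a) \<in> pairs" for a b c
      using pairsD[OF that(1)] pairsD[OF that(2)] by simp
    then show ?thesis by auto
  qed
  moreover have "inj_on fst ?A" by (rule inj_on_inverseI[of _ "\<lambda>p. (p, \<pi> p)"]) (auto dest: pairsD(4))
  moreover have "inj_on snd ?A" by (rule inj_on_inverseI[of _ "\<lambda>q. (\<pi> q, q)"]) (auto dest: pairsD(5))
  moreover have "finite ?A" by (rule finite_subset[OF _ finite_pairs]) auto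
  ultimately show ?thesis by (simp add: card_Un_disjoint card_image)
qed

lemma side_in_sides: "p < m \<Longrightarrow> side p \<in> set (sides ks)"
  by (simp add: initial_corner_def length_sides)

lemma side_in_corners: "p < m \<Longrightarrow> side p \<in> corners ks"
  using side_in_sides sides_subset_corners by blast

lemma terminal_eq: 
  assumes "p < m"
  shows "terminal_corner ks p = succ_corner (side p)"
proof -
  obtain i j where ij: "sides ks ! p = (i, j)" by fastforce
  then have "i < length ks" "j < ks ! i" using side_in_sides[OF assms] by (auto simp: initial_corner_def set_sides)
  then show ?thesis using ij by (auto simp: terminal_corner_def next_corner_def initial_corner_def corners_def max_def)
qed

lemma fst_side: "fst (side p) = polygon ks p"
  by (simp add: initial_corner_def polygon_def)

lemma fst_terminal: "p < m \<Longrightarrow> fst (terminal_corner ks p) = polygon ks p"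
  by (simp add: terminal_eq fst_side)

lemma polygon_less: "p < m \<Longrightarrow> polygon ks p < length ks"
  using side_in_sides[of p] by (auto simp: set_sides fst_side[symmetric])

lemma terminal_in_corners: "p < m \<Longrightarrow> terminal_corner ks p \<in> corners ks"
  by (simp add: terminal_eq next_corner_in_corners side_in_corners)

lemma side_cases:
  assumes "x \<in> set (sides ks)"
  obtains p where "p < m" "x = side p"
  using assms by (auto simp: in_set_conv_nth initial_corner_def length_sides)

lemma side_inj: "p < m \<Longrightarrow> q < m \<Longrightarrow> side p = side q \<longleftrightarrow> p = q"
  by (simp add: initial_corner_def nth_eq_iff_index_eq distinct_sides length_sides)

lemma partner_side:
  assumes "p < m"
  shows "partner (side p) = side (\<pi> p)"
proof -
  have "inv_into {..<m} ((!) (sides ks)) (side p) = p"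
    unfolding initial_corner_def
    by (rule inv_into_f_f) (use bij_betw_sides[of ks] assms in \<open>auto simp: bij_betw_def\<close>)
  then show ?thesis using side_in_sides[OF assms] by (simp add: partner_corner_def initial_corner_def)
qed

lemma partner_not_side: "x \<notin> set (sides ks) \<Longrightarrow> partner x = x"
  by (simp add: partner_corner_def)

lemma next_not_side:
  assumes "x \<notin> set (sides ks)"
  shows "succ_corner x = x"
proof (cases "x \<in> corners ks")
  case True
  then have "snd x = 0" "ks ! fst x = 0" using assms by (auto simp: corners_def set_sides)
  then show ?thesis using True by (simp add: next_corner_def prod_eq_iff)
qed (simp add: next_corner_def)

lemma partner_partner [simp]: "partner (partner x) = x"
proof (cases "x \<in> set (sides ks)")
  case True
  then obtain p where "p < m" "x = side p" by (rule side_cases)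
  then show ?thesis by (simp add: partner_side pi)
qed (simp add: partner_not_side)

text \<open>The marking \<open>R\<close> of the vertex permutation. It is a predicate on corners
  because sides are named there by their initial corners; the corner of a sphere is never
  marked.\<close>

definition glued_same :: "(nat \<times> nat \<Rightarrow> side_op) \<Rightarrow> nat \<times> nat \<Rightarrow> bool" where
  "glued_same s x \<longleftrightarrow> (\<exists>(p, q)\<in>pairs. s (p, q) = Glue_Same \<and> (x = side p \<or> x = side q))"

lemma glued_same_partner: "glued_same s (partner x) = glued_same s x"
proof -
  have "glued_same s x" if "glued_same s (partner x)" for x
  proof -
    from that obtain p q where pq: "(p, q) \<in> pairs" "s (p, q) = Glue_Same" "partner x = side p \<or> partner x = side q"
      by (auto simp: glued_same_def)
    have "x = side q \<or> x = side p"
      using pq(3) partner_side[OF pairsD(1)[OF pq(1)]] partner_side[OF pairsD(2)[OF pq(1)]]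
        pairsD(4,5)[OF pq(1)] by (metis partner_partner)
    then show ?thesis using pq unfolding glued_same_def by blast
  qed
  then show ?thesis by (metis partner_partner)
qed

lemma glued_same_side:
  assumes "(p, q) \<in> pairs"
  shows "glued_same s (side p) \<longleftrightarrow> s (p, q) = Glue_Same"
proof
  assume "glued_same s (side p)"
  then obtain a b where ab: "(a, b) \<in> pairs" "s (a, b) = Glue_Same" "side p = side a \<or> side p = side b"
    by (auto simp: glued_same_def)
  then have "p = a \<or> p = b" using pairsD[OF assms] pairsD[OF ab(1)] by (simp add: side_inj)
  then have "(a, b) = (p, q)" using pairsD[OF assms] pairsD[OF ab(1)] by auto
  then show "s (p, q) = Glue_Same" using ab by simp
qed (use assms in \<open>auto simp: glued_same_def\<close>)

lemma glued_same_in_sides: "glued_same s x \<Longrightarrow> x \<in> set (sides ks)"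
  using pairsD side_in_sides by (fastforce simp: glued_same_def)

lemma glued_same_partner_neq: "glued_same s x \<Longrightarrow> partner x \<noteq> x"
proof
  assume "glued_same s x" "partner x = x"
  then obtain p where "p < m" "x = side p" using glued_same_in_sides side_cases by metis
  then show False using \<open>partner x = x\<close> pi[of p] by (simp add: partner_side side_inj)
qed

abbreviation identified :: "(nat \<times> nat \<Rightarrow> side_op) \<Rightarrow> (nat \<times> nat) rel" where
  "identified s \<equiv> \<Union>x\<in>pairs. corner_identifications ks (s x) x"

lemma identified_in_corners: "(x, y) \<in> identified s \<Longrightarrow> x \<in> corners ks \<and> y \<in> corners ks"
proof -
  assume "(x, y) \<in> identified s"
  then obtain p q where pq: "(p, q) \<in> pairs" "(x, y) \<in> corner_identifications ks (s (p, q)) (p, q)"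
    by auto
  then show ?thesis using pairsD(1,2)[OF pq(1)]
    by (auto simp: corner_identifications_def side_in_corners terminal_in_corners split: side_op.splits)
qed

text \<open>A union of components. Parities are needed both for one surface, where orientability is
  decided, and for all polygons at once, where the symplectic signs are multiplied. Contracted pairs
  impose nothing, since a contraction joins no polygons.\<close>

definition closed_polygons :: "(nat \<times> nat \<Rightarrow> side_op) \<Rightarrow> nat set \<Rightarrow> bool" where
  "closed_polygons s C \<longleftrightarrow> C \<subseteq> {..<length ks} \<and>
     (\<forall>(p, q)\<in>glued_pairs ks \<pi> s. polygon ks p \<in> C \<longleftrightarrow> polygon ks q \<in> C)"

text \<open>A gluing relates corners of polygons that lie in \<open>C\<close> together or not at
  all, and a contraction identifies two corners of the same polygon.\<close>

lemma identified_closed: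
  assumes "closed_polygons s C" and "(x, y) \<in> identified s"
  shows "x \<in> corners ks \<and> fst x \<in> C \<longleftrightarrow> y \<in> corners ks \<and> fst y \<in> C"
proof -
  obtain p q where pq: "(p, q) \<in> pairs" "(x, y) \<in> corner_identifications ks (s (p, q)) (p, q)"
    using assms(2) by auto
  have "s (p, q) \<noteq> Contract \<Longrightarrow> polygon ks p \<in> C \<longleftrightarrow> polygon ks q \<in> C"
    using assms(1) pq(1) by (auto simp: closed_polygons_def glued_pairs_def)
  then have "fst x \<in> C \<longleftrightarrow> fst y \<in> C"
    using pq(2) pairsD[OF pq(1)]
    by (auto simp: corner_identifications_def fst_side fst_terminal split: side_op.splits)
  then show ?thesis using identified_in_corners[OF assms(2)] by simp
qed

lemma card_corner_labels:
  assumes "closed_polygons s C"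
  shows "card {c \<in> {x \<in> corners ks. fst x \<in> C} \<rightarrow>\<^sub>E {..<N::nat}.
      \<forall>(x, y)\<in>identified s. fst x \<in> C \<longrightarrow> c x = c y} = N ^ card (surface_vertices ks \<pi> s C)"
proof -
  let ?S = "{x \<in> corners ks. fst x \<in> C}"
  have "{c \<in> ?S \<rightarrow>\<^sub>E {..<N}. \<forall>(x, y)\<in>identified s. fst x \<in> C \<longrightarrow> c x = c y} =
      {c \<in> ?S \<rightarrow>\<^sub>E {..<N}. \<forall>(x, y)\<in>identified s. x \<in> ?S \<longrightarrow> c x = c y}"
    using identified_in_corners by blast
  moreover have "card {c \<in> ?S \<rightarrow>\<^sub>E {..<N}. \<forall>(x, y)\<in>identified s. x \<in> ?S \<longrightarrow> c x = c y} =
      N ^ card (?S // generated_equiv (identified s))"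
    by (rule card_labels_respecting) (use identified_closed[OF assms] in auto)
  ultimately show ?thesis by (simp add: surface_vertices_def corner_equiv_def)
qed

lemma card_all_corner_labels:
  "card {c \<in> corners ks \<rightarrow>\<^sub>E {..<N::nat}. \<forall>(x, y)\<in>identified s. c x = c y} =
     N ^ card (corners ks // corner_equiv ks \<pi> s)"
proof -
  have "{c \<in> corners ks \<rightarrow>\<^sub>E {..<N}. \<forall>(x, y)\<in>identified s. c x = c y} =
      {c \<in> corners ks \<rightarrow>\<^sub>E {..<N}. \<forall>(x, y)\<in>identified s. x \<in> corners ks \<longrightarrow> c x = c y}"
    using identified_in_corners by blast
  then show ?thesis
    using card_labels_respecting[of "corners ks" "identified s" N] identified_in_corners[of _ _ s]
    by (simp add: corner_equiv_def)
qed

end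

section \<open>Parity of the cell counts\<close>

lemma minus_one_power_eqD: "(- 1 :: int) ^ a = (- 1) ^ b \<Longrightarrow> even a = even b"
  by (simp add: minus_one_power_iff split: if_splits)

lemma card_eq_sum_over_classes:
  assumes "finite A" and "finite Q" and "\<And>x. x \<in> A \<Longrightarrow> \<exists>!C. C \<in> Q \<and> f x \<in> C"
  shows "(\<Sum>C\<in>Q. card {x \<in> A. f x \<in> C}) = card A"
proof -
  have "A = (\<Union>C\<in>Q. {x \<in> A. f x \<in> C})" using assms(3) by blast
  moreover have "card (\<Union>C\<in>Q. {x \<in> A. f x \<in> C}) = (\<Sum>C\<in>Q. card {x \<in> A. f x \<in> C})"
    by (rule card_UN_disjoint) (use assms in auto)
  ultimately show ?thesis by simp
qed

context paired_polygons
begin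

text \<open>Turns identifications listed by pairs into conditions at every corner, the shape in
  which the vertex permutation produces them. A pair is then tested from both of its sides, with the
  same outcome; the corner of a sphere is fixed by both maps and imposes nothing.\<close>

lemma identified_iff:
  assumes no_contract: "\<forall>x\<in>pairs. s x \<noteq> Contract" and C: "closed_polygons s C"
  shows "(\<forall>(x, y)\<in>identified s. fst x \<in> C \<longrightarrow> c x = c y) \<longleftrightarrow>
    (\<forall>x\<in>{x \<in> corners ks. fst x \<in> C}. if glued_same s x then c x = c (partner x) \<and> c (succ_corner x) = c (succ_corner (partner x))
       else c x = c (succ_corner (partner x)) \<and> c (succ_corner x) = c (partner x))"
    (is "?L \<longleftrightarrow> (\<forall>x\<in>?S. ?Q x)")
proof
  note ops = bspec[OF no_contract]
  assume L: ?L
  have pair: "?Q (side p) \<and> ?Q (side q)" if pq: "(p, q) \<in> pairs" and p: "polygon ks p \<in> C" for p q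
  proof -
    note d = pairsD[OF pq]
    have q: "polygon ks q \<in> C"
      using C pq p ops[OF pq] by (auto simp: closed_polygons_def glued_pairs_def)
    have id: "c x = c y" if "(x, y) \<in> corner_identifications ks (s (p, q)) (p, q)" for x y
    proof -
      have "(x, y) \<in> identified s" using that pq by blast
      moreover have "fst x \<in> C"
        using that p q d by (auto simp: corner_identifications_def fst_side fst_terminal split: side_op.splits)
      ultimately show ?thesis using L by blast
    qed
    have same: "glued_same s (side p) = (s (p, q) = Glue_Same)" "glued_same s (side q) = (s (p, q) = Glue_Same)"
      using glued_same_side[OF pq, of s] glued_same_partner[of s "side p"] d by (auto simp: partner_side)
    show ?thesis
    proof (cases "s (p, q)")
      case Glue_Same
      then have "c (side p) = c (side q)" "c (terminal_corner ks p) = c (terminal_corner ks q)"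
        by (intro id, simp add: corner_identifications_def)+
      then show ?thesis using Glue_Same d same by (simp add: partner_side terminal_eq)
    next
      case Glue_Opposite
      then have "c (side p) = c (terminal_corner ks q)" "c (terminal_corner ks p) = c (side q)"
        by (intro id, simp add: corner_identifications_def)+
      then show ?thesis using Glue_Opposite d same by (simp add: partner_side terminal_eq)
    next
      case Contract
      then show ?thesis using ops[OF pq] by simp
    qed
  qed
  show "\<forall>x\<in>?S. ?Q x"
  proof
    fix x assume x: "x \<in> ?S"
    show "?Q x"
    proof (cases "x \<in> set (sides ks)")
      case True
      then obtain p where p: "p < m" "x = side p" by (rule side_cases)
      then have pC: "polygon ks p \<in> C" using x by (simp add: fst_side)
      from p(1) show ?thesis
      proof (cases rule: pairs_cases)
        case 1
        then show ?thesis using pair[OF 1 pC] p by simp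
      next
        case 2
        then have "polygon ks (\<pi> p) \<in> C"
          using C pC ops[OF 2] by (auto simp: closed_polygons_def glued_pairs_def)
        then show ?thesis using pair[OF 2] p by simp
      qed
    next
      case False
      then have "\<not> glued_same s x" using glued_same_in_sides by blast
      then show ?thesis using False by (simp add: partner_not_side next_not_side)
    qed
  qed
next
  note ops = bspec[OF no_contract]
  assume Q: "\<forall>x\<in>?S. ?Q x"
  show ?L
  proof (clarify)
    fix i j i' j' p q assume pq: "(p, q) \<in> pairs"
      and id: "((i, j), (i', j')) \<in> corner_identifications ks (s (p, q)) (p, q)" and iC: "fst (i, j) \<in> C"
    note d = pairsD[OF pq]
    have "polygon ks p \<in> C \<longleftrightarrow> polygon ks q \<in> C"
      using C pq ops[OF pq] by (auto simp: closed_polygons_def glued_pairs_def)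
    then have "polygon ks p \<in> C" using iC id d ops[OF pq]
      by (auto simp: corner_identifications_def fst_side[symmetric] terminal_eq split: side_op.splits dest!: arg_cong[of _ _ fst])
    then have "side p \<in> ?S" using side_in_corners[OF d(1)] by (simp add: fst_side)
    then have "?Q (side p)" by (rule bspec[OF Q])
    then show "c (i, j) = c (i', j')"
      using id d ops[OF pq] glued_same_side[OF pq, of s]
      by (auto simp: corner_identifications_def partner_side terminal_eq split: side_op.splits)
  qed
qed

text \<open>On the corners over \<open>C\<close> the pairing is a product of one transposition per
  edge, so its sign supplies the edge count in the comparison of permutation signs. The function
  \<open>sg\<close> is left open because two different ones are used: a coherent orientation of the
  faces and the half of the index range that contains a label.\<close>

lemma component_parity:
  fixes sg :: "nat \<times> nat \<Rightarrow> bool"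
  assumes ops: "\<And>x. x \<in> pairs \<Longrightarrow> s x \<noteq> Contract" and C: "closed_polygons s C"
    and same: "\<And>p q. (p, q) \<in> pairs \<Longrightarrow> polygon ks p \<in> C \<Longrightarrow> s (p, q) = Glue_Same \<Longrightarrow>
      sg (side p) \<noteq> sg (side q) \<and> sg (terminal_corner ks p) \<noteq> sg (terminal_corner ks q)"
    and opp: "\<And>p q. (p, q) \<in> pairs \<Longrightarrow> polygon ks p \<in> C \<Longrightarrow> s (p, q) = Glue_Opposite \<Longrightarrow>
      sg (side p) = sg (terminal_corner ks q) \<and> sg (terminal_corner ks p) = sg (side q)"
  shows "(- 1) ^ (card (surface_vertices ks \<pi> s C) + card C) =
    (- 1 :: int) ^ (card (surface_edges ks \<pi> s C) +
      card {(p, q) \<in> surface_edges ks \<pi> s C. s (p, q) = Glue_Same \<and> sg (side p) \<noteq> sg (terminal_corner ks p)})"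
proof -
  let ?S = "{x \<in> corners ks. fst x \<in> C}"
  define \<phi> where "\<phi> x = (if fst x \<in> C then succ_corner x else x)" for x
  define \<rho> where "\<rho> x = (if x \<in> ?S then partner x else x)" for x
  define R where "R x \<longleftrightarrow> x \<in> ?S \<and> glued_same s x" for x
  have Cle: "C \<subseteq> {..<length ks}" using C by (simp add: closed_polygons_def)
  have polC: "polygon ks (\<pi> p) \<in> C \<longleftrightarrow> polygon ks p \<in> C" if "p < m" for p
    using that
  proof (cases rule: pairs_cases)
    case 1
    then show ?thesis using C ops[OF 1] by (auto simp: closed_polygons_def glued_pairs_def)
  next
    case 2
    then show ?thesis using C ops[OF 2] by (auto simp: closed_polygons_def glued_pairs_def)
  qed
  have partS: "partner x \<in> ?S \<longleftrightarrow> x \<in> ?S" for x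
  proof (cases "x \<in> set (sides ks)")
    case True
    then obtain p where "p < m" "x = side p" by (rule side_cases)
    then show ?thesis by (simp add: partner_side pi side_in_corners fst_side polC)
  qed (simp add: partner_not_side)
  have fin: "finite ?S" by simp
  have \<phi>: "\<phi> permutes ?S" using next_corner_permutes_restrict[of C ks] by (simp add: \<phi>_def[abs_def])
  have \<rho>\<rho>: "\<rho> (\<rho> x) = x" for x    unfolding \<rho>_def using partS[of x] partner_partner[of x] by presburger
  have \<rho>: "\<rho> permutes ?S"
  proof (rule permutes_finite_injI[OF fin])
    show "inj \<rho>" by (rule inj_on_inverseI[of _ \<rho>]) (rule \<rho>\<rho>)
    show "\<rho> x \<in> ?S" if "x \<in> ?S" for x using that partS[of x] unfolding \<rho>_def by (simp only: if_True)
    show "\<rho> x = x" if "x \<notin> ?S" for x using that unfolding \<rho>_def by (simp only: if_False)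
  qed
  have RR: "R (\<rho> x) = R x" for x
    using partS[of x] glued_same_partner[of s x] unfolding R_def \<rho>_def by presburger
  have cons: "if R x then sg (\<rho> x) \<noteq> sg x \<and> sg (\<phi> (\<rho> x)) \<noteq> sg (\<phi> x) else sg (\<phi> (\<rho> x)) = sg x" for x
  proof (cases "x \<in> ?S \<and> x \<in> set (sides ks)")
    case True
    then obtain p where p: "p < m" "x = side p" using side_cases by metis
    then have pC: "polygon ks p \<in> C" "polygon ks (\<pi> p) \<in> C" using True polC[of p] by (auto simp: fst_side)
    have x: "R x = glued_same s (side p)" "\<rho> x = side (\<pi> p)" "\<phi> x = terminal_corner ks p"
        "\<phi> (side (\<pi> p)) = terminal_corner ks (\<pi> p)"
      using True p pC pi[of p] by (auto simp: R_def \<rho>_def \<phi>_def partner_side terminal_eq fst_side)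
    from p(1) show ?thesis
    proof (cases rule: pairs_cases)
      case 1
      then show ?thesis unfolding x unfolding p(2)
        using same[OF 1 pC(1)] opp[OF 1 pC(1)] glued_same_side[OF 1, of s] ops[OF 1] by (cases "s (p, \<pi> p)") auto
    next
      case 2
      have "glued_same s (side p) = glued_same s (side (\<pi> p))"
        using glued_same_partner[of s "side p"] p by (simp add: partner_side)
      then show ?thesis unfolding x unfolding p(2)
        using same[OF 2 pC(2)] opp[OF 2 pC(2)] glued_same_side[OF 2, of s] ops[OF 2] by (cases "s (\<pi> p, p)") auto
    qed
  next
    case False
    then have "\<not> R x" using glued_same_in_sides[of s x] by (auto simp: R_def)
    moreover have "\<rho> x = x" "\<phi> x = x"
      using False by (auto simp: \<rho>_def \<phi>_def partner_not_side next_not_side) (auto simp: next_corner_def)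
    ultimately show ?thesis by simp
  qed
  have cR: "sg (\<rho> x) \<noteq> sg x" "sg (\<phi> (\<rho> x)) \<noteq> sg (\<phi> x)" if "R x" for x using cons[of x] that by auto
  have cN: "sg (\<phi> (\<rho> x)) = sg x" if "\<not> R x" for x using cons[of x] that by auto
  have V: "card {c \<in> ?S \<rightarrow>\<^sub>E {..<2::nat}. \<forall>x\<in>?S. if R x then c x = c (\<rho> x) \<and> c (\<phi> x) = c (\<phi> (\<rho> x))
              else c x = c (\<phi> (\<rho> x)) \<and> c (\<phi> x) = c (\<rho> x)} = 2 ^ card (surface_vertices ks \<pi> s C)"
  proof -
    have "(\<forall>x\<in>?S. if R x then c x = c (\<rho> x) \<and> c (\<phi> x) = c (\<phi> (\<rho> x))
              else c x = c (\<phi> (\<rho> x)) \<and> c (\<phi> x) = c (\<rho> x)) \<longleftrightarrow> (\<forall>(x, y)\<in>identified s. fst x \<in> C \<longrightarrow> c x = c y)"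
      for c :: "nat \<times> nat \<Rightarrow> nat"
    proof -
      have "R x = glued_same s x" "\<rho> x = partner x" "\<phi> x = succ_corner x"
        "\<phi> (partner x) = succ_corner (partner x)" if "x \<in> ?S" for x
        using that partS[of x] by (simp_all add: R_def \<rho>_def \<phi>_def)
      moreover have "\<forall>x\<in>pairs. s x \<noteq> Contract" using ops by blast
      ultimately show ?thesis
        unfolding identified_iff[OF \<open>\<forall>x\<in>pairs. s x \<noteq> Contract\<close> C]
        by (intro ball_cong refl) (simp only:)
    qed
    then show ?thesis using card_corner_labels[OF C, of 2] by simp
  qed
  have n: "card {c \<in> ?S \<rightarrow>\<^sub>E {..<2::nat}. \<forall>x\<in>?S. c (\<phi> x) = c x} = 2 ^ card C"
    using card_next_corner_invariant[OF Cle, of 2] by (simp add: \<phi>_def cong: conj_cong)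
  have main: "(- 1) ^ (card (surface_vertices ks \<pi> s C) + card C) =
      sign \<rho> * (- 1) ^ (card {x \<in> ?S. R x \<and> sg x \<noteq> sg (\<phi> x)} div 2)"
    by (rule vertex_face_parity[of ?S \<phi> \<rho> R sg]) (fact fin \<phi> \<rho> \<rho>\<rho> RR cR cN V n)+
  have inj: "inj_on side {..<m}" by (auto intro!: inj_onI simp: side_inj)
  \<comment> \<open>The permutation signs count corners, the conclusion counts edges. A property
    shared by the two sides of a pair converts one into the other with a factor 2, which the
    \<open>div 2\<close> in the signs absorbs.\<close>
  have cnt: "card {x \<in> ?S. P x} = 2 * card {(p, q) \<in> surface_edges ks \<pi> s C. P (side p)}"
    if P: "\<And>x. P x \<Longrightarrow> x \<in> set (sides ks)" "\<And>p. p < m \<Longrightarrow> polygon ks p \<in> C \<Longrightarrow> P (side (\<pi> p)) = P (side p)" for P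
  proof -
    have "{x \<in> ?S. P x} = side ` {p. p < m \<and> polygon ks p \<in> C \<and> P (side p)}"
    proof (intro equalityI subsetI)
      fix x assume x: "x \<in> {x \<in> ?S. P x}"
      then obtain p where "p < m" "x = side p" using P(1) side_cases by blast
      then show "x \<in> side ` {p. p < m \<and> polygon ks p \<in> C \<and> P (side p)}" using x by (auto simp: fst_side)
    qed (auto simp: side_in_corners fst_side)
    then have "card {x \<in> ?S. P x} = card {p. p < m \<and> polygon ks p \<in> C \<and> P (side p)}"
      using inj by (simp add: card_image inj_on_subset subset_iff)
    also have "\<dots> = 2 * card {(p, q) \<in> pairs. polygon ks p \<in> C \<and> P (side p)}"
      by (rule card_sides_of_pairs) (use polC P(2) in auto)
    also have "{(p, q) \<in> pairs. polygon ks p \<in> C \<and> P (side p)} = {(p, q) \<in> surface_edges ks \<pi> s C. P (side p)}"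
    proof -
      have "polygon ks q \<in> C" if "(p, q) \<in> pairs" "polygon ks p \<in> C" for p q
        using polC[of p] pairsD[OF that(1)] that(2) by simp
      then show ?thesis using ops by (auto simp: surface_edges_def glued_pairs_def)
    qed
    finally show ?thesis .
  qed
  have "sign \<rho> = (- 1) ^ card (surface_edges ks \<pi> s C)"
  proof -
    have "card {x \<in> ?S. \<rho> x \<noteq> x} = 2 * card {(p, q) \<in> surface_edges ks \<pi> s C. \<rho> (side p) \<noteq> side p}"
    proof (rule cnt)
      show "x \<in> set (sides ks)" if "\<rho> x \<noteq> x" for x using that partner_not_side[of x] by (auto simp: \<rho>_def split: if_splits)
      show "(\<rho> (side (\<pi> p)) \<noteq> side (\<pi> p)) = (\<rho> (side p) \<noteq> side p)" if "p < m" "polygon ks p \<in> C" for p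
      proof -
        have "\<rho> (side (\<pi> p)) = side p" "\<rho> (side p) = side (\<pi> p)"
          using that polC[of p] pi[of p] by (simp_all add: \<rho>_def partner_side side_in_corners fst_side)
        then show ?thesis by metis
      qed
    qed
    also have "{(p, q) \<in> surface_edges ks \<pi> s C. \<rho> (side p) \<noteq> side p} = surface_edges ks \<pi> s C"
    proof -
      have "\<rho> (side p) \<noteq> side p" if "(p, q) \<in> surface_edges ks \<pi> s C" for p q
      proof -
        have "(p, q) \<in> pairs" "polygon ks p \<in> C" using that by (auto simp: surface_edges_def glued_pairs_def)
        then show ?thesis using pairsD[of p q] by (simp add: \<rho>_def partner_side side_in_corners fst_side side_inj)
      qed
      then show ?thesis by auto
    qed
    finally show ?thesis using sign_involution[OF fin \<rho> \<rho>\<rho>] by simp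
  qed
  moreover have "card {x \<in> ?S. R x \<and> sg x \<noteq> sg (\<phi> x)} =
     2 * card {(p, q) \<in> surface_edges ks \<pi> s C. R (side p) \<and> sg (side p) \<noteq> sg (\<phi> (side p))}"
  proof (rule cnt)
    show "x \<in> set (sides ks)" if "R x \<and> sg x \<noteq> sg (\<phi> x)" for x using that glued_same_in_sides[of s x] by (auto simp: R_def)
    show "(R (side (\<pi> p)) \<and> sg (side (\<pi> p)) \<noteq> sg (\<phi> (side (\<pi> p)))) = (R (side p) \<and> sg (side p) \<noteq> sg (\<phi> (side p)))"
      if "p < m" "polygon ks p \<in> C" for p
    proof -
      have "side (\<pi> p) = \<rho> (side p)" using that by (simp add: \<rho>_def partner_side side_in_corners fst_side)
      then show ?thesis using RR cR[of "side p"] by auto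
    qed
  qed
  moreover have "{(p, q) \<in> surface_edges ks \<pi> s C. R (side p) \<and> sg (side p) \<noteq> sg (\<phi> (side p))} =
      {(p, q) \<in> surface_edges ks \<pi> s C. s (p, q) = Glue_Same \<and> sg (side p) \<noteq> sg (terminal_corner ks p)}"
  proof -
    have "R (side p) = (s (p, q) = Glue_Same) \<and> \<phi> (side p) = terminal_corner ks p"
      if "(p, q) \<in> surface_edges ks \<pi> s C" for p q
    proof -
      have "(p, q) \<in> pairs" "polygon ks p \<in> C" using that by (auto simp: surface_edges_def glued_pairs_def)
      then show ?thesis using pairsD[of p q] glued_same_side[of p q s]
        by (simp add: R_def \<phi>_def side_in_corners fst_side terminal_eq)
    qed
    then show ?thesis by auto
  qed
  ultimately show ?thesis using main by (simp add: power_add)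
qed

section \<open>Connected surfaces and the total Euler characteristic\<close>

lemma finite_glued_pairs [simp]: "finite (glued_pairs ks \<pi> s)"
  by (rule finite_subset[OF _ finite_pairs]) (auto simp: glued_pairs_def)

lemma polygon_equiv_glued:
  "(p, q) \<in> glued_pairs ks \<pi> s \<Longrightarrow> (polygon ks p, polygon ks q) \<in> polygon_equiv ks \<pi> s"
  unfolding polygon_equiv_def by (rule generated_equivI) force

lemma polygon_equiv_bounded:
  assumes "(i, j) \<in> polygon_equiv ks \<pi> s"
  shows "i < length ks \<longleftrightarrow> j < length ks"
  using assms unfolding polygon_equiv_def
proof (rule generated_equiv_respects)
  fix u v assume "(u, v) \<in> (\<lambda>(p, q). (polygon ks p, polygon ks q)) ` glued_pairs ks \<pi> s"
  then obtain p q where "(p, q) \<in> pairs" "u = polygon ks p" "v = polygon ks q" by (auto simp: glued_pairs_def)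
  then show "(u < length ks) = (v < length ks)" using polygon_less pairsD[of p q] by auto
qed

lemma surfaces_closed:
  assumes "C \<in> surfaces ks \<pi> s"
  shows "closed_polygons s C"
proof -
  obtain i where i: "i < length ks" "C = polygon_equiv ks \<pi> s `` {i}"
    using assms by (auto simp: surfaces_def elim!: quotientE)
  have "C \<subseteq> {..<length ks}" using polygon_equiv_bounded i by auto
  moreover have "polygon ks p \<in> C \<longleftrightarrow> polygon ks q \<in> C" if "(p, q) \<in> glued_pairs ks \<pi> s" for p q
  proof -
    have 1: "(polygon ks p, polygon ks q) \<in> polygon_equiv ks \<pi> s" by (rule polygon_equiv_glued[OF that])
    have 2: "trans (polygon_equiv ks \<pi> s)" "sym (polygon_equiv ks \<pi> s)"
      unfolding polygon_equiv_def by (rule trans_generated_equiv, rule sym_generated_equiv)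
    show ?thesis using transD[OF 2(1) _ 1] transD[OF 2(1) _ symD[OF 2(2) 1]] i(2) by blast
  qed
  ultimately show ?thesis by (auto simp: closed_polygons_def)
qed

lemma finite_surfaces [simp]: "finite (surfaces ks \<pi> s)"
  by (auto simp: surfaces_def quotient_def)

lemma unique_surface:
  assumes "i < length ks"
  shows "\<exists>!C. C \<in> surfaces ks \<pi> s \<and> i \<in> C"
proof
  show "polygon_equiv ks \<pi> s `` {i} \<in> surfaces ks \<pi> s \<and> i \<in> polygon_equiv ks \<pi> s `` {i}"
    using assms by (auto simp: surfaces_def polygon_equiv_def intro: quotientI)
next
  fix C assume "C \<in> surfaces ks \<pi> s \<and> i \<in> C"
  then obtain j where "C = polygon_equiv ks \<pi> s `` {j}" "(j, i) \<in> polygon_equiv ks \<pi> s"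
    by (auto simp: surfaces_def elim!: quotientE)
  then show "C = polygon_equiv ks \<pi> s `` {i}"
    unfolding polygon_equiv_def by (simp add: generated_equiv_Image_eq)
qed

text \<open>Every face, edge and vertex lies in exactly one surface. For a vertex this holds because
  corner identifications, contractions included, never leave a component.\<close>

lemma total_euler_eq:
  "total_euler ks \<pi> s = int (card (corners ks // corner_equiv ks \<pi> s)) -
     int (card (glued_pairs ks \<pi> s)) + int (length ks)"
proof -
  let ?Q = "surfaces ks \<pi> s"
  let ?E = "corner_equiv ks \<pi> s"
  have "(\<Sum>C\<in>?Q. card {i \<in> {..<length ks}. i \<in> C}) = card {..<length ks}"
    by (rule card_eq_sum_over_classes) (use unique_surface in auto)
  moreover have "{i \<in> {..<length ks}. i \<in> C} = C" if "C \<in> ?Q" for C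
    using surfaces_closed[OF that] by (auto simp: closed_polygons_def)
  ultimately have faces: "(\<Sum>C\<in>?Q. card C) = length ks" by simp
  have "(\<Sum>C\<in>?Q. card {x \<in> glued_pairs ks \<pi> s. polygon ks (fst x) \<in> C}) = card (glued_pairs ks \<pi> s)"
  proof (rule card_eq_sum_over_classes)
    fix x assume "x \<in> glued_pairs ks \<pi> s"
    then have "fst x < m" using pairsD by (cases x) (auto simp: glued_pairs_def)
    then show "\<exists>!C. C \<in> ?Q \<and> polygon ks (fst x) \<in> C" by (intro unique_surface polygon_less)
  qed simp_all
  moreover have "{x \<in> glued_pairs ks \<pi> s. polygon ks (fst x) \<in> C} = surface_edges ks \<pi> s C" if "C \<in> ?Q" for C
    using surfaces_closed[OF that] by (auto simp: closed_polygons_def surface_edges_def)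
  ultimately have edges: "(\<Sum>C\<in>?Q. card (surface_edges ks \<pi> s C)) = card (glued_pairs ks \<pi> s)" by simp
  \<comment> \<open>The polygon of an arbitrary representative of a vertex. It depends on the
    choice, but the surface that contains it does not.\<close>
  define f where "f V = fst (SOME v. v \<in> V)" for V :: "(nat \<times> nat) set"
  have f: "f (?E `` {v}) \<in> C \<longleftrightarrow> fst v \<in> C" if "C \<in> ?Q" "v \<in> corners ks" for v C
  proof -
    have "(SOME w. w \<in> ?E `` {v}) \<in> ?E `` {v}" by (rule someI[of _ v]) (simp add: corner_equiv_def)
    then have "(v, SOME w. w \<in> ?E `` {v}) \<in> generated_equiv (identified s)" by (simp add: corner_equiv_def)
    then have "(v \<in> corners ks \<and> fst v \<in> C) =
        ((SOME w. w \<in> ?E `` {v}) \<in> corners ks \<and> fst (SOME w. w \<in> ?E `` {v}) \<in> C)"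
      by (rule generated_equiv_respects[where f = "\<lambda>v. v \<in> corners ks \<and> fst v \<in> C"])
        (rule identified_closed[OF surfaces_closed[OF that(1)]])
    moreover have "(v \<in> corners ks) = ((SOME w. w \<in> ?E `` {v}) \<in> corners ks)"
      using \<open>(v, _) \<in> generated_equiv (identified s)\<close>
      by (rule generated_equiv_respects[where f = "\<lambda>v. v \<in> corners ks"])
        (use identified_in_corners in blast)
    ultimately show ?thesis using that(2) by (auto simp: f_def)
  qed
  have "(\<Sum>C\<in>?Q. card {V \<in> corners ks // ?E. f V \<in> C}) = card (corners ks // ?E)"
  proof (rule card_eq_sum_over_classes)
    show "finite (corners ks // ?E)" by (auto simp: quotient_def)
    fix V assume "V \<in> corners ks // ?E"
    then obtain v where v: "v \<in> corners ks" "V = ?E `` {v}" by (auto elim: quotientE)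
    have "fst v < length ks" using v by (auto simp: corners_def)
    then show "\<exists>!C. C \<in> ?Q \<and> f V \<in> C" using unique_surface[of "fst v" s] f[OF _ v(1)] v(2) by (simp cong: conj_cong)
  qed simp
  moreover have "{V \<in> corners ks // ?E. f V \<in> C} = surface_vertices ks \<pi> s C" if "C \<in> ?Q" for C
    using f[OF that] by (auto simp: surface_vertices_def quotient_def)
  ultimately have vertices: "(\<Sum>C\<in>?Q. card (surface_vertices ks \<pi> s C)) = card (corners ks // ?E)" by simp
  show ?thesis
    by (simp add: total_euler_def euler_char_def sum.distrib sum_subtractf flip: of_nat_sum)
      (simp add: faces edges vertices)
qed

text \<open>Take for \<open>sg\<close> the orientation of the polygon to which a corner belongs. It
  is constant along every side, so no edge counts as a change and the parity of vertices plus faces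
  is that of the edges.\<close>

lemma orientable_even_euler_char:
  assumes ops: "\<And>x. x \<in> pairs \<Longrightarrow> s x \<noteq> Contract" and C: "C \<in> surfaces ks \<pi> s"
    and "orientable ks \<pi> s C"
  shows "even (euler_char ks \<pi> s C)"
proof -
  obtain \<epsilon> :: "nat \<Rightarrow> bool" where e: "\<forall>(p, q)\<in>surface_edges ks \<pi> s C.
      (s (p, q) = Glue_Opposite \<longrightarrow> \<epsilon> (polygon ks p) = \<epsilon> (polygon ks q)) \<and>
      (s (p, q) = Glue_Same \<longrightarrow> \<epsilon> (polygon ks p) \<noteq> \<epsilon> (polygon ks q))"
    using assms(3) unfolding orientable_def by (rule exE)
  have \<epsilon>: "s (p, q) = Glue_Opposite \<Longrightarrow> \<epsilon> (polygon ks p) = \<epsilon> (polygon ks q)"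
      "s (p, q) = Glue_Same \<Longrightarrow> \<epsilon> (polygon ks p) \<noteq> \<epsilon> (polygon ks q)"
    if "(p, q) \<in> surface_edges ks \<pi> s C" for p q
    using bspec[OF e that] by simp_all
  note closed = surfaces_closed[OF C]
  have edge: "(p, q) \<in> surface_edges ks \<pi> s C" if "(p, q) \<in> pairs" "polygon ks p \<in> C" for p q
  proof -
    have "(p, q) \<in> glued_pairs ks \<pi> s" using that(1) ops[OF that(1)] by (simp add: glued_pairs_def)
    then show ?thesis using that(2) closed by (auto simp: surface_edges_def closed_polygons_def)
  qed
  have "(- 1) ^ (card (surface_vertices ks \<pi> s C) + card C) =
    (- 1 :: int) ^ (card (surface_edges ks \<pi> s C) + card {(p, q) \<in> surface_edges ks \<pi> s C.
        s (p, q) = Glue_Same \<and> (\<epsilon> \<circ> fst) (side p) \<noteq> (\<epsilon> \<circ> fst) (terminal_corner ks p)})"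
  proof (rule component_parity[OF ops closed])
    fix p q assume pq: "(p, q) \<in> pairs" "polygon ks p \<in> C"
    note d = pairsD(1,2)[OF pq(1)] and \<epsilon> = \<epsilon>[OF edge[OF pq]]
    show "(\<epsilon> \<circ> fst) (side p) \<noteq> (\<epsilon> \<circ> fst) (side q) \<and>
        (\<epsilon> \<circ> fst) (terminal_corner ks p) \<noteq> (\<epsilon> \<circ> fst) (terminal_corner ks q)" if "s (p, q) = Glue_Same"
      using \<epsilon>(2)[OF that] d by (simp add: fst_side fst_terminal)
    show "(\<epsilon> \<circ> fst) (side p) = (\<epsilon> \<circ> fst) (terminal_corner ks q) \<and>
        (\<epsilon> \<circ> fst) (terminal_corner ks p) = (\<epsilon> \<circ> fst) (side q)" if "s (p, q) = Glue_Opposite"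
      using \<epsilon>(1)[OF that] d by (simp add: fst_side fst_terminal)
  qed
  also have "{(p, q) \<in> surface_edges ks \<pi> s C. s (p, q) = Glue_Same \<and>
      (\<epsilon> \<circ> fst) (side p) \<noteq> (\<epsilon> \<circ> fst) (terminal_corner ks p)} = {}"
    using pairsD by (auto simp: surface_edges_def glued_pairs_def fst_side fst_terminal)
  finally have "(- 1) ^ (card (surface_vertices ks \<pi> s C) + card C) = (- 1 :: int) ^ card (surface_edges ks \<pi> s C)"
    by simp
  then have "even (card (surface_vertices ks \<pi> s C) + card C) = even (card (surface_edges ks \<pi> s C))"
    by (rule minus_one_power_eqD)
  then show ?thesis by (auto simp: euler_char_def)
qed

text \<open>The difference is even termwise: an orientable surface contributes minus its even Euler
  characteristic, a non-orientable one contributes 2 - 2\<chi>.\<close>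

lemma even_genus_minus_euler:
  assumes ops: "\<And>x. x \<in> pairs \<Longrightarrow> s x \<noteq> Contract"
  shows "even (total_genus ks \<pi> s - total_euler ks \<pi> s)"
  unfolding total_genus_def total_euler_def sum_subtractf[symmetric]
  by (rule dvd_sum) (use orientable_even_euler_char[OF ops] in \<open>auto simp: nonorientable_genus_def\<close>)

end

section \<open>The sum over matrix indices\<close>

text \<open>The scalar of an operation, separated from its condition on the indices. A glued pair
  costs one factor \<open>1 / N\<close>, being one edge; a contracted pair costs one factor for each
  of its two sides.\<close>

definition op_coeff :: "nat \<Rightarrow> side_op \<Rightarrow> complex" where
  "op_coeff N w = (case w of Glue_Same \<Rightarrow> 1 / of_nat N | Glue_Opposite \<Rightarrow> - (1 / of_nat N) | Contract \<Rightarrow> 1 / (of_nat N)\<^sup>2)"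

definition op_identifies :: "side_op \<Rightarrow> 'a \<Rightarrow> 'a \<Rightarrow> 'a \<Rightarrow> 'a \<Rightarrow> bool" where
  "op_identifies w a b c d \<longleftrightarrow> (case w of Glue_Same \<Rightarrow> a = c \<and> b = d | Glue_Opposite \<Rightarrow> a = d \<and> b = c
     | Contract \<Rightarrow> a = b \<and> c = d)"

lemma pair_weight_eq:
  "G \<noteq> Sp \<or> w \<noteq> Glue_Same \<Longrightarrow> pair_weight G N w a b c d = op_coeff N w * of_bool (op_identifies w a b c d)"
  by (cases G; cases w) (simp_all add: op_coeff_def op_identifies_def)

text \<open>The two entries of \<open>symp_J N\<close> contribute the row signs of \<open>a\<close>
  and \<open>b\<close>, whose product is 1 exactly when \<open>a\<close> and \<open>b\<close> lie in
  the same half of the index range.\<close>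

lemma pair_weight_Sp_same:
  assumes "even N" "a < N" "b < N" "c < N" "d < N"
  shows "pair_weight Sp N Glue_Same a b c d =
    op_coeff N Glue_Same * of_bool (c = symp_flip N a \<and> d = symp_flip N b) *
      (if (a < N div 2) = (b < N div 2) then 1 else - 1)"
  using assms by (simp add: op_coeff_def symp_J_entry symp_sign_def)

lemma prod_of_bool: "finite A \<Longrightarrow> (\<Prod>x\<in>A. of_bool (P x)) = (of_bool (\<forall>x\<in>A. P x) :: 'a :: comm_semiring_1)"
  by (induction A rule: finite_induct) auto

lemma prod_if_eq_power:
  "finite A \<Longrightarrow> (\<Prod>x\<in>A. if P x then z else 1) = (z :: 'a :: comm_monoid_mult) ^ card {x \<in> A. P x}"
  by (simp flip: prod.inter_filter)

lemma sum_of_bool_eq_card: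
  "finite A \<Longrightarrow> (\<Sum>x\<in>A. of_bool (P x)) = (of_nat (card {x \<in> A. P x}) :: 'a :: semiring_1)"
  by (simp add: of_bool_def flip: sum.inter_filter)

context paired_polygons
begin

section \<open>Expansion over the operations\<close>

lemma cyclic_indices_terminal:
  assumes a: "a \<in> cyclic_indices N ks" and p: "p < m" and ij: "sides ks ! p = (i, j)"
  shows "a (i, j) = a (side p)" and "a (i, Suc j) = a (terminal_corner ks p)"
proof -
  have "i < length ks" "j < ks ! i" using side_in_sides[OF p] ij by (auto simp: initial_corner_def set_sides)
  then show "a (i, Suc j) = a (terminal_corner ks p)"
    using a ij by (cases "Suc j = ks ! i") (auto simp: terminal_corner_def cyclic_indices_def)
qed (simp add: ij initial_corner_def)

text \<open>The last index of each cycle repeats the first, so the free indices sit at the corners.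
  For a sphere the last index is \<open>(i, 0)\<close> itself, which is also its corner.\<close>

lemma bij_betw_cyclic_indices:
  "bij_betw (\<lambda>a. restrict a (corners ks)) (cyclic_indices N ks) (corners ks \<rightarrow>\<^sub>E {..<N})"
proof (rule bij_betw_byWitness[where f' = "\<lambda>c. \<lambda>(i, j)\<in>(SIGMA i:{..<length ks}. {..ks ! i}). c (i, if j = ks ! i then 0 else j)"])
  have sub: "x \<in> corners ks \<Longrightarrow> x \<in> (SIGMA i:{..<length ks}. {..ks ! i})" for x
    by (auto simp: corners_def max_def split: if_splits)
  have cor: "(i, if j = ks ! i then 0 else j) \<in> corners ks" if "i < length ks" "j \<le> ks ! i" for i j
    using that by (auto simp: corners_def)
  show "\<forall>a\<in>cyclic_indices N ks. (\<lambda>(i, j)\<in>(SIGMA i:{..<length ks}. {..ks ! i}).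
      (restrict a (corners ks)) (i, if j = ks ! i then 0 else j)) = a"
  proof
    fix a assume a: "a \<in> cyclic_indices N ks"
    show "(\<lambda>(i, j)\<in>(SIGMA i:{..<length ks}. {..ks ! i}).
      (restrict a (corners ks)) (i, if j = ks ! i then 0 else j)) = a"
    proof
      fix x :: "nat \<times> nat"
      obtain i j where x: "x = (i, j)" by fastforce
      show "(\<lambda>(i, j)\<in>(SIGMA i:{..<length ks}. {..ks ! i}).
          (restrict a (corners ks)) (i, if j = ks ! i then 0 else j)) x = a x"
      proof (cases "i < length ks \<and> j \<le> ks ! i")
        case True
        then show ?thesis using cor[of i j] a by (auto simp: x cyclic_indices_def)
      next
        case False
        then have "a (i, j) = undefined" using a by (auto simp: cyclic_indices_def PiE_iff extensional_def)
        then show ?thesis using False by (auto simp: x)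
      qed
    qed
  qed
  show "\<forall>c\<in>corners ks \<rightarrow>\<^sub>E {..<N}. restrict (\<lambda>(i, j)\<in>(SIGMA i:{..<length ks}. {..ks ! i}).
      c (i, if j = ks ! i then 0 else j)) (corners ks) = c"
  proof
    fix c assume c: "c \<in> corners ks \<rightarrow>\<^sub>E {..<N}"
    show "restrict (\<lambda>(i, j)\<in>(SIGMA i:{..<length ks}. {..ks ! i}).
      c (i, if j = ks ! i then 0 else j)) (corners ks) = c"
    proof
      fix x :: "nat \<times> nat"
      obtain i j where x: "x = (i, j)" by fastforce
      show "restrict (\<lambda>(i, j)\<in>(SIGMA i:{..<length ks}. {..ks ! i}).
          c (i, if j = ks ! i then 0 else j)) (corners ks) x = c x"
      proof (cases "x \<in> corners ks")
        case True
        then have "(if j = ks ! i then 0 else j) = j" by (auto simp: x corners_def)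
        then show ?thesis using True sub[OF True] by (simp add: x)
      next
        case False
        then show ?thesis using PiE_arb[OF c] by simp
      qed
    qed
  qed
  show "(\<lambda>a. restrict a (corners ks)) ` cyclic_indices N ks \<subseteq> corners ks \<rightarrow>\<^sub>E {..<N}"
    using sub by (auto simp: cyclic_indices_def PiE_iff)
  show "(\<lambda>c. \<lambda>(i, j)\<in>(SIGMA i:{..<length ks}. {..ks ! i}). c (i, if j = ks ! i then 0 else j)) `
      (corners ks \<rightarrow>\<^sub>E {..<N}) \<subseteq> cyclic_indices N ks"
  proof
    fix b assume "b \<in> (\<lambda>c. \<lambda>(i, j)\<in>(SIGMA i:{..<length ks}. {..ks ! i}). c (i, if j = ks ! i then 0 else j)) `
      (corners ks \<rightarrow>\<^sub>E {..<N})"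
    then obtain c where c: "c \<in> corners ks \<rightarrow>\<^sub>E {..<N}"
      and b: "b = (\<lambda>(i, j)\<in>(SIGMA i:{..<length ks}. {..ks ! i}). c (i, if j = ks ! i then 0 else j))"
      by blast
    have "b (i, j) < N" if "i < length ks" "j \<le> ks ! i" for i j
      using PiE_mem[OF c cor[OF that]] that by (simp add: b)
    then show "b \<in> cyclic_indices N ks" by (auto simp: cyclic_indices_def b)
  qed
qed

lemma length_entry_list: "length (entry_list W ks a) = m"
  by (simp add: entry_list_def length_sides)

lemma sum_pairing_bracket:
  assumes cov: "\<And>a b u v. a < N \<Longrightarrow> b < N \<Longrightarrow> u < N \<Longrightarrow> v < N \<Longrightarrow>
      (\<integral>\<omega>. W \<omega> $$ (a, b) * W \<omega> $$ (u, v) \<partial>M) = (\<Sum>w\<in>A. f w a b u v)"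
    and fin: "finite A"
  shows "(\<Sum>a\<in>cyclic_indices N ks. pairing_bracket M \<pi> (entry_list W ks a)) =
    (\<Sum>s\<in>pairs \<rightarrow>\<^sub>E A. \<Sum>c\<in>corners ks \<rightarrow>\<^sub>E {..<N}. \<Prod>(p, q)\<in>pairs.
       f (s (p, q)) (c (side p)) (c (terminal_corner ks p)) (c (side q)) (c (terminal_corner ks q)))"
proof -
  let ?f = "\<lambda>c (p, q) w. f w (c (side p)) (c (terminal_corner ks p)) (c (side q)) (c (terminal_corner ks q))"
  have bracket: "pairing_bracket M \<pi> (entry_list W ks a) = (\<Prod>x\<in>pairs. \<Sum>w\<in>A. ?f (restrict a (corners ks)) x w)"
    if a: "a \<in> cyclic_indices N ks" for a
    unfolding pairing_bracket_def length_entry_list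
  proof (intro prod.cong refl)
    fix x assume "x \<in> pairs"
    moreover obtain p q where x: "x = (p, q)" by fastforce
    ultimately have d: "p < m" "q < m" using pairsD by auto
    have c: "restrict a (corners ks) \<in> corners ks \<rightarrow>\<^sub>E {..<N}"
      using bij_betwE[OF bij_betw_cyclic_indices] a by blast
    have lt: "a y < N" if "y \<in> corners ks" for y using PiE_mem[OF c that] that by simp
    have e: "(entry_list W ks a ! r) \<omega> = W \<omega> $$ (a (side r), a (terminal_corner ks r))" if "r < m" for r \<omega>
    proof -
      obtain i j where ij: "sides ks ! r = (i, j)" by fastforce
      then show ?thesis
        using that cyclic_indices_terminal[OF a that ij] by (simp add: entry_list_def length_sides)
    qed
    have "(\<integral>\<omega>. (entry_list W ks a ! p) \<omega> * (entry_list W ks a ! q) \<omega> \<partial>M) =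
        (\<Sum>w\<in>A. f w (a (side p)) (a (terminal_corner ks p)) (a (side q)) (a (terminal_corner ks q)))"
      unfolding e[OF d(1)] e[OF d(2)]
      by (rule cov) (use d in \<open>auto intro!: lt simp: side_in_corners terminal_in_corners\<close>)
    then show "(case x of (p, q) \<Rightarrow> \<integral>\<omega>. (entry_list W ks a ! p) \<omega> * (entry_list W ks a ! q) \<omega> \<partial>M) =
        (\<Sum>w\<in>A. ?f (restrict a (corners ks)) x w)"
      using d by (simp add: x side_in_corners terminal_in_corners)
  qed
  have "(\<Sum>a\<in>cyclic_indices N ks. pairing_bracket M \<pi> (entry_list W ks a)) =
      (\<Sum>a\<in>cyclic_indices N ks. \<Prod>x\<in>pairs. \<Sum>w\<in>A. ?f (restrict a (corners ks)) x w)"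
    by (rule sum.cong) (simp_all add: bracket)
  also have "\<dots> = (\<Sum>c\<in>corners ks \<rightarrow>\<^sub>E {..<N}. \<Prod>x\<in>pairs. \<Sum>w\<in>A. ?f c x w)"
    by (rule sum.reindex_bij_betw[OF bij_betw_cyclic_indices])
  also have "\<dots> = (\<Sum>c\<in>corners ks \<rightarrow>\<^sub>E {..<N}. \<Sum>s\<in>pairs \<rightarrow>\<^sub>E A. \<Prod>x\<in>pairs. ?f c x (s x))"
    by (intro sum.cong refl prod_sum_PiE finite_pairs fin)
  also have "\<dots> = (\<Sum>s\<in>pairs \<rightarrow>\<^sub>E A. \<Sum>c\<in>corners ks \<rightarrow>\<^sub>E {..<N}. \<Prod>x\<in>pairs. ?f c x (s x))"
    by (rule sum.swap)
  finally show ?thesis by (simp add: case_prod_unfold)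
qed

text \<open>With V vertices, E glued and k contracted pairs the power of \<open>N\<close> is V - E -
  2k. Here 2k is \<gamma> and \<chi> is V - E + n, so the exponent is - n - \<gamma> + \<chi>: the
  term - n merely removes the faces, which carry no weight.\<close>

lemma prod_op_coeff:
  assumes N: "N \<ge> 1"
  shows "(\<Prod>x\<in>pairs. op_coeff N (s x)) * of_nat N ^ card (corners ks // corner_equiv ks \<pi> s) =
    of_real ((- 1) powi num_opposite ks \<pi> s *
      real N powi (- int (length ks) - num_contracted_sides ks \<pi> s + total_euler ks \<pi> s))"
proof -
  let ?o = "card {x \<in> pairs. s x = Glue_Opposite}" and ?g = "card (glued_pairs ks \<pi> s)"
    and ?k = "card {x \<in> pairs. s x = Contract}" and ?V = "card (corners ks // corner_equiv ks \<pi> s)"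
  have "op_coeff N w = (if w = Glue_Opposite then - 1 else 1) * (if w \<noteq> Contract then 1 / of_nat N else 1) *
      (if w = Contract then 1 / (of_nat N)\<^sup>2 else 1)" for w
    by (cases w) (simp_all add: op_coeff_def)
  then have "(\<Prod>x\<in>pairs. op_coeff N (s x)) = (- 1) ^ ?o * (1 / of_nat N) ^ ?g * (1 / (of_nat N)\<^sup>2) ^ ?k"
    by (simp add: prod.distrib prod_if_eq_power glued_pairs_def)
  also have "\<dots> = of_real ((- 1) ^ ?o * (1 / real N) ^ ?g * (1 / (real N)\<^sup>2) ^ ?k)" by simp
  finally have 1: "(\<Prod>x\<in>pairs. op_coeff N (s x)) * of_nat N ^ ?V =
      of_real ((- 1) ^ ?o * ((1 / real N) ^ ?g * (1 / (real N)\<^sup>2) ^ ?k * real N ^ ?V))"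
    by (simp add: mult.assoc)
  have diff: "real N powi (int v - int w) = real N ^ v / real N ^ w" for v w
    using N by (simp add: power_int_diff)
  have "- int (length ks) - num_contracted_sides ks \<pi> s + total_euler ks \<pi> s = int ?V - int (?g + 2 * ?k)"
    by (simp add: num_contracted_sides_def total_euler_eq)
  then have "real N powi (- int (length ks) - num_contracted_sides ks \<pi> s + total_euler ks \<pi> s) =
      real N ^ ?V / real N ^ (?g + 2 * ?k)"
    by (simp only: diff)
  also have "\<dots> = (1 / real N) ^ ?g * (1 / (real N)\<^sup>2) ^ ?k * real N ^ ?V"
    by (simp add: power_add power_mult power_divide)
  finally show ?thesis unfolding 1 by (simp add: num_opposite_def)
qed

lemma op_identifies_iff:
  "(\<forall>(p, q)\<in>pairs. op_identifies (s (p, q)) (c (side p)) (c (terminal_corner ks p)) (c (side q)) (c (terminal_corner ks q)))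
    \<longleftrightarrow> (\<forall>(x, y)\<in>identified s. c x = c y)"
proof -
  have "op_identifies (s (p, q)) (c (side p)) (c (terminal_corner ks p)) (c (side q)) (c (terminal_corner ks q))
      \<longleftrightarrow> (\<forall>(x, y)\<in>corner_identifications ks (s (p, q)) (p, q). c x = c y)" for p q
    by (cases "s (p, q)") (simp_all add: op_identifies_def corner_identifications_def)
  then have pair: "(case x of (p, q) \<Rightarrow>
      op_identifies (s (p, q)) (c (side p)) (c (terminal_corner ks p)) (c (side q)) (c (terminal_corner ks q)))
      \<longleftrightarrow> (\<forall>(x, y)\<in>corner_identifications ks (s x) x. c x = c y)" for x
    by (cases x) (simp only: prod.case)
  have "(\<forall>z\<in>identified s. P z) \<longleftrightarrow> (\<forall>x\<in>pairs. \<forall>z\<in>corner_identifications ks (s x) x. P z)" for P by blast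
  then show ?thesis by (simp only:) (intro ball_cong refl pair)
qed

lemma sum_pair_weight_not_Sp:
  assumes N: "N \<ge> 1" and G: "G \<noteq> Sp"
  shows "(\<Sum>c\<in>corners ks \<rightarrow>\<^sub>E {..<N}. \<Prod>(p, q)\<in>pairs.
      pair_weight G N (s (p, q)) (c (side p)) (c (terminal_corner ks p)) (c (side q)) (c (terminal_corner ks q))) =
    of_real ((- 1) powi num_opposite ks \<pi> s *
      real N powi (- int (length ks) - num_contracted_sides ks \<pi> s + total_euler ks \<pi> s))"
proof -
  have fin: "finite (corners ks \<rightarrow>\<^sub>E {..<N})" by (intro finite_PiE) auto
  let ?i = "\<lambda>c (p, q). op_identifies (s (p, q)) (c (side p)) (c (terminal_corner ks p)) (c (side q)) (c (terminal_corner ks q))"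
  have "(\<Prod>(p, q)\<in>pairs. pair_weight G N (s (p, q)) (c (side p)) (c (terminal_corner ks p)) (c (side q)) (c (terminal_corner ks q))) =
      (\<Prod>x\<in>pairs. op_coeff N (s x)) * of_bool (\<forall>(x, y)\<in>identified s. c x = c y)" for c
  proof -
    have "(\<Prod>(p, q)\<in>pairs. pair_weight G N (s (p, q)) (c (side p)) (c (terminal_corner ks p)) (c (side q)) (c (terminal_corner ks q))) =
        (\<Prod>x\<in>pairs. op_coeff N (s x) * of_bool (?i c x))"
      by (intro prod.cong) (auto simp: pair_weight_eq G)
    then show ?thesis unfolding op_identifies_iff[symmetric] by (simp add: prod.distrib prod_of_bool)
  qed
  then have "(\<Sum>c\<in>corners ks \<rightarrow>\<^sub>E {..<N}. \<Prod>(p, q)\<in>pairs.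
      pair_weight G N (s (p, q)) (c (side p)) (c (terminal_corner ks p)) (c (side q)) (c (terminal_corner ks q))) =
    (\<Prod>x\<in>pairs. op_coeff N (s x)) * of_nat (card {c \<in> corners ks \<rightarrow>\<^sub>E {..<N}. \<forall>(x, y)\<in>identified s. c x = c y})"
    by (simp add: sum_distrib_left[symmetric] sum_of_bool_eq_card[OF fin])
  then show ?thesis unfolding card_all_corner_labels of_nat_power prod_op_coeff[OF N] .
qed

section \<open>Labels flipped by the symplectic form\<close>

definition flip_compatible :: "nat \<Rightarrow> (nat \<times> nat \<Rightarrow> side_op) \<Rightarrow> (nat \<times> nat \<Rightarrow> nat) \<Rightarrow> bool" where
  "flip_compatible N s c \<longleftrightarrow> (\<forall>(p, q)\<in>pairs.
     if s (p, q) = Glue_Same then c (side q) = symp_flip N (c (side p)) \<and>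
       c (terminal_corner ks q) = symp_flip N (c (terminal_corner ks p))
     else c (side p) = c (terminal_corner ks q) \<and> c (terminal_corner ks p) = c (side q))"

text \<open>Corner signs that change exactly across same-orientation gluings exist whether or not
  the surfaces are orientable. Flipping the labels at the corners of one sign is an involution that
  exchanges flip-compatible labels with labels constant on vertices, whose number is known.\<close>

lemma card_flip_compatible:
  assumes even: "even N" and ops: "\<And>x. x \<in> pairs \<Longrightarrow> s x \<noteq> Contract"
  shows "card {c \<in> corners ks \<rightarrow>\<^sub>E {..<N}. flip_compatible N s c} = N ^ card (corners ks // corner_equiv ks \<pi> s)"
proof -
  have "succ_corner permutes corners ks"
    using next_corner_permutes_restrict[of UNIV ks] by simp
  then obtain sg :: "nat \<times> nat \<Rightarrow> bool" where
    sg: "\<And>x. glued_same s x \<Longrightarrow> sg (partner x) \<noteq> sg x" "\<And>x. glued_same s x \<Longrightarrow> sg (succ_corner (partner x)) \<noteq> sg (succ_corner x)"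
      "\<And>x. \<not> glued_same s x \<Longrightarrow> sg (succ_corner (partner x)) = sg x"
    by (rule corner_signs_exist[of succ_corner "corners ks" partner "glued_same s",
          OF _ partner_partner glued_same_partner glued_same_partner_neq]) blast+
  have same: "sg (side q) \<noteq> sg (side p)" "sg (terminal_corner ks q) \<noteq> sg (terminal_corner ks p)"
    if "(p, q) \<in> pairs" "s (p, q) = Glue_Same" for p q
    using sg(1,2)[of "side p"] glued_same_side[OF that(1), of s] that pairsD[OF that(1)]
    by (simp_all add: partner_side terminal_eq)
  have opp: "sg (terminal_corner ks q) = sg (side p)" "sg (terminal_corner ks p) = sg (side q)"
    if "(p, q) \<in> pairs" "s (p, q) \<noteq> Glue_Same" for p q
    using sg(3)[of "side p"] sg(3)[of "side q"] glued_same_side[OF that(1), of s] that pairsD[OF that(1)]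
      glued_same_partner[of s "side p"]
    by (simp_all add: partner_side terminal_eq)
  define T where "T c = (\<lambda>x\<in>corners ks. if sg x then c x else symp_flip N (c x))" for c
  have TP: "T c \<in> corners ks \<rightarrow>\<^sub>E {..<N}" if "c \<in> corners ks \<rightarrow>\<^sub>E {..<N}" for c
    using that symp_flip(1)[OF even] by (simp add: T_def PiE_iff)
  have TT: "T (T c) = c" if "c \<in> corners ks \<rightarrow>\<^sub>E {..<N}" for c
  proof
    fix x show "T (T c) x = c x"
      using PiE_mem[OF that, of x] symp_flip(2)[OF even, of "c x"] PiE_arb[OF that, of x] by (simp add: T_def)
  qed
  have compat: "flip_compatible N s (T c) \<longleftrightarrow> (\<forall>(x, y)\<in>identified s. c x = c y)" if c: "c \<in> corners ks \<rightarrow>\<^sub>E {..<N}" for c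
  proof -
    have pair: "(if s (p, q) = Glue_Same then T c (side q) = symp_flip N (T c (side p)) \<and>
         T c (terminal_corner ks q) = symp_flip N (T c (terminal_corner ks p))
       else T c (side p) = T c (terminal_corner ks q) \<and> T c (terminal_corner ks p) = T c (side q)) \<longleftrightarrow>
      op_identifies (s (p, q)) (c (side p)) (c (terminal_corner ks p)) (c (side q)) (c (terminal_corner ks q))"
      if pq: "(p, q) \<in> pairs" for p q
    proof -
      note d = pairsD(1,2)[OF pq]
      note cor = side_in_corners[OF d(1)] side_in_corners[OF d(2)] terminal_in_corners[OF d(1)] terminal_in_corners[OF d(2)]
      have lt: "c x < N" if "x \<in> corners ks" for x using PiE_mem[OF c that] by simp
      have inj: "symp_flip N a = symp_flip N b \<longleftrightarrow> a = b" if "a < N" "b < N" for a b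
        using symp_flip(2)[OF even] that by metis
      show ?thesis
      proof (cases "s (p, q) = Glue_Same")
        case True
        then show ?thesis using same[OF pq True] lt cor symp_flip(2)[OF even] inj
          by (cases "sg (side p)"; cases "sg (terminal_corner ks p)") (auto simp: T_def op_identifies_def)
      next
        case False
        then have "s (p, q) = Glue_Opposite" using ops[OF pq] by (cases "s (p, q)") auto
        then show ?thesis using opp[OF pq False] lt cor inj
          by (cases "sg (side p)"; cases "sg (side q)") (auto simp: T_def op_identifies_def)
      qed
    qed
    show ?thesis unfolding flip_compatible_def op_identifies_iff[symmetric]
    proof (intro ball_cong refl)
      fix x assume x: "x \<in> pairs"
      obtain p q where pq: "x = (p, q)" by fastforce
      show "(case x of (p, q) \<Rightarrow> if s (p, q) = Glue_Same then T c (side q) = symp_flip N (T c (side p)) \<and>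
          T c (terminal_corner ks q) = symp_flip N (T c (terminal_corner ks p))
        else T c (side p) = T c (terminal_corner ks q) \<and> T c (terminal_corner ks p) = T c (side q)) \<longleftrightarrow>
        (case x of (p, q) \<Rightarrow>
          op_identifies (s (p, q)) (c (side p)) (c (terminal_corner ks p)) (c (side q)) (c (terminal_corner ks q)))"
        using pair[of p q] x unfolding pq prod.case .
    qed
  qed
  have "bij_betw T {c \<in> corners ks \<rightarrow>\<^sub>E {..<N}. \<forall>(x, y)\<in>identified s. c x = c y}
      {c \<in> corners ks \<rightarrow>\<^sub>E {..<N}. flip_compatible N s c}"
  proof (rule bij_betw_byWitness[where f' = T])
    show "T ` {c \<in> corners ks \<rightarrow>\<^sub>E {..<N}. flip_compatible N s c} \<subseteq>
        {c \<in> corners ks \<rightarrow>\<^sub>E {..<N}. \<forall>(x, y)\<in>identified s. c x = c y}"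
    proof clarify
      fix c assume c: "c \<in> corners ks \<rightarrow>\<^sub>E {..<N}" "flip_compatible N s c"
      then show "T c \<in> corners ks \<rightarrow>\<^sub>E {..<N} \<and> (\<forall>(x, y)\<in>identified s. T c x = T c y)"
        using compat[OF TP[OF c(1)]] TT[OF c(1)] TP[OF c(1)] by simp
    qed
  qed (use TT TP compat in auto)
  from bij_betw_same_card[OF this] show ?thesis unfolding card_all_corner_labels by (rule sym)
qed

text \<open>The half of the index range that contains a label is changed by the flip and kept by an
  equality, so it qualifies as \<open>sg\<close> for all polygons together. The exponent then has
  the parity of the total Euler characteristic, whichever compatible label is taken.\<close>

lemma flip_compatible_sign:
  assumes even: "even N" and ops: "\<And>x. x \<in> pairs \<Longrightarrow> s x \<noteq> Contract"
    and c: "c \<in> corners ks \<rightarrow>\<^sub>E {..<N}" and compat: "flip_compatible N s c"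
  shows "(- 1 :: complex) ^ card {(p, q) \<in> pairs. s (p, q) = Glue_Same \<and>
      (c (side p) < N div 2) \<noteq> (c (terminal_corner ks p) < N div 2)} = (- 1) powi total_genus ks \<pi> s"
proof -
  let ?C = "{..<length ks}" and ?sg = "\<lambda>x. c x < N div 2"
  let ?D = "{(p, q) \<in> pairs. s (p, q) = Glue_Same \<and> ?sg (side p) \<noteq> ?sg (terminal_corner ks p)}"
  let ?V = "card (corners ks // corner_equiv ks \<pi> s)"
  have flip: "(symp_flip N (c x) < N div 2) \<noteq> (c x < N div 2)" if "x \<in> corners ks" for x
    using symp_flip(3)[OF even, of "c x"] even PiE_mem[OF c that]
    by (auto simp: symp_flip_def)
  have closed: "closed_polygons s ?C"
    using pairsD polygon_less by (fastforce simp: closed_polygons_def glued_pairs_def)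
  have edges: "surface_edges ks \<pi> s ?C = pairs"
  proof (rule Set.set_eqI)
    fix x :: "nat \<times> nat"
    obtain p q where x: "x = (p, q)" by fastforce
    show "x \<in> surface_edges ks \<pi> s ?C \<longleftrightarrow> x \<in> pairs"
      using ops[of x] pairsD(1,2)[of p q] polygon_less[of p] polygon_less[of q]
      by (auto simp: x surface_edges_def glued_pairs_def)
  qed
  have glued: "glued_pairs ks \<pi> s = pairs" using ops by (auto simp: glued_pairs_def)
  have vert: "surface_vertices ks \<pi> s ?C = corners ks // corner_equiv ks \<pi> s"
  proof -
    have "{v \<in> corners ks. fst v \<in> ?C} = corners ks" by (auto simp: corners_def)
    then show ?thesis by (simp add: surface_vertices_def)
  qed
  have "(- 1) ^ (card (surface_vertices ks \<pi> s ?C) + card ?C) =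
    (- 1 :: int) ^ (card (surface_edges ks \<pi> s ?C) + card {(p, q) \<in> surface_edges ks \<pi> s ?C. s (p, q) = Glue_Same \<and>
      ?sg (side p) \<noteq> ?sg (terminal_corner ks p)})"
  proof (rule component_parity[OF ops closed])
    fix p q assume pq: "(p, q) \<in> pairs"
    note d = pairsD(1,2)[OF pq]
    have cp: "if s (p, q) = Glue_Same then c (side q) = symp_flip N (c (side p)) \<and>
       c (terminal_corner ks q) = symp_flip N (c (terminal_corner ks p))
     else c (side p) = c (terminal_corner ks q) \<and> c (terminal_corner ks p) = c (side q)"
      using compat pq by (auto simp: flip_compatible_def)
    show "?sg (side p) \<noteq> ?sg (side q) \<and> ?sg (terminal_corner ks p) \<noteq> ?sg (terminal_corner ks q)"
      if "s (p, q) = Glue_Same"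
      using cp that flip[OF side_in_corners[OF d(1)]] flip[OF terminal_in_corners[OF d(1)]] by simp
    show "?sg (side p) = ?sg (terminal_corner ks q) \<and> ?sg (terminal_corner ks p) = ?sg (side q)"
      if "s (p, q) = Glue_Opposite" using cp that by simp
  qed
  then have "(- 1) ^ (?V + length ks) = (- 1 :: int) ^ (card pairs + card ?D)" by (simp add: edges vert)
  then have "even (?V + length ks) = even (card pairs + card ?D)"
    by (rule minus_one_power_eqD)
  moreover have "even (total_genus ks \<pi> s) = even (total_euler ks \<pi> s)"
    using even_genus_minus_euler[OF ops] by simp
  ultimately have "even (total_genus ks \<pi> s) = even (card ?D)"
    by (auto simp: total_euler_eq glued)
  then show ?thesis by (auto simp: power_int_minus_left minus_one_power_iff)
qed

text \<open>The sign of a compatible label depends only on the construction and leaves the sum as a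
  factor. What remains is a count of labels, which gives the same power of \<open>N\<close> as for
  labels constant on vertices.\<close>

lemma sum_pair_weight_Sp:
  assumes N: "N \<ge> 1" and even: "even N" and ops: "\<And>x. x \<in> pairs \<Longrightarrow> s x \<noteq> Contract"
  shows "(\<Sum>c\<in>corners ks \<rightarrow>\<^sub>E {..<N}. \<Prod>(p, q)\<in>pairs.
      pair_weight Sp N (s (p, q)) (c (side p)) (c (terminal_corner ks p)) (c (side q)) (c (terminal_corner ks q))) =
    of_real ((- 1) powi (num_opposite ks \<pi> s + total_genus ks \<pi> s) *
      real N powi (- int (length ks) + total_euler ks \<pi> s))"
proof -
  have fin: "finite (corners ks \<rightarrow>\<^sub>E {..<N})" by (intro finite_PiE) auto
  let ?P = "\<lambda>c (p, q). if s (p, q) = Glue_Same then c (side q) = symp_flip N (c (side p)) \<and>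
       c (terminal_corner ks q) = symp_flip N (c (terminal_corner ks p))
     else c (side p) = c (terminal_corner ks q) \<and> c (terminal_corner ks p) = c (side q)"
  let ?D = "\<lambda>c (p, q). s (p, q) = Glue_Same \<and> (c (side p) < N div 2) \<noteq> (c (terminal_corner ks p) < N div 2)"
  let ?g = "(- 1) powi total_genus ks \<pi> s :: complex"
  have "(\<Prod>(p, q)\<in>pairs. pair_weight Sp N (s (p, q)) (c (side p)) (c (terminal_corner ks p)) (c (side q)) (c (terminal_corner ks q))) =
      (\<Prod>x\<in>pairs. op_coeff N (s x)) * ?g * of_bool (flip_compatible N s c)"
    if c: "c \<in> corners ks \<rightarrow>\<^sub>E {..<N}" for c
  proof -
    have "(\<Prod>(p, q)\<in>pairs. pair_weight Sp N (s (p, q)) (c (side p)) (c (terminal_corner ks p)) (c (side q)) (c (terminal_corner ks q))) =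
        (\<Prod>x\<in>pairs. op_coeff N (s x) * of_bool (?P c x) * (if ?D c x then - 1 else 1))"
    proof (intro prod.cong refl)
      fix x assume "x \<in> pairs"
      moreover obtain p q where x: "x = (p, q)" by fastforce
      ultimately have pq: "(p, q) \<in> pairs" by simp
      note d = pairsD(1,2)[OF pq]
      have lt: "c x < N" if "x \<in> corners ks" for x using PiE_mem[OF c that] by simp
      note lt' = lt[OF side_in_corners[OF d(1)]] lt[OF terminal_in_corners[OF d(1)]]
        lt[OF side_in_corners[OF d(2)]] lt[OF terminal_in_corners[OF d(2)]]
      have "pair_weight Sp N (s (p, q)) (c (side p)) (c (terminal_corner ks p)) (c (side q)) (c (terminal_corner ks q)) =
          op_coeff N (s (p, q)) * of_bool (?P c (p, q)) * (if ?D c (p, q) then - 1 else 1)"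
      proof (cases "s (p, q)")
        case Glue_Same
        then show ?thesis by (simp add: pair_weight_Sp_same[OF even lt'] del: pair_weight.simps)
      next
        case Glue_Opposite
        then show ?thesis by (simp add: pair_weight_eq op_identifies_def del: pair_weight.simps)
      next
        case Contract
        then show ?thesis using ops[OF pq] by simp
      qed
      then show "(case x of (p, q) \<Rightarrow> pair_weight Sp N (s (p, q)) (c (side p)) (c (terminal_corner ks p)) (c (side q)) (c (terminal_corner ks q))) =
          op_coeff N (s x) * of_bool (?P c x) * (if ?D c x then - 1 else 1)"
        unfolding x prod.case .
    qed
    also have "\<dots> = (\<Prod>x\<in>pairs. op_coeff N (s x)) * of_bool (\<forall>x\<in>pairs. ?P c x) * (- 1) ^ card {x \<in> pairs. ?D c x}"
      by (simp only: prod.distrib prod_of_bool[OF finite_pairs] prod_if_eq_power[OF finite_pairs])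
    also have "(\<forall>x\<in>pairs. ?P c x) = flip_compatible N s c" by (simp only: flip_compatible_def)
    also have "{x \<in> pairs. ?D c x} = {(p, q) \<in> pairs. s (p, q) = Glue_Same \<and>
        (c (side p) < N div 2) \<noteq> (c (terminal_corner ks p) < N div 2)}" by auto
    also have "(\<Prod>x\<in>pairs. op_coeff N (s x)) * of_bool (flip_compatible N s c) * (- 1) ^ card {(p, q) \<in> pairs. s (p, q) = Glue_Same \<and>
        (c (side p) < N div 2) \<noteq> (c (terminal_corner ks p) < N div 2)} =
        (\<Prod>x\<in>pairs. op_coeff N (s x)) * ?g * of_bool (flip_compatible N s c)"
    proof (cases "flip_compatible N s c")
      case True
      have sign: "(- 1) ^ card {(p, q) \<in> pairs. s (p, q) = Glue_Same \<and>
          (c (side p) < N div 2) \<noteq> (c (terminal_corner ks p) < N div 2)} = ?g"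
        by (rule flip_compatible_sign[OF even _ c True]) (rule ops)
      show ?thesis unfolding sign by (simp only: mult_ac)
    qed simp
    finally show ?thesis .
  qed
  then have "(\<Sum>c\<in>corners ks \<rightarrow>\<^sub>E {..<N}. \<Prod>(p, q)\<in>pairs.
      pair_weight Sp N (s (p, q)) (c (side p)) (c (terminal_corner ks p)) (c (side q)) (c (terminal_corner ks q))) =
    (\<Sum>c\<in>corners ks \<rightarrow>\<^sub>E {..<N}. (\<Prod>x\<in>pairs. op_coeff N (s x)) * ?g * of_bool (flip_compatible N s c))"
    by (rule sum.cong[OF refl])
  also have "\<dots> = (\<Prod>x\<in>pairs. op_coeff N (s x)) * ?g *
      of_nat (card {c \<in> corners ks \<rightarrow>\<^sub>E {..<N}. flip_compatible N s c})"
    by (simp only: sum_distrib_left[symmetric] sum_of_bool_eq_card[OF fin])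
  also have "\<dots> = ?g * ((\<Prod>x\<in>pairs. op_coeff N (s x)) * of_nat N ^ card (corners ks // corner_equiv ks \<pi> s))"
    by (simp add: card_flip_compatible[OF even ops])
  also have "\<dots> = of_real ((- 1) powi (num_opposite ks \<pi> s + total_genus ks \<pi> s) *
      real N powi (- int (length ks) + total_euler ks \<pi> s))"
  proof -
    have "{x \<in> pairs. s x = Contract} = {}" using ops by auto
    then have "num_contracted_sides ks \<pi> s = 0" by (simp add: num_contracted_sides_def)
    then show ?thesis unfolding prod_op_coeff[OF N]
      by (simp add: power_int_add mult_ac)
  qed
  finally show ?thesis .
qed

end

theorem lemma4p19:
  fixes G :: lie_type and N d K :: nat
    and M :: "'w measure" and B :: "nat \<Rightarrow> 'w \<Rightarrow> real"
    and X :: "nat \<Rightarrow> complex mat" and W :: "'w \<Rightarrow> complex mat"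
    and ks :: "nat list" and \<pi> :: "nat \<Rightarrow> nat"
  assumes "N \<ge> 1" and "G = Sp \<Longrightarrow> even N"
    and "prob_space M"
    and "lie_orthonormal_basis G N d X"
    and "std_gaussian_family M d B"
    and "\<And>\<omega>. W \<omega> = real_lincomb N d (\<lambda>j. B j \<omega>) X"
    and "length ks \<ge> 1" and "sum_list ks = 2 * K"
    and "is_pairing (2 * K) \<pi>"
  shows "(\<Sum>a\<in>cyclic_indices N ks. pairing_bracket M \<pi> (entry_list W ks a)) =
         of_real (\<Sum>s\<in>constructions G ks \<pi>. surface_weight G N ks \<pi> s)"
proof -
  interpret paired_polygons ks \<pi> by unfold_locales (use assms(8,9) in simp)
  have cov: "(\<integral>\<omega>. W \<omega> $$ (a, b) * W \<omega> $$ (u, v) \<partial>M) = (\<Sum>w\<in>allowed_ops G. pair_weight G N w a b u v)"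
    if "a < N" "b < N" "u < N" "v < N" for a b u v
    unfolding assms(6)
    by (rule gaussian_matrix_covariance[OF assms(1) _ assms(3-5) that]) (rule assms(2))
  have fin: "finite (allowed_ops G)" by (cases G) auto
  have weight: "(\<Sum>c\<in>corners ks \<rightarrow>\<^sub>E {..<N}. \<Prod>(p, q)\<in>pairs.
      pair_weight G N (s (p, q)) (c (side p)) (c (terminal_corner ks p)) (c (side q)) (c (terminal_corner ks q))) =
    of_real (surface_weight G N ks \<pi> s)" if s: "s \<in> pairs \<rightarrow>\<^sub>E allowed_ops G" for s
  proof -
    have mem: "s x \<in> allowed_ops G" if "x \<in> pairs" for x using PiE_mem[OF s that] .
    have no_contract: "s x \<noteq> Contract" if "G \<noteq> SU" "x \<in> pairs" for x
      using mem[OF that(2)] that(1) by (cases G) auto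
    show ?thesis
    proof (cases G)
      case SO
      \<comment> \<open>Without contractions the exponent shared by SO and SU loses its term for
        contracted sides.\<close>
      then have "{x \<in> pairs. s x = Contract} = {}" using no_contract by auto
      then have "num_contracted_sides ks \<pi> s = 0" by (simp add: num_contracted_sides_def)
      then show ?thesis using sum_pair_weight_not_Sp[OF assms(1), of G s] SO by simp
    next
      case SU
      then show ?thesis using sum_pair_weight_not_Sp[OF assms(1), of G s] by simp
    next
      case Sp
      then show ?thesis using sum_pair_weight_Sp[OF assms(1), of s] assms(2) no_contract by simp
    qed
  qed
  have "(\<Sum>a\<in>cyclic_indices N ks. pairing_bracket M \<pi> (entry_list W ks a)) =
    (\<Sum>s\<in>pairs \<rightarrow>\<^sub>E allowed_ops G. \<Sum>c\<in>corners ks \<rightarrow>\<^sub>E {..<N}. \<Prod>(p, q)\<in>pairs.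
       pair_weight G N (s (p, q)) (c (side p)) (c (terminal_corner ks p)) (c (side q)) (c (terminal_corner ks q)))"
    by (rule sum_pairing_bracket[OF cov fin])
  also have "\<dots> = (\<Sum>s\<in>pairs \<rightarrow>\<^sub>E allowed_ops G. of_real (surface_weight G N ks \<pi> s))"
    by (intro sum.cong refl weight)
  finally show ?thesis by (simp add: constructions_def)
qed

end
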